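(* Let $G$ be a connected metric graph and let $D=\mathrm{diam}(G)$. Then the equality $$\mathrm{len}(G) = \Big(\mathrm{cyc}(G) + \max\big\{1, \tfrac{\ell(G)}{2}\big\}\Big)\cdot \mathrm{diam}(G)$$ holds if and only if $G$ is (isometric to) one of the following graphs, of diameter $D$: \begin{itemize} \item a $0$-Medusa graph (which has no leaves); \item a $\lambda$-Medusa graph for some $0<\lambda<D/2$ with exactly two leaves; \item a $D/2$-Medusa graph with two or more leaves. \end{itemize}
   Context: A metric graph is the compact metric space obtained from a finite collection of compact intervals (edges) of positive length by identifying their endpoints in groups (the vertices); equivalently, it is a finite edge-weighted multigraph (loops and parallel edges allowed) in which all points in the interior of each edge are included and each edge is locally isometric to an interval whose length is the edge weight. Metric graphs are assumed connected. Vertices of degree two may be inserted or removed without changing the metric graph. $d_G(x,y)$ is the minimum length of a path in $G$ from $x$ to $y$; $\mathrm{diam}(G)=\max_{x,y\in G} d_G(x,y)$ over all points of $G$; $\mathrm{len}(G)$ is the sum of the edge lengths; $\ell(G)$ is the number of leaves (vertices of degree one); $\mathrm{cyc}(G)=|E|-|V|+1$ for any combinatorial graph $(V,E)$ describing $G$. Medusa graphs. For $D>0$, $0\le\lambda\le D/2$ and integers $k,\ell\ge 0$, a $\lambda$-Medusa graph with diameter $D$, cyclomatic number $k$ and $\ell$ leaves is constructed as follows: take a base edge $uw$ of length $D-2\lambda$, add $k$ parallel edges of length $D$ connecting $u$ and $w$, and add $\ell$ leaves by adding $\ell$ pendant edges of length $\lambda$, each having one endpoint located at an arbitrary point of the (closed)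 base edge $uw$ (the attachment points may coincide or differ). The resulting graph is required to have exactly $\ell$ leaves when $\lambda>0$ (this matters only when $k=0$, where $u$ and $w$ must not be additional leaves). For $\lambda=0$ the pendant edges are absent, and the $0$-Medusa graph consists of $k+1$ parallel edges of length $D$ joining $u$ and $w$; it has no leaves when $k\ge1$. For $\lambda=D/2$ the base edge degenerates to a single point $u=w$, so the graph consists of one vertex with $k$ loops of length $D$ and $\ell$ pendant edges of length $D/2$ attached to it. *)

theory Defs
  imports Complex_Main "Graph_Theory.Digraph_Component"
begin

section \<open>Metric graphs\<close>

text \<open>
  A metric graph is given by a finite multigraph (loops and parallel arcs allowed) together with
  arc lengths. The direction of an arc \<open>e\<close> only serves to parametrise the arc by the interval
  \<open>{0..w e}\<close>, from its tail to its head; connectedness refers to the underlying undirected graph.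
\<close>

locale metric_graph = fin_digraph G
  for G :: "('v, 'e) pre_digraph" +
  fixes w :: "'e \<Rightarrow> real"
  assumes length_pos: "e \<in> arcs G \<Longrightarrow> 0 < w e"
    and arcs_nonempty: "arcs G \<noteq> {}"
    and connected: "Digraph_Component.connected G"

datatype ('v, 'e) mg_point = Vertex 'v | Inner 'e real

definition points :: "('v, 'e) pre_digraph \<Rightarrow> ('e \<Rightarrow> real) \<Rightarrow> ('v, 'e) mg_point set" where
  "points G w = Vertex ` verts G \<union> {Inner e t | e t. e \<in> arcs G \<and> 0 < t \<and> t < w e}"

text \<open>The gluing map: the point of the metric graph at coordinate \<open>t \<in> {0..w e}\<close> of arc \<open>e\<close>.\<close>

definition point_at :: "('v, 'e) pre_digraph \<Rightarrow> ('e \<Rightarrow> real) \<Rightarrow> 'e \<Rightarrow> real \<Rightarrow> ('v, 'e) mg_point" where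
  "point_at G w e t =
     (if t = 0 then Vertex (tail G e) else if t = w e then Vertex (head G e) else Inner e t)"

text \<open>
  \<open>path_length G w x y r\<close>: some path from \<open>x\<close> to \<open>y\<close>, a finite concatenation of segments
  each of which runs inside a single closed arc, has length \<open>r\<close>.
\<close>

inductive path_length ::
  "('v, 'e) pre_digraph \<Rightarrow> ('e \<Rightarrow> real) \<Rightarrow>
     ('v, 'e) mg_point \<Rightarrow> ('v, 'e) mg_point \<Rightarrow> real \<Rightarrow> bool"
  for G w x where
  trivial: "x \<in> points G w \<Longrightarrow> path_length G w x x 0"
| segment: "path_length G w x (point_at G w e s) r \<Longrightarrow> e \<in> arcs G \<Longrightarrow>
     s \<in> {0..w e} \<Longrightarrow> t \<in> {0..w e} \<Longrightarrow>
     path_length G w x (point_at G w e t) (r + \<bar>t - s\<bar>)"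

definition graph_dist ::
  "('v, 'e) pre_digraph \<Rightarrow> ('e \<Rightarrow> real) \<Rightarrow> ('v, 'e) mg_point \<Rightarrow> ('v, 'e) mg_point \<Rightarrow> real" where
  "graph_dist G w x y = Inf {r. path_length G w x y r}"

definition diam :: "('v, 'e) pre_digraph \<Rightarrow> ('e \<Rightarrow> real) \<Rightarrow> real" where
  "diam G w = Sup {graph_dist G w x y | x y. x \<in> points G w \<and> y \<in> points G w}"

definition total_length :: "('v, 'e) pre_digraph \<Rightarrow> ('e \<Rightarrow> real) \<Rightarrow> real" where
  "total_length G w = (\<Sum>e\<in>arcs G. w e)"

text \<open>The degree of a vertex is the sum of its in- and out-degree, so a loop counts twice.\<close>

definition num_leaves :: "('v, 'e) pre_digraph \<Rightarrow> nat" where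
  "num_leaves G = card {v \<in> verts G. in_degree G v + out_degree G v = 1}"

definition cyc :: "('v, 'e) pre_digraph \<Rightarrow> int" where
  "cyc G = int (card (arcs G)) - int (card (verts G)) + 1"

definition isometric ::
  "('v, 'e) pre_digraph \<Rightarrow> ('e \<Rightarrow> real) \<Rightarrow> ('v2, 'e2) pre_digraph \<Rightarrow> ('e2 \<Rightarrow> real) \<Rightarrow> bool" where
  "isometric G w H w' \<longleftrightarrow>
     (\<exists>f. bij_betw f (points G w) (points H w') \<and>
          (\<forall>x\<in>points G w. \<forall>y\<in>points G w. graph_dist H w' (f x) (f y) = graph_dist G w x y))"


section \<open>Medusa graphs\<close>

text \<open>
  The base edge is the interval \<open>{0..D - 2 * lam}\<close>, with ends \<open>Base 0\<close> and
  \<open>Base (D - 2 * lam)\<close>, subdivided at the attachment points \<open>a i\<close> of the pendant edges.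
  The arc \<open>Base_edge p\<close> runs from \<open>p\<close> to the next subdivision point. If \<open>lam = D / 2\<close>, the
  two ends coincide, there is no base edge, and the parallel edges are loops. If \<open>lam = 0\<close>, there
  are no pendant edges, whatever \<open>l\<close> is.
\<close>

datatype medusa_vertex = Base real | Leaf nat
datatype medusa_edge = Base_edge real | Parallel nat | Pendant nat

definition pendants :: "real \<Rightarrow> nat \<Rightarrow> nat set" where
  "pendants lam l = (if lam = 0 then {} else {..<l})"

definition base_points :: "real \<Rightarrow> real \<Rightarrow> nat \<Rightarrow> (nat \<Rightarrow> real) \<Rightarrow> real set" where
  "base_points D lam l a = {0, D - 2 * lam} \<union> a ` pendants lam l"

definition next_point :: "real set \<Rightarrow> real \<Rightarrow> real" where
  "next_point P p = Min {q \<in> P. p < q}"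

definition medusa ::
  "real \<Rightarrow> real \<Rightarrow> nat \<Rightarrow> nat \<Rightarrow> (nat \<Rightarrow> real) \<Rightarrow> (medusa_vertex, medusa_edge) pre_digraph" where
  "medusa D lam k l a =
     \<lparr> verts = Base ` base_points D lam l a \<union> Leaf ` pendants lam l,
       arcs = Base_edge ` (base_points D lam l a - {D - 2 * lam})
                \<union> Parallel ` {..<k} \<union> Pendant ` pendants lam l,
       tail = (\<lambda>e. case e of
                 Base_edge p \<Rightarrow> Base p
               | Parallel _ \<Rightarrow> Base 0
               | Pendant i \<Rightarrow> Base (a i)),
       head = (\<lambda>e. case e of
                 Base_edge p \<Rightarrow> Base (next_point (base_points D lam l a) p)
               | Parallel _ \<Rightarrow> Base (D - 2 * lam)
               | Pendant i \<Rightarrow> Leaf i) \<rparr>"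

definition medusa_length ::
  "real \<Rightarrow> real \<Rightarrow> nat \<Rightarrow> (nat \<Rightarrow> real) \<Rightarrow> medusa_edge \<Rightarrow> real" where
  "medusa_length D lam l a e = (case e of
       Base_edge p \<Rightarrow> next_point (base_points D lam l a) p - p
     | Parallel _ \<Rightarrow> D
     | Pendant _ \<Rightarrow> lam)"

text \<open>
  The condition on the number of leaves excludes, for \<open>k = 0\<close>, that an end of the base edge is
  an additional leaf.
\<close>

definition medusa_parameters :: "real \<Rightarrow> real \<Rightarrow> nat \<Rightarrow> nat \<Rightarrow> (nat \<Rightarrow> real) \<Rightarrow> bool" where
  "medusa_parameters D lam k l a \<longleftrightarrow>
     0 < D \<and> 0 \<le> lam \<and> lam \<le> D / 2 \<and>
     (\<forall>i<l. a i \<in> {0..D - 2 * lam}) \<and>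
     (0 < lam \<longrightarrow> num_leaves (medusa D lam k l a) = l)"

text \<open>\<open>(G, w)\<close> is a \<open>lam\<close>-Medusa graph with diameter \<open>D\<close>, cyclomatic number \<open>k\<close> and \<open>l\<close> leaves,
  up to isometry.\<close>

definition is_medusa ::
  "('v, 'e) pre_digraph \<Rightarrow> ('e \<Rightarrow> real) \<Rightarrow> real \<Rightarrow> real \<Rightarrow> nat \<Rightarrow> nat \<Rightarrow> bool" where
  "is_medusa G w D lam k l \<longleftrightarrow>
     (\<exists>a. medusa_parameters D lam k l a \<and>
          isometric G w (medusa D lam k l a) (medusa_length D lam l a))"

end

theory Submission
  imports Defs "HOL-Analysis.Analysis"
begin

text \<open>
  Fix a vertex \<open>r\<close> and the distances \<open>d(r, \<cdot>)\<close>. A shortest path tree omits exactly \<open>cyc\<close> arcs, and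
  counting arc by arc gives \<open>len + (\<Sum>v. (deg v - 2) d(r, v)) = (\<Sum>e. 2 h(e))\<close>, where \<open>e\<close> ranges over the
  omitted arcs and \<open>h(e) \<le> D\<close> is the largest distance from \<open>r\<close> to a point of \<open>e\<close>. If no vertex is a
  leaf, add this identity for two points \<open>r\<close> and \<open>q\<close> at distance \<open>D\<close>: since
  \<open>d(r, v) + d(q, v) \<ge> D\<close> and the weights \<open>deg v - 2\<close> are nonnegative with sum \<open>2 cyc - 2\<close>, the
  bound \<open>len \<le> (cyc + 1) D\<close> follows.

  If there is one leaf \<open>r\<close>, with pendant arc of length \<open>\<mu>\<close>, let \<open>q\<close> be the highest point of the omitted
  arcs. Two geodesics from \<open>q\<close> to \<open>r\<close> meet at a vertex other than \<open>r\<close>; the omitted arc that ends there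
  in a shortest path tree for \<open>q\<close> has \<open>h(e) \<le> D - \<mu>\<close>, which improves the bound to
  \<open>len \<le> (cyc + 1) D - \<mu>\<close>. With two leaves, deleting the one with the shorter pendant arc
  gives \<open>len \<le> (cyc + 1) D\<close>. With three or more leaves, one pendant arc has length at most \<open>D / 2\<close>, and
  it is deleted. In the case of equality all estimates are tight: every vertex with
  \<open>deg v > 2\<close> lies on a geodesic between the two points, all omitted arcs have length \<open>D\<close> and common ends,
  and the remaining tree is a path with pendant arcs.

  Conversely, length, cyclomatic number and number of leaves are isometry invariants: the length is the
  integral over \<open>t\<close> of the number of points at distance \<open>t\<close> from a fixed point, and this
  number for small \<open>t\<close> is the degree. So it suffices to compute them for Medusa graphs.
\<close>

text \<open>Interior points are the main obstacle: the far point \<open>q\<close> of the overview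
  need not be a vertex. It is made one by subdividing its arc; the new vertex has weight
  \<open>deg v - 2 = 0\<close>, so the weighted sums do not change. Subdivision needs fresh names,
  which is why the graph is copied to the type \<open>nat\<close>. Conversely, vertices of degree
  two are merged away, so that no vertex escapes the discussion of equality by having weight zero;
  only a circle has to keep one.

  Explicit paths are mostly avoided. A lower bound for a distance comes from a function that is
  1-Lipschitz on every arc, and a shortest path tree is just a choice of one tight arc for each
  vertex other than the root. Equality cases follow one pattern: a sum of terms of one sign
  vanishes, hence so does each term.

  Leaves have weight \<open>-1\<close>, the only negative weight, and are therefore deleted. A
  deletion can lower the diameter and create a vertex of degree two; hence the estimates for graphs
  with leaves allow any \<open>D\<close> with \<open>diam G w \<le> D\<close>, and the graph is
  reduced again afterwards.\<close>

definition joins :: "('v, 'e) pre_digraph \<Rightarrow> 'e \<Rightarrow> 'v \<Rightarrow> 'v \<Rightarrow> bool" where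
  "joins G e a b \<longleftrightarrow>
     e \<in> arcs G \<and> (tail G e = a \<and> head G e = b \<or> tail G e = b \<and> head G e = a)"

definition vdegree :: "('v, 'e) pre_digraph \<Rightarrow> 'v \<Rightarrow> nat" where
  "vdegree G v = in_degree G v + out_degree G v"

lemma joins_commute: "joins G e a b \<longleftrightarrow> joins G e b a"
  by (auto simp: joins_def)

lemma joins_arc: "joins G e a b \<Longrightarrow> e \<in> arcs G"
  by (simp add: joins_def)

lemma joins_ends: "e \<in> arcs G \<Longrightarrow> joins G e (tail G e) (head G e)"
  by (simp add: joins_def)

section \<open>Connectedness\<close>

text \<open>Sets that no arc leaves replace walks in the symmetrised graph. In this form
  connectedness serves as an induction principle over the vertices, and it is easily rechecked after
  subdividing, merging or deleting arcs.\<close>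

lemma connected_iff_no_closed_set:
  assumes "wf_digraph G"
  shows "Digraph_Component.connected G \<longleftrightarrow>
    verts G \<noteq> {} \<and> (\<forall>S. S \<subseteq> verts G \<longrightarrow> S \<noteq> {} \<longrightarrow>
      (\<forall>e\<in>arcs G. tail G e \<in> S \<longleftrightarrow> head G e \<in> S) \<longrightarrow> S = verts G)"
proof -
  interpret wf_digraph G by fact
  let ?H = "with_proj (mk_symmetric G)"
  have vH: "verts ?H = verts G" by simp
  have aH: "arcs_ends ?H = (\<Union>e\<in>arcs G. {(tail G e, head G e), (head G e, tail G e)})"
    by (simp add: parcs_mk_symmetric arcs_ends_def arc_to_ends_def)
  show ?thesis
  proof (intro iffI conjI allI impI)
    assume "Digraph_Component.connected G"
    then show "verts G \<noteq> {}"
      by (simp add: connected_def strongly_connected_def)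
  next
    fix S assume con: "Digraph_Component.connected G" and S: "S \<subseteq> verts G" "S \<noteq> {}"
      and closed: "\<forall>e\<in>arcs G. (tail G e \<in> S) = (head G e \<in> S)"
    from S obtain u where u: "u \<in> S" by blast
    have "v \<in> S" if "v \<in> verts G" for v
    proof -
      have "(u, v) \<in> rtrancl_on (verts G) (arcs_ends ?H)"
        using con u S that vH by (auto simp: connected_def strongly_connected_def reachable_def)
      then show "v \<in> S"
        by (induction rule: rtrancl_on_induct) (use u closed aH in auto)
    qed
    then show "S = verts G" using S by blast
  next
    assume *: "verts G \<noteq> {} \<and> (\<forall>S. S \<subseteq> verts G \<longrightarrow> S \<noteq> {} \<longrightarrow>
      (\<forall>e\<in>arcs G. tail G e \<in> S \<longleftrightarrow> head G e \<in> S) \<longrightarrow> S = verts G)"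
    have "reachable ?H u v" if u: "u \<in> verts G" and v: "v \<in> verts G" for u v
    proof -
      let ?S = "{v \<in> verts G. reachable ?H u v}"
      have step: "reachable ?H u b" if "reachable ?H u a" "(a, b) \<in> arcs_ends ?H" "b \<in> verts G" for a b
        using that unfolding reachable_def
        by (metis rtrancl_on_into_rtrancl_on vH)
      have "?S = verts G"
      proof (rule *[THEN conjunct2, rule_format])
        show "?S \<noteq> {}" using u by (auto simp: reachable_def)
        fix e assume e: "e \<in> arcs G"
        then have "(tail G e, head G e) \<in> arcs_ends ?H" "(head G e, tail G e) \<in> arcs_ends ?H"
          unfolding aH by auto
        with e step show "tail G e \<in> ?S \<longleftrightarrow> head G e \<in> ?S" by auto
      qed auto
      with v show ?thesis by auto
    qed
    then show "Digraph_Component.connected G"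
      using * vH by (auto simp: connected_def strongly_connected_def)
  qed
qed

lemma metric_graphI:
  assumes "finite (verts G)" "finite (arcs G)" "arcs G \<noteq> {}"
    and "\<And>e. e \<in> arcs G \<Longrightarrow> tail G e \<in> verts G"
    and "\<And>e. e \<in> arcs G \<Longrightarrow> head G e \<in> verts G"
    and "\<And>e. e \<in> arcs G \<Longrightarrow> 0 < w e"
    and "\<And>S. S \<subseteq> verts G \<Longrightarrow> S \<noteq> {} \<Longrightarrow>
      (\<And>e. e \<in> arcs G \<Longrightarrow> tail G e \<in> S \<longleftrightarrow> head G e \<in> S) \<Longrightarrow> S = verts G"
  shows "metric_graph G w"
proof -
  have wf: "wf_digraph G" using assms by unfold_locales auto
  have "verts G \<noteq> {}" using assms(3,4) by blast
  with assms(7) have "Digraph_Component.connected G"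
    by (subst connected_iff_no_closed_set[OF wf]) auto
  with assms wf show ?thesis
    by (intro metric_graph.intro fin_digraph.intro) (auto intro!: fin_digraph_axioms.intro metric_graph_axioms.intro)
qed

context metric_graph
begin

lemma closed_set_eq_verts:
  assumes "S \<subseteq> verts G" "S \<noteq> {}"
    and "\<And>e. e \<in> arcs G \<Longrightarrow> tail G e \<in> S \<longleftrightarrow> head G e \<in> S"
  shows "S = verts G"
  using connected assms connected_iff_no_closed_set[OF wf_digraph_axioms] by blast

lemma joins_verts: "joins G e a b \<Longrightarrow> a \<in> verts G \<and> b \<in> verts G"
  by (auto simp: joins_def)

lemma verts_nonempty: "verts G \<noteq> {}"
  using arcs_nonempty tail_in_verts by blast

text \<open>A vertex without arcs would be a closed set, hence the only vertex; but some arc exists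
  and would have to be a loop there.\<close>

lemma incident_arc:
  assumes "v \<in> verts G"
  obtains e u where "joins G e u v"
proof -
  have "\<exists>e u. joins G e u v"
  proof (rule ccontr)
    assume no: "\<nexists>e u. joins G e u v"
    have "{v} = verts G"
      by (rule closed_set_eq_verts) (use assms no in \<open>auto simp: joins_def\<close>)
    moreover obtain e where "e \<in> arcs G" using arcs_nonempty by blast
    ultimately have "joins G e v v"
      using tail_in_verts[of e] head_in_verts[of e] unfolding joins_def by blast
    with no show False by blast
  qed
  then show thesis using that by blast
qed

section \<open>Path lengths and distances\<close>

abbreviation pt where "pt \<equiv> point_at G w"
abbreviation gd where "gd \<equiv> graph_dist G w"
abbreviation vd where "vd u v \<equiv> graph_dist G w (Vertex u) (Vertex v)"

lemma pt_0 [simp]: "pt e 0 = Vertex (tail G e)"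
  by (simp add: point_at_def)

lemma pt_w [simp]: "e \<in> arcs G \<Longrightarrow> pt e (w e) = Vertex (head G e)"
  using length_pos[of e] by (simp add: point_at_def)

lemma pt_in_points: "e \<in> arcs G \<Longrightarrow> t \<in> {0..w e} \<Longrightarrow> pt e t \<in> points G w"
  by (auto simp: point_at_def points_def)

lemma Vertex_in_points [simp]: "Vertex v \<in> points G w \<longleftrightarrow> v \<in> verts G"
  by (auto simp: points_def)

lemma path_length_points:
  "path_length G w x y r \<Longrightarrow> x \<in> points G w \<and> y \<in> points G w \<and> 0 \<le> r"
  by (induction rule: path_length.induct) (auto intro: pt_in_points)

lemma path_length_trans:
  assumes "path_length G w y z s" "path_length G w x y r"
  shows "path_length G w x z (r + s)"
  using assms
  by (induction rule: path_length.induct) (auto simp: add.assoc[symmetric] intro: path_length.segment)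

lemma path_length_segment:
  assumes "e \<in> arcs G" "s \<in> {0..w e}" "t \<in> {0..w e}"
  shows "path_length G w (pt e s) (pt e t) \<bar>t - s\<bar>"
  using path_length.segment[OF path_length.trivial[OF pt_in_points] assms(1) assms(2) assms(3)] assms
  by simp

lemma path_length_sym: "path_length G w x y r \<Longrightarrow> path_length G w y x r"
proof (induction rule: path_length.induct)
  case trivial
  then show ?case by (rule path_length.trivial)
next
  case (segment e s r t)
  show ?case
    using path_length_trans[OF segment.IH path_length_segment[of e t s]] segment.hyps
    by (simp add: abs_minus_commute add.commute)
qed

text \<open>Vertices are included as ends of arcs, so that statements about all points can be proved
  for \<open>pt e t\<close> alone.\<close>

lemma point_cases:
  assumes "p \<in> points G w"
  obtains e t where "e \<in> arcs G" "t \<in> {0..w e}" "p = pt e t"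
proof (cases p)
  case (Vertex v)
  then obtain e u where e: "joins G e u v"
    using assms incident_arc by auto
  then have "e \<in> arcs G" "p = pt e 0 \<or> p = pt e (w e)"
    using Vertex by (auto simp: joins_def)
  then show ?thesis using that[of e 0] that[of e "w e"] length_pos[of e] by auto
next
  case (Inner e t)
  then have "e \<in> arcs G" "0 < t" "t < w e" using assms by (auto simp: points_def)
  then show ?thesis using that[of e t] Inner by (simp add: point_at_def)
qed

lemma path_exists_vertices:
  assumes "u \<in> verts G" "v \<in> verts G"
  shows "\<exists>r. path_length G w (Vertex u) (Vertex v) r"
proof -
  let ?S = "{v \<in> verts G. \<exists>r. path_length G w (Vertex u) (Vertex v) r}"
  have "?S = verts G"
  proof (rule closed_set_eq_verts)
    show "?S \<noteq> {}" using assms(1) path_length.trivial[of "Vertex u" G w] by auto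
    fix e assume e: "e \<in> arcs G"
    then have "path_length G w (Vertex (tail G e)) (Vertex (head G e)) (w e)"
      using path_length_segment[of e 0 "w e"] length_pos[of e] by simp
    with e path_length_trans path_length_sym
    show "tail G e \<in> ?S \<longleftrightarrow> head G e \<in> ?S"
      by auto blast+
  qed auto
  with assms(2) show ?thesis by blast
qed

lemma path_exists:
  assumes "x \<in> points G w" "y \<in> points G w"
  shows "\<exists>r. path_length G w x y r"
proof -
  have "\<exists>v\<in>verts G. \<exists>r. path_length G w (Vertex v) z r" if z: "z \<in> points G w" for z
  proof -
    obtain e t where et: "e \<in> arcs G" "t \<in> {0..w e}" "z = pt e t" using point_cases[OF z] .
    then show ?thesis
      using path_length_segment[of e 0 t] length_pos[of e] tail_in_verts[of e] by auto
  qed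
  then obtain u v r s where uv: "u \<in> verts G" "v \<in> verts G"
    "path_length G w (Vertex u) x r" "path_length G w (Vertex v) y s" using assms by meson
  with path_exists_vertices obtain q where "path_length G w (Vertex u) (Vertex v) q" by blast
  with uv path_length_trans path_length_sym show ?thesis by meson
qed

lemma dist_le_path: "path_length G w x y r \<Longrightarrow> gd x y \<le> r"
  unfolding graph_dist_def
  by (rule cInf_lower) (auto intro!: bdd_belowI[of _ 0] dest: path_length_points)

lemma le_dist:
  assumes "x \<in> points G w" "y \<in> points G w" "\<And>r. path_length G w x y r \<Longrightarrow> c \<le> r"
  shows "c \<le> gd x y"
  unfolding graph_dist_def
  by (rule cInf_greatest) (use assms path_exists in auto)

lemma dist_nonneg: "x \<in> points G w \<Longrightarrow> y \<in> points G w \<Longrightarrow> 0 \<le> gd x y"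
  by (rule le_dist) (auto dest: path_length_points)

lemma dist_self [simp]: "x \<in> points G w \<Longrightarrow> gd x x = 0"
  using dist_le_path[OF path_length.trivial] dist_nonneg[of x x] by force

lemma dist_commute: "gd x y = gd y x"
proof -
  have "{r. path_length G w x y r} = {r. path_length G w y x r}" using path_length_sym by blast
  then show ?thesis by (simp add: graph_dist_def)
qed

lemma dist_triangle:
  assumes "x \<in> points G w" "y \<in> points G w" "z \<in> points G w"
  shows "gd x z \<le> gd x y + gd y z"
proof -
  have "gd x z - r \<le> gd y z" if r: "path_length G w x y r" for r
    by (rule le_dist) (use assms dist_le_path[OF path_length_trans[OF _ r]] in force)+
  then have "gd x z - gd y z \<le> gd x y"
    by (intro le_dist) (use assms in force)+
  then show ?thesis by simp
qed

lemma dist_segment: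
  "e \<in> arcs G \<Longrightarrow> s \<in> {0..w e} \<Longrightarrow> t \<in> {0..w e} \<Longrightarrow> gd (pt e s) (pt e t) \<le> \<bar>s - t\<bar>"
  using dist_le_path[OF path_length_segment[of e s t]] by (simp add: abs_minus_commute)

text \<open>Duality: along a path, a function that is 1-Lipschitz on every arc grows by at most the
  length. Lower bounds for distances are thus a matter of choosing \<open>\<phi>\<close>.\<close>

lemma dist_ge_potential:
  assumes lip: "\<And>e s t. e \<in> arcs G \<Longrightarrow> s \<in> {0..w e} \<Longrightarrow> t \<in> {0..w e} \<Longrightarrow>
      \<bar>\<phi> (pt e s) - \<phi> (pt e t)\<bar> \<le> \<bar>s - t\<bar>"
    and "x \<in> points G w" "y \<in> points G w"
  shows "\<phi> y - \<phi> x \<le> gd x y"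
proof -
  have "\<phi> y - \<phi> x \<le> r" if "path_length G w x y r" for r
    using that
  proof (induction rule: path_length.induct)
    case (segment e s r t)
    then show ?case using lip[of e s t] by force
  qed simp
  with assms show ?thesis by (intro le_dist) auto
qed

text \<open>By induction on a path, with the triangle inequality in the target; so contraction has
  to be checked inside single arcs only.\<close>

lemma dist_map_le:
  assumes H: "metric_graph H w'"
    and pts: "\<And>x. x \<in> points G w \<Longrightarrow> f x \<in> points H w'"
    and lip: "\<And>e s t. e \<in> arcs G \<Longrightarrow> s \<in> {0..w e} \<Longrightarrow> t \<in> {0..w e} \<Longrightarrow>
      graph_dist H w' (f (pt e s)) (f (pt e t)) \<le> \<bar>s - t\<bar>"
    and x: "x \<in> points G w" and y: "y \<in> points G w"
  shows "graph_dist H w' (f x) (f y) \<le> gd x y"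
proof -
  interpret H: metric_graph H w' by fact
  have "graph_dist H w' (f x) (f y) \<le> r" if "path_length G w x y r" for r
    using that
  proof (induction rule: path_length.induct)
    case (segment e s r t)
    have "x \<in> points G w" "pt e s \<in> points G w" "pt e t \<in> points G w"
      using segment path_length_points pt_in_points by blast+
    then have "graph_dist H w' (f x) (f (pt e t))
        \<le> graph_dist H w' (f x) (f (pt e s)) + graph_dist H w' (f (pt e s)) (f (pt e t))"
      using pts by (intro H.dist_triangle) auto
    with segment lip[of e s t] show ?case by (simp add: abs_minus_commute)
  qed (use pts in simp)
  with x y show ?thesis by (intro le_dist) auto
qed

lemma dist_vertex_ge_potential:
  assumes lip: "\<And>e. e \<in> arcs G \<Longrightarrow> \<bar>g (tail G e) - g (head G e)\<bar> \<le> w e"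
    and r: "r \<in> verts G" and e: "e \<in> arcs G" and t: "t \<in> {0..w e}"
  shows "min (g (tail G e) + t) (g (head G e) + w e - t) - g r \<le> gd (Vertex r) (pt e t)"
proof -
  \<comment> \<open>The largest 1-Lipschitz extension of \<open>g\<close> to the interior of each
    arc.\<close>
  define \<phi> where "\<phi> p = (case p of Vertex v \<Rightarrow> g v
    | Inner e t \<Rightarrow> min (g (tail G e) + t) (g (head G e) + w e - t))" for p
  have \<phi>: "\<phi> (pt e t) = min (g (tail G e) + t) (g (head G e) + w e - t)"
    if "e \<in> arcs G" "t \<in> {0..w e}" for e t
    using lip[OF that(1)] length_pos[OF that(1)] by (auto simp: point_at_def \<phi>_def min_def)
  have "\<phi> (pt e t) - \<phi> (Vertex r) \<le> gd (Vertex r) (pt e t)"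
    by (rule dist_ge_potential) (use r e t pt_in_points in \<open>auto simp: \<phi> min_def\<close>)
  with e t show ?thesis by (simp add: \<phi>) (simp add: \<phi>_def)
qed

lemma dist_vertices_ge_potential:
  assumes lip: "\<And>e. e \<in> arcs G \<Longrightarrow> \<bar>g (tail G e) - g (head G e)\<bar> \<le> w e"
    and r: "r \<in> verts G" and v: "v \<in> verts G"
  shows "g v - g r \<le> vd r v"
proof -
  obtain e u where e: "joins G e u v" using incident_arc[OF v] .
  then have "e \<in> arcs G" by (simp add: joins_def)
  with e length_pos[of e] lip[of e] dist_vertex_ge_potential[of g r e 0, OF lip r]
    dist_vertex_ge_potential[of g r e "w e", OF lip r]
  show ?thesis by (auto simp: joins_def min_def split: if_splits)
qed

lemma dist_arc:
  assumes "joins G e u v" "r \<in> verts G" shows "vd r v \<le> vd r u + w e"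
proof -
  have e: "e \<in> arcs G" and uv: "u \<in> verts G" "v \<in> verts G"
    using assms joins_verts by (auto simp: joins_def)
  have "vd u v \<le> w e"
    using e assms(1) dist_segment[of e 0 "w e"] dist_segment[of e "w e" 0] length_pos[OF e]
    by (auto simp: joins_def)
  then show ?thesis
    using dist_triangle[of "Vertex r" "Vertex u" "Vertex v"] uv assms(2) by simp
qed

lemma dist_arc_abs:
  assumes "joins G e u v" "r \<in> verts G" shows "\<bar>vd r u - vd r v\<bar> \<le> w e"
  using dist_arc[OF assms] dist_arc[of e v u r] assms joins_commute[of G e] by force

text \<open>If no arc at \<open>v\<close> were tight, the distance function could be raised at \<open>v\<close>.\<close>

lemma dist_parent:
  assumes r: "r \<in> verts G" and v: "v \<in> verts G" and "v \<noteq> r"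
  shows "\<exists>e u. joins G e u v \<and> vd r v = vd r u + w e"
proof (rule ccontr)
  assume no: "\<not> ?thesis"
  let ?A = "{e \<in> arcs G. tail G e = v \<or> head G e = v}"
  \<comment> \<open>The slack of an arc at \<open>v\<close>; a loop at \<open>v\<close> has slack
    \<open>w e\<close>.\<close>
  let ?s = "\<lambda>e. if tail G e = v then vd r (head G e) + w e - vd r v
    else vd r (tail G e) + w e - vd r v"
  have fin: "finite ?A" by simp
  have "?A \<noteq> {}" using incident_arc[OF v] by (auto simp: joins_def)
  have pos: "0 < ?s e" if "e \<in> ?A" for e
  proof -
    have "joins G e (if tail G e = v then head G e else tail G e) v"
      using that by (auto simp: joins_def)
    with no dist_arc[OF this r] show ?thesis by (auto split: if_splits) force+
  qed
  define \<epsilon> where "\<epsilon> = Min (?s ` ?A)"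
  have \<epsilon>0: "0 < \<epsilon>"
    unfolding \<epsilon>_def using fin \<open>?A \<noteq> {}\<close> pos by (subst Min_gr_iff) (blast, blast, fast)
  have \<epsilon>: "\<epsilon> \<le> ?s e" if "e \<in> ?A" for e
    unfolding \<epsilon>_def using that fin by (intro Min_le) auto
  define g where "g = (\<lambda>u. vd r u)(v := vd r v + \<epsilon>)"
  have "\<bar>g (tail G e) - g (head G e)\<bar> \<le> w e" if e: "e \<in> arcs G" for e
    using dist_arc_abs[OF joins_ends[OF e] r] \<epsilon>[of e] \<epsilon>0 e length_pos[OF e]
    by (auto simp: g_def split: if_splits)
  from dist_vertices_ge_potential[OF this r v] \<epsilon>0 r \<open>v \<noteq> r\<close> show False
    by (simp add: g_def)
qed

lemma vd_nonneg: "u \<in> verts G \<Longrightarrow> v \<in> verts G \<Longrightarrow> 0 \<le> vd u v"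
  by (rule dist_nonneg) auto

lemma vd_commute: "vd u v = vd v u"
  by (rule dist_commute)

lemma vd_pos:
  assumes "u \<in> verts G" "v \<in> verts G" "u \<noteq> v" shows "0 < vd u v"
proof -
  obtain e a where "joins G e a v" "vd u v = vd u a + w e"
    using dist_parent[of u v] assms by auto
  then show ?thesis using length_pos[of e] joins_verts[of e a v] vd_nonneg[of u a] assms
    by (auto simp: joins_def)
qed

lemma vd_triangle:
  "u \<in> verts G \<Longrightarrow> v \<in> verts G \<Longrightarrow> x \<in> verts G \<Longrightarrow> vd u x \<le> vd u v + vd v x"
  by (rule dist_triangle) auto

text \<open>\<open>vd r\<close> is itself an admissible potential, which gives the lower bound; the
  upper bound is the shorter of the routes through the two ends.\<close>

lemma dist_point_at:
  assumes r: "r \<in> verts G" and e: "e \<in> arcs G" and t: "t \<in> {0..w e}"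
  shows "gd (Vertex r) (pt e t) = min (vd r (tail G e) + t) (vd r (head G e) + w e - t)"
proof (rule antisym)
  show "min (vd r (tail G e) + t) (vd r (head G e) + w e - t) \<le> gd (Vertex r) (pt e t)"
    using dist_vertex_ge_potential[of "\<lambda>v. vd r v", OF _ r e t] dist_arc_abs[OF joins_ends r] r
    by simp
  have p: "Vertex r \<in> points G w" "pt e t \<in> points G w" using r e t pt_in_points by auto
  have "gd (Vertex r) (pt e t) \<le> vd r (tail G e) + t"
    using dist_triangle[OF p(1) _ p(2), of "Vertex (tail G e)"] dist_segment[OF e _ t, of 0] e t by simp
  moreover have "gd (Vertex r) (pt e t) \<le> vd r (head G e) + (w e - t)"
    using dist_triangle[OF p(1) _ p(2), of "Vertex (head G e)"] dist_segment[OF e _ t, of "w e"] e t by simp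
  ultimately show "gd (Vertex r) (pt e t) \<le> min (vd r (tail G e) + t) (vd r (head G e) + w e - t)"
    by simp
qed

section \<open>The diameter\<close>

lemma dist_bounded: "\<exists>B. \<forall>x\<in>points G w. \<forall>y\<in>points G w. gd x y \<le> B"
proof -
  obtain r where r: "r \<in> verts G" using verts_nonempty by blast
  let ?C = "(\<Sum>v\<in>verts G. vd r v) + (\<Sum>e\<in>arcs G. w e)"
  have b: "gd (Vertex r) p \<le> ?C" if p: "p \<in> points G w" for p
  proof -
    obtain e t where et: "e \<in> arcs G" "t \<in> {0..w e}" "p = pt e t" using point_cases[OF p] .
    have "vd r (tail G e) \<le> (\<Sum>v\<in>verts G. vd r v)"
      by (rule member_le_sum) (use et r vd_nonneg in auto)
    moreover have "w e \<le> (\<Sum>e\<in>arcs G. w e)"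
      by (rule member_le_sum) (use et length_pos in \<open>auto intro: less_imp_le\<close>)
    ultimately show ?thesis using et dist_point_at[OF r et(1,2)] by (simp add: min_le_iff_disj)
  qed
  have "gd x y \<le> ?C + ?C" if "x \<in> points G w" "y \<in> points G w" for x y
    using dist_triangle[of x "Vertex r" y] dist_commute[of x "Vertex r"] that r b[of x] b[of y] by simp
  then show ?thesis by blast
qed

lemma dist_le_diam: "x \<in> points G w \<Longrightarrow> y \<in> points G w \<Longrightarrow> gd x y \<le> diam G w"
  unfolding diam_def using dist_bounded by (intro cSup_upper) (auto simp: bdd_above_def)

lemma diam_le:
  assumes "\<And>x y. x \<in> points G w \<Longrightarrow> y \<in> points G w \<Longrightarrow> gd x y \<le> B"
  shows "diam G w \<le> B"
proof -
  obtain v where "v \<in> verts G" using verts_nonempty by blast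
  then have "Vertex v \<in> points G w" by simp
  then show ?thesis unfolding diam_def by (intro cSup_least) (use assms in blast)+
qed

text \<open>Twice the largest distance from \<open>r\<close> to a point of the arc \<open>e\<close>.\<close>

definition height2 :: "'v \<Rightarrow> 'e \<Rightarrow> real" where
  "height2 r e = vd r (tail G e) + vd r (head G e) + w e"

text \<open>At the coordinate \<open>t\<close> the routes from \<open>r\<close> through the two ends
  of \<open>e\<close> are equally long, so the minimum in \<open>dist_point_at\<close> is largest
  there.\<close>

lemma top_point:
  assumes r: "r \<in> verts G" and e: "e \<in> arcs G"
  defines "t \<equiv> (vd r (head G e) - vd r (tail G e) + w e) / 2"
  shows "t \<in> {0..w e}" "gd (Vertex r) (pt e t) = height2 r e / 2"
proof -
  show t: "t \<in> {0..w e}"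
    using dist_arc_abs[OF joins_ends[OF e] r] by (auto simp: t_def field_simps abs_le_iff)
  show "gd (Vertex r) (pt e t) = height2 r e / 2"
    by (subst dist_point_at[OF r e t]) (simp add: t_def height2_def field_simps)
qed

lemma height2_le_diam:
  assumes "r \<in> verts G" "e \<in> arcs G" shows "height2 r e \<le> 2 * diam G w"
  using dist_le_diam[of "Vertex r" "pt e ((vd r (head G e) - vd r (tail G e) + w e) / 2)"]
    top_point[OF assms] pt_in_points[OF assms(2)] assms by simp

lemma vd_le_diam: "u \<in> verts G \<Longrightarrow> v \<in> verts G \<Longrightarrow> vd u v \<le> diam G w"
  by (rule dist_le_diam) auto

lemma diam_pos: "0 < diam G w"
proof -
  obtain e where e: "e \<in> arcs G" using arcs_nonempty by blast
  with height2_le_diam[of "tail G e" e] length_pos[of e] vd_nonneg[of "tail G e" "head G e"]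
  show ?thesis by (simp add: height2_def)
qed

end

section \<open>Isometries\<close>

text \<open>\<open>isometric\<close> hides the map, but later arguments have to know where it sends
  vertices.\<close>

definition isometry_map ::
  "('v, 'e) pre_digraph \<Rightarrow> ('e \<Rightarrow> real) \<Rightarrow> ('v2, 'e2) pre_digraph \<Rightarrow> ('e2 \<Rightarrow> real) \<Rightarrow>
     (('v, 'e) mg_point \<Rightarrow> ('v2, 'e2) mg_point) \<Rightarrow> bool" where
  "isometry_map G w H w' f \<longleftrightarrow> bij_betw f (points G w) (points H w') \<and>
     (\<forall>x\<in>points G w. \<forall>y\<in>points G w. graph_dist H w' (f x) (f y) = graph_dist G w x y)"

lemma isometric_iff: "isometric G w H w' \<longleftrightarrow> (\<exists>f. isometry_map G w H w' f)"
  by (simp add: isometric_def isometry_map_def)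

lemma isometry_map_inv:
  assumes "isometry_map G w H w' f"
  shows "isometry_map H w' G w (inv_into (points G w) f)"
proof -
  let ?g = "inv_into (points G w) f"
  have bij: "bij_betw f (points G w) (points H w')" using assms by (simp add: isometry_map_def)
  then have "?g y \<in> points G w" "f (?g y) = y" if "y \<in> points H w'" for y
    using that by (auto simp: bij_betw_def inv_into_into f_inv_into_f)
  then show ?thesis
    using assms bij_betw_inv_into[OF bij] unfolding isometry_map_def by metis
qed

lemma isometry_map_comp:
  assumes "isometry_map G w H w' f" "isometry_map H w' K w'' g"
  shows "isometry_map G w K w'' (g \<circ> f)"
  using assms bij_betw_trans unfolding isometry_map_def
  by (metis (no_types, lifting) bij_betwE comp_apply)

lemma isometric_refl: "isometric G w G w"
  unfolding isometric_def by (rule exI[of _ id]) simp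

lemma isometric_sym: "isometric G w H w' \<Longrightarrow> isometric H w' G w"
  using isometry_map_inv isometric_iff by metis

lemma isometric_trans: "isometric G w H w' \<Longrightarrow> isometric H w' K w'' \<Longrightarrow> isometric G w K w''"
  using isometry_map_comp isometric_iff by metis

lemma isometric_diam:
  assumes "isometric G w H w'" shows "diam H w' = diam G w"
proof -
  obtain f where f: "bij_betw f (points G w) (points H w')"
    "\<forall>x\<in>points G w. \<forall>y\<in>points G w. graph_dist H w' (f x) (f y) = graph_dist G w x y"
    using assms by (auto simp: isometric_def)
  then have "points H w' = f ` points G w" by (simp add: bij_betw_def)
  with f have "{graph_dist H w' x y | x y. x \<in> points H w' \<and> y \<in> points H w'}
      = {graph_dist G w x y | x y. x \<in> points G w \<and> y \<in> points G w}"
    by auto (metis imageI)+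
  then show ?thesis by (simp add: diam_def)
qed

text \<open>The inverse map need not be given explicitly: lifting any two points of one arc of
  \<open>H\<close> to points of \<open>G\<close> at distance at most
  \<open>\<bar>s - t\<bar>\<close> yields surjectivity and shows the inverse to be
  1-Lipschitz.\<close>

lemma isometry_mapI:
  assumes G: "metric_graph G w" and H: "metric_graph H w'"
    and pts: "\<And>x. x \<in> points G w \<Longrightarrow> f x \<in> points H w'"
    and inj: "inj_on f (points G w)"
    and lip: "\<And>e s t. e \<in> arcs G \<Longrightarrow> s \<in> {0..w e} \<Longrightarrow> t \<in> {0..w e} \<Longrightarrow>
      graph_dist H w' (f (point_at G w e s)) (f (point_at G w e t)) \<le> \<bar>s - t\<bar>"
    and lip': "\<And>a s t. a \<in> arcs H \<Longrightarrow> s \<in> {0..w' a} \<Longrightarrow> t \<in> {0..w' a} \<Longrightarrow>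
      \<exists>x\<in>points G w. \<exists>y\<in>points G w. f x = point_at H w' a s \<and> f y = point_at H w' a t
        \<and> graph_dist G w x y \<le> \<bar>s - t\<bar>"
  shows "isometry_map G w H w' f"
proof -
  interpret G: metric_graph G w by fact
  interpret H: metric_graph H w' by fact
  have "y \<in> f ` points G w" if "y \<in> points H w'" for y
    using H.point_cases[OF that] lip' by (metis imageI)
  with pts inj have bij: "bij_betw f (points G w) (points H w')"
    by (auto simp: bij_betw_def)
  let ?g = "inv_into (points G w) f"
  have g: "?g (f x) = x" if "x \<in> points G w" for x
    using inj that by simp
  have 1: "graph_dist H w' (f x) (f y) \<le> graph_dist G w x y"
    if "x \<in> points G w" "y \<in> points G w" for x y
    by (rule G.dist_map_le[OF H]) (use pts lip that in auto)
  have 2: "graph_dist G w (?g x) (?g y) \<le> graph_dist H w' x y"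
    if "x \<in> points H w'" "y \<in> points H w'" for x y
  proof (rule H.dist_map_le[OF G])
    show "?g x \<in> points G w" if "x \<in> points H w'" for x
      using that bij by (metis bij_betw_def inv_into_into)
    fix a s t assume "a \<in> arcs H" "s \<in> {0..w' a}" "t \<in> {0..w' a}"
    then obtain x y where "x \<in> points G w" "y \<in> points G w" "f x = point_at H w' a s"
      "f y = point_at H w' a t" "graph_dist G w x y \<le> \<bar>s - t\<bar>" using lip' by blast
    then show "graph_dist G w (?g (point_at H w' a s)) (?g (point_at H w' a t)) \<le> \<bar>s - t\<bar>"
      using g[of x] g[of y] by simp
  qed (use that in auto)
  show ?thesis
    unfolding isometry_map_def
  proof (intro conjI ballI bij)
    fix x y assume xy: "x \<in> points G w" "y \<in> points G w"
    then show "graph_dist H w' (f x) (f y) = graph_dist G w x y"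
      using 1[OF xy] 2[OF pts[OF xy(1)] pts[OF xy(2)]] g by simp
  qed
qed

lemma relabel_isometry:
  assumes G: "metric_graph G w" and H: "metric_graph H w'"
    and \<phi>: "bij_betw \<phi> (verts G) (verts H)" and \<psi>: "bij_betw \<psi> (arcs G) (arcs H)"
    and len: "\<And>e. e \<in> arcs G \<Longrightarrow> w' (\<psi> e) = w e"
    and ends: "\<And>e. e \<in> arcs G \<Longrightarrow> joins H (\<psi> e) (\<phi> (tail G e)) (\<phi> (head G e))"
  obtains f where "isometry_map G w H w' f" "\<And>v. f (Vertex v) = Vertex (\<phi> v)"
proof -
  interpret G: metric_graph G w by fact
  interpret H: metric_graph H w' by fact
  \<comment> \<open>The relabelling may reverse an arc; its coordinate then becomes
    \<open>w e - t\<close>.\<close>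
  define same where "same e \<longleftrightarrow> tail H (\<psi> e) = \<phi> (tail G e) \<and> head H (\<psi> e) = \<phi> (head G e)" for e
  define c where "c e t = (if same e then t else w e - t)" for e t
  define f where "f p = (case p of Vertex v \<Rightarrow> Vertex (\<phi> v) | Inner e t \<Rightarrow> Inner (\<psi> e) (c e t))" for p
  have \<psi>H: "\<psi> e \<in> arcs H" if "e \<in> arcs G" for e using \<psi> that by (auto simp: bij_betw_def)
  have f_pt: "f (point_at G w e t) = point_at H w' (\<psi> e) (c e t)"
    if "e \<in> arcs G" "t \<in> {0..w e}" for e t
    using that len[OF that(1)] ends[OF that(1)] G.length_pos[OF that(1)]
    by (auto simp: point_at_def f_def c_def same_def joins_def)
  have c: "c e t \<in> {0..w e}" "c e (c e t) = t" "\<bar>c e s - c e t\<bar> = \<bar>s - t\<bar>"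
    if "t \<in> {0..w e}" for e s t
    using that by (auto simp: c_def)
  have "isometry_map G w H w' f"
  proof (rule isometry_mapI[OF G H])
    show "f x \<in> points H w'" if "x \<in> points G w" for x
      using G.point_cases[OF that] f_pt c len \<psi>H H.pt_in_points by metis
    show "inj_on f (points G w)"
    proof (rule inj_onI)
      fix x y assume xy: "x \<in> points G w" "y \<in> points G w" "f x = f y"
      have i: "inj_on \<phi> (verts G)" "inj_on \<psi> (arcs G)"
        using \<phi> \<psi> by (auto simp: bij_betw_def)
      show "x = y"
      proof (cases x)
        case (Vertex u)
        then obtain v where "y = Vertex v" using xy(3) by (cases y) (auto simp: f_def)
        with Vertex xy i(1) show ?thesis by (simp add: f_def inj_on_eq_iff)
      next
        case (Inner a r)
        then obtain b t where b: "y = Inner b t" using xy(3) by (cases y) (auto simp: f_def)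
        have "a \<in> arcs G" "b \<in> arcs G" "\<psi> a = \<psi> b" "c a r = c b t"
          using xy b Inner by (auto simp: f_def points_def)
        moreover from this have "a = b" using i(2) by (simp add: inj_on_eq_iff)
        ultimately show ?thesis using b Inner by (auto simp: c_def split: if_splits)
      qed
    qed
    show "graph_dist H w' (f (point_at G w e s)) (f (point_at G w e t)) \<le> \<bar>s - t\<bar>"
      if "e \<in> arcs G" "s \<in> {0..w e}" "t \<in> {0..w e}" for e s t
      using H.dist_segment[OF \<psi>H, of e "c e s" "c e t"] that f_pt c len by simp
    show "\<exists>x\<in>points G w. \<exists>y\<in>points G w. f x = point_at H w' a s \<and> f y = point_at H w' a t
        \<and> graph_dist G w x y \<le> \<bar>s - t\<bar>"
      if "a \<in> arcs H" "s \<in> {0..w' a}" "t \<in> {0..w' a}" for a s t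
    proof -
      have "a \<in> \<psi> ` arcs G" using \<psi> that(1) by (simp add: bij_betw_def)
      then obtain e where e: "e \<in> arcs G" "a = \<psi> e" by blast
      then have st: "s \<in> {0..w e}" "t \<in> {0..w e}" using that len by auto
      show ?thesis
        using G.dist_segment[OF e(1), of "c e s" "c e t"] f_pt[OF e(1)] c[OF st(1)] c[OF st(2)] e
          G.pt_in_points[OF e(1)] by (intro bexI[of _ "point_at G w e (c e s)"] bexI[of _ "point_at G w e (c e t)"]) auto
    qed
  qed
  then show thesis using that by (simp add: f_def)
qed

section \<open>Subdividing an arc\<close>

definition split_arc :: "('v, 'e) pre_digraph \<Rightarrow> 'e \<Rightarrow> 'v \<Rightarrow> 'e \<Rightarrow> ('v, 'e) pre_digraph" where
  "split_arc G e v' e' =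
     \<lparr> verts = insert v' (verts G), arcs = insert e' (arcs G),
       tail = (tail G)(e' := v'), head = (head G)(e := v', e' := head G e) \<rparr>"

definition split_length :: "('e \<Rightarrow> real) \<Rightarrow> 'e \<Rightarrow> real \<Rightarrow> 'e \<Rightarrow> 'e \<Rightarrow> real" where
  "split_length w e s e' = w(e := s, e' := w e - s)"

lemma split_arc_metric_graph:
  assumes G: "metric_graph G w" and e: "e \<in> arcs G" and s: "0 < s" "s < w e"
    and v': "v' \<notin> verts G" and e': "e' \<notin> arcs G"
  shows "metric_graph (split_arc G e v' e') (split_length w e s e')"
proof -
  interpret metric_graph G w by fact
  show ?thesis
  proof (rule metric_graphI)
    fix S assume S: "S \<subseteq> verts (split_arc G e v' e')" "S \<noteq> {}"
      and cl: "\<And>a. a \<in> arcs (split_arc G e v' e') \<Longrightarrow>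
        tail (split_arc G e v' e') a \<in> S \<longleftrightarrow> head (split_arc G e v' e') a \<in> S"
    have 1: "tail G e \<in> S \<longleftrightarrow> v' \<in> S" "v' \<in> S \<longleftrightarrow> head G e \<in> S"
      using cl[of e] cl[of e'] e e' by (auto simp: split_arc_def split: if_splits)
    have 2: "tail G a \<in> S \<longleftrightarrow> head G a \<in> S" if "a \<in> arcs G" for a
      using cl[of a] 1 that e' by (cases "a = e") (auto simp: split_arc_def split: if_splits)
    have "S - {v'} = verts G"
    proof (rule closed_set_eq_verts)
      show "S - {v'} \<subseteq> verts G" using S by (auto simp: split_arc_def)
      show "S - {v'} \<noteq> {}"
        using S 1 v' tail_in_verts[OF e] by (metis Diff_empty Diff_insert0 insert_Diff insert_not_empty singletonD singletonI subset_singletonD Diff_eq_empty_iff)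
      show "tail G a \<in> S - {v'} \<longleftrightarrow> head G a \<in> S - {v'}" if "a \<in> arcs G" for a
        using 2[OF that] that v' tail_in_verts[OF that] head_in_verts[OF that] by auto
    qed
    moreover from this have "v' \<in> S" using 1 tail_in_verts[OF e] by blast
    ultimately show "S = verts (split_arc G e v' e')" by (auto simp: split_arc_def)
  qed (use e s e' length_pos in \<open>auto simp: split_arc_def split_length_def\<close>)
qed

lemma split_arc_isometry:
  assumes G: "metric_graph G w" and e: "e \<in> arcs G" and s: "0 < s" "s < w e"
    and v': "v' \<notin> verts G" and e': "e' \<notin> arcs G"
  obtains f where
    "isometry_map (split_arc G e v' e') (split_length w e s e') G w f"
    "f (Vertex v') = Inner e s" "\<And>v. v \<in> verts G \<Longrightarrow> f (Vertex v) = Vertex v"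
proof -
  interpret metric_graph G w by fact
  let ?H = "split_arc G e v' e'" and ?w = "split_length w e s e'"
  have H: "metric_graph ?H ?w" using split_arc_metric_graph[OF assms] .
  interpret H: metric_graph ?H ?w by fact
  have ee': "e \<noteq> e'" using e e' by auto
  define f where "f p = (case p of Vertex v \<Rightarrow> if v = v' then Inner e s else Vertex v
    | Inner a t \<Rightarrow> if a = e' then Inner e (s + t) else Inner a t)" for p :: "('a, 'b) mg_point"
  have f_e: "f (point_at ?H ?w e t) = pt e t" if "t \<in> {0..s}" for t
    using that s v' e ee' tail_in_verts[OF e]
    by (auto simp: f_def point_at_def split_arc_def split_length_def)
  have f_e': "f (point_at ?H ?w e' t) = pt e (s + t)" if "t \<in> {0..w e - s}" for t
    using that s v' e ee' head_in_verts[OF e]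
    by (auto simp: f_def point_at_def split_arc_def split_length_def)
  have f_a: "f (point_at ?H ?w a t) = pt a t" if a: "a \<in> arcs G" "a \<noteq> e" for a t
  proof -
    have "tail G a \<noteq> v'" "head G a \<noteq> v'" "a \<noteq> e'"
      using a v' e' tail_in_verts[OF a(1)] head_in_verts[OF a(1)] by auto
    with a(2) show ?thesis
      by (simp add: f_def point_at_def split_arc_def split_length_def)
  qed
  have arcsH: "arcs ?H = insert e' (arcs G)" and wH: "?w e = s" "?w e' = w e - s"
    "\<And>a. a \<noteq> e \<Longrightarrow> a \<noteq> e' \<Longrightarrow> ?w a = w a"
    using ee' by (auto simp: split_arc_def split_length_def)
  have "isometry_map ?H ?w G w f"
  proof (rule isometry_mapI[OF H G])
    show "f x \<in> points G w" if "x \<in> points ?H ?w" for x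
      using that s e ee' wH by (auto simp: points_def f_def arcsH split_arc_def split_length_def split: if_splits)
    show "inj_on f (points ?H ?w)"
      by (rule inj_onI)
        (use e' ee' v' wH in \<open>auto simp: points_def f_def arcsH split_arc_def split_length_def split: if_splits\<close>)
    show "gd (f (H.pt a q)) (f (H.pt a t)) \<le> \<bar>q - t\<bar>"
      if "a \<in> arcs ?H" "q \<in> {0..?w a}" "t \<in> {0..?w a}" for a q t
    proof -
      consider "a = e'" | "a = e" | "a \<noteq> e" "a \<noteq> e'" by metis
      then show ?thesis
      proof cases
        case 1
        then show ?thesis using that dist_segment[OF e, of "s + q" "s + t"] s by (simp add: f_e' wH)
      next
        case 2
        then show ?thesis using that dist_segment[OF e, of q t] s by (simp add: f_e wH)
      next
        case 3
        then show ?thesis using that dist_segment[of a q t] by (simp add: f_a wH arcsH)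
      qed
    qed
    show "\<exists>x\<in>points ?H ?w. \<exists>y\<in>points ?H ?w. f x = pt a q \<and> f y = pt a t \<and> H.gd x y \<le> \<bar>q - t\<bar>"
      if a: "a \<in> arcs G" and q: "q \<in> {0..w a}" and t: "t \<in> {0..w a}" for a q t
    proof (cases "a = e")
      case False
      have ae': "a \<noteq> e'" using a e' by auto
      then have "H.pt a q \<in> points ?H ?w" "H.pt a t \<in> points ?H ?w" "H.gd (H.pt a q) (H.pt a t) \<le> \<bar>q - t\<bar>"
        using a q t False H.pt_in_points[of a] H.dist_segment[of a q t] by (simp_all add: arcsH wH)
      with False a show ?thesis by (metis f_a)
    next
      case True
      \<comment> \<open>\<open>h\<close> inverts \<open>f\<close> on the arc \<open>e\<close>, which
        is now cut at \<open>s\<close>. For two points on different sides of the cut the distance is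
        estimated through \<open>v'\<close>.\<close>
      define h where "h t = (if t \<le> s then H.pt e t else H.pt e' (t - s))" for t
      have h: "h t \<in> points ?H ?w" "f (h t) = pt e t" if "t \<in> {0..w e}" for t
        using that s e H.pt_in_points[of e] H.pt_in_points[of e']
        by (auto simp: h_def f_e f_e' arcsH wH)
      have v: "H.pt e s = Vertex v'" "H.pt e' 0 = Vertex v'" "Vertex v' \<in> points ?H ?w"
        using s ee' by (auto simp: point_at_def split_arc_def split_length_def points_def)
      have le: "H.gd (h q) (h t) \<le> t - q" if "q \<in> {0..w e}" "t \<in> {0..w e}" "q \<le> t" for q t
      proof -
        consider "t \<le> s" | "s < q" | "q \<le> s" "s < t" using that by linarith
        then show ?thesis
        proof cases
          case 1
          then show ?thesis using that H.dist_segment[of e q t] e by (simp add: h_def arcsH wH)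
        next
          case 2
          then show ?thesis using that H.dist_segment[of e' "q - s" "t - s"] e by (simp add: h_def arcsH wH)
        next
          case 3
          have "H.gd (h q) (Vertex v') \<le> s - q" "H.gd (Vertex v') (h t) \<le> t - s"
            using that 3 s H.dist_segment[of e q s] H.dist_segment[of e' 0 "t - s"] e v
            by (simp_all add: h_def arcsH wH)
          then show ?thesis using H.dist_triangle[OF h(1) v(3) h(1)] that by fastforce
        qed
      qed
      have "H.gd (h q) (h t) \<le> \<bar>q - t\<bar>"
        using le[of q t] le[of t q] q t True H.dist_commute[of "h q" "h t"] by (cases "q \<le> t") auto
      with True h q t show ?thesis by blast
    qed
  qed
  moreover have "f (Vertex v') = Inner e s" "\<And>v. v \<in> verts G \<Longrightarrow> f (Vertex v) = Vertex v"
    using v' by (auto simp: f_def)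
  ultimately show thesis using that by blast
qed

section \<open>Counting points at a given distance\<close>

lemma degree_eq_sum:
  assumes "finite (arcs G)"
  shows "vdegree G v = (\<Sum>e\<in>arcs G. of_bool (tail G e = v) + of_bool (head G e = v))"
proof -
  have "in_arcs G v = {e \<in> arcs G. head G e = v}" "out_arcs G v = {e \<in> arcs G. tail G e = v}"
    by (auto simp: in_arcs_def out_arcs_def)
  then show ?thesis
    using assms
    by (simp add: vdegree_def in_degree_def out_degree_def sum.distrib sum_of_bool_eq Int_def add.commute)
qed

context metric_graph
begin

lemma sum_degree_mult:
  "(\<Sum>v\<in>verts G. real (vdegree G v) * f v) = (\<Sum>e\<in>arcs G. f (tail G e) + f (head G e))"
proof -
  have "(\<Sum>v\<in>verts G. real (vdegree G v) * f v)
      = (\<Sum>v\<in>verts G. \<Sum>e\<in>arcs G. of_bool (tail G e = v) * f v + of_bool (head G e = v) * f v)"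
    by (simp add: degree_eq_sum sum_distrib_right distrib_right)
  also have "\<dots> = (\<Sum>e\<in>arcs G. \<Sum>v\<in>verts G. of_bool (tail G e = v) * f v + of_bool (head G e = v) * f v)"
    by (rule sum.swap)
  also have "\<dots> = (\<Sum>e\<in>arcs G. f (tail G e) + f (head G e))"
  proof (rule sum.cong[OF refl])
    fix e assume "e \<in> arcs G"
    then have "tail G e \<in> verts G" "head G e \<in> verts G" by auto
    then show "(\<Sum>v\<in>verts G. of_bool (tail G e = v) * f v + of_bool (head G e = v) * f v)
        = f (tail G e) + f (head G e)"
      by (simp add: sum.distrib of_bool_def if_distrib[of "\<lambda>x. x * _"] cong: if_cong)
  qed
  finally show ?thesis .
qed

text \<open>For a radius that avoids vertices and highest points, an arc meets the sphere once for
  each end that is closer than \<open>t\<close>, as long as \<open>t\<close> stays below the highest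
  point of the arc. \<open>A\<close> and \<open>B\<close> are the coordinates reached from the tail
  and from the head.\<close>

lemma card_sphere:
  assumes r: "r \<in> verts G"
    and t: "\<And>v. v \<in> verts G \<Longrightarrow> vd r v \<noteq> t" "\<And>e. e \<in> arcs G \<Longrightarrow> height2 r e \<noteq> 2 * t"
  shows "card {p \<in> points G w. gd (Vertex r) p = t} =
    (\<Sum>e\<in>arcs G. of_bool (vd r (tail G e) < t \<and> 2 * t < height2 r e)
      + of_bool (vd r (head G e) < t \<and> 2 * t < height2 r e))"
proof -
  define A where "A e = (if vd r (tail G e) < t \<and> 2 * t < height2 r e then {t - vd r (tail G e)} else {})" for e
  define B where "B e = (if vd r (head G e) < t \<and> 2 * t < height2 r e then {vd r (head G e) + w e - t} else {})" for e
  have inner: "gd (Vertex r) (Inner e s) = min (vd r (tail G e) + s) (vd r (head G e) + w e - s)"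
    if "e \<in> arcs G" "0 < s" "s < w e" for e s
    using dist_point_at[OF r that(1), of s] that by (simp add: point_at_def)
  have "{p \<in> points G w. gd (Vertex r) p = t} = (\<Union>e\<in>arcs G. Inner e ` (A e \<union> B e))"
  proof (intro equalityI subsetI)
    fix p assume "p \<in> {p \<in> points G w. gd (Vertex r) p = t}"
    then obtain e s where p: "p = Inner e s" "e \<in> arcs G" "0 < s" "s < w e" "gd (Vertex r) p = t"
      using t(1) by (auto simp: points_def)
    have "s \<in> A e \<union> B e"
      using inner[OF p(2-4)] p t(2)[OF p(2)]
      by (auto simp: A_def B_def height2_def min_def split: if_splits)
    with p show "p \<in> (\<Union>e\<in>arcs G. Inner e ` (A e \<union> B e))" by blast
  next
    fix p :: "('v, 'e) mg_point" assume "p \<in> (\<Union>e\<in>arcs G. Inner e ` (A e \<union> B e))"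
    then obtain e s where p: "p = Inner e s" "e \<in> arcs G" "s \<in> A e \<union> B e" by blast
    have s: "0 < s \<and> s < w e \<and> min (vd r (tail G e) + s) (vd r (head G e) + w e - s) = t"
      using p(3) dist_arc_abs[OF joins_ends[OF p(2)] r]
      by (auto simp: A_def B_def height2_def split: if_splits)
    with inner[OF p(2)] p show "p \<in> {p \<in> points G w. gd (Vertex r) p = t}"
      by (auto simp: points_def)
  qed
  moreover have "card (\<Union>e\<in>arcs G. Inner e ` (A e \<union> B e) :: ('v, 'e) mg_point set) = (\<Sum>e\<in>arcs G. card (A e \<union> B e))"
    by (subst card_UN_disjoint) (auto simp: A_def B_def card_image inj_on_def)
  moreover have "card (A e \<union> B e) = of_bool (vd r (tail G e) < t \<and> 2 * t < height2 r e)
      + of_bool (vd r (head G e) < t \<and> 2 * t < height2 r e)" if "e \<in> arcs G" for e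
    using t(2)[OF that] by (auto simp: A_def B_def height2_def card_insert_if)
  ultimately show ?thesis by simp
qed

lemma has_integral_of_bool_interval:
  fixes a b :: real assumes "a \<le> b"
  shows "((\<lambda>t. of_bool (a < t \<and> t < b) :: real) has_integral (b - a)) UNIV"
proof -
  have "((\<lambda>t. 1 :: real) has_integral (b - a)) {a..b}"
    using has_integral_const_real[of "1::real" a b] assms by simp
  then have "((\<lambda>t. if t \<in> {a..b} then 1 else 0 :: real) has_integral (b - a)) UNIV"
    by (subst has_integral_restrict_UNIV)
  then show ?thesis
    by (rule has_integral_spike_finite[of "{a, b}", rotated 2]) auto
qed

text \<open>The radii at which an arc is hit from its tail and from its head form two intervals
  ending at \<open>height2 r e / 2\<close>; their lengths add up to \<open>w e\<close>. The finitely
  many exceptional radii do not affect the integral.\<close>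

lemma length_has_integral:
  assumes r: "r \<in> verts G"
  shows "((\<lambda>t. real (card {p \<in> points G w. gd (Vertex r) p = t})) has_integral total_length G w) UNIV"
proof -
  let ?f = "\<lambda>e t. of_bool (vd r (tail G e) < t \<and> t < height2 r e / 2)
      + of_bool (vd r (head G e) < t \<and> t < height2 r e / 2) :: real"
  have "(?f e has_integral w e) UNIV" if e: "e \<in> arcs G" for e
  proof -
    have "vd r (tail G e) \<le> height2 r e / 2" "vd r (head G e) \<le> height2 r e / 2"
      using dist_arc_abs[OF joins_ends[OF e] r] by (auto simp: height2_def)
    from has_integral_add[OF this[THEN has_integral_of_bool_interval]]
    show ?thesis by (simp add: height2_def)
  qed
  then have sum: "((\<lambda>t. \<Sum>e\<in>arcs G. ?f e t) has_integral total_length G w) UNIV"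
    unfolding total_length_def by (intro has_integral_sum) auto
  let ?X = "vd r ` verts G \<union> (\<lambda>e. height2 r e / 2) ` arcs G"
  show ?thesis
  proof (rule has_integral_spike_finite[OF _ _ sum])
    show "finite ?X" by simp
    fix t assume t: "t \<in> UNIV - ?X"
    have "card {p \<in> points G w. gd (Vertex r) p = t} =
      (\<Sum>e\<in>arcs G. of_bool (vd r (tail G e) < t \<and> 2 * t < height2 r e)
      + of_bool (vd r (head G e) < t \<and> 2 * t < height2 r e))"
      by (rule card_sphere[OF r]) (use t in force)+
    then show "real (card {p \<in> points G w. gd (Vertex r) p = t}) = (\<Sum>e\<in>arcs G. ?f e t)"
      by (simp add: field_simps)
  qed
qed

end

section \<open>The degree of a point as a metric invariant\<close>

definition germ_degree :: "('v, 'e) pre_digraph \<Rightarrow> ('e \<Rightarrow> real) \<Rightarrow> ('v, 'e) mg_point \<Rightarrow> nat \<Rightarrow> bool" where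
  "germ_degree G w p n \<longleftrightarrow>
     (\<forall>\<^sub>F t in at_right 0. card {q \<in> points G w. graph_dist G w p q = t} = n)"

lemma germ_degree_unique: "germ_degree G w p n \<Longrightarrow> germ_degree G w p m \<Longrightarrow> n = m"
proof -
  assume "germ_degree G w p n" "germ_degree G w p m"
  then have "\<forall>\<^sub>F t in at_right (0::real). n = m"
    unfolding germ_degree_def by eventually_elim simp
  then show ?thesis by simp
qed

lemma isometry_card_sphere:
  assumes "isometry_map G w H w' f" "p \<in> points G w"
  shows "card {q \<in> points H w'. graph_dist H w' (f p) q = t} = card {q \<in> points G w. graph_dist G w p q = t}"
proof -
  have "bij_betw f {q \<in> points G w. graph_dist G w p q = t} {q \<in> points H w'. graph_dist H w' (f p) q = t}"
    using assms unfolding isometry_map_def by (intro bij_betw_Collect) auto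
  then show ?thesis by (rule bij_betw_same_card[symmetric])
qed

lemma germ_degree_isometry:
  assumes "isometry_map G w H w' f" "p \<in> points G w"
  shows "germ_degree H w' (f p) n \<longleftrightarrow> germ_degree G w p n"
  unfolding germ_degree_def using isometry_card_sphere[OF assms] by simp

text \<open>For small \<open>t\<close> only arc ends lying at \<open>r\<close> itself contribute in
  \<open>card_sphere\<close>; both ends of a loop do, in accordance with its degree.\<close>

lemma (in metric_graph) germ_degree_Vertex:
  assumes r: "r \<in> verts G"
  shows "germ_degree G w (Vertex r) (vdegree G r)"
proof -
  have small: "\<forall>\<^sub>F t in at_right 0. t < c" if "0 < c" for c :: real
    using that by (auto simp: eventually_at_right_field)
  have 1: "\<forall>\<^sub>F t in at_right 0. \<forall>v\<in>verts G. v \<noteq> r \<longrightarrow> t < vd r v"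
    by (intro eventually_ball_finite) (use small vd_pos r in auto)
  have 2: "\<forall>\<^sub>F t in at_right 0. \<forall>e\<in>arcs G. t < height2 r e / 2"
  proof (intro eventually_ball_finite ballI small)
    fix e assume "e \<in> arcs G"
    then show "0 < height2 r e / 2"
      using length_pos[of e] vd_nonneg[of r "tail G e"] vd_nonneg[of r "head G e"] r
      by (simp add: height2_def)
  qed simp
  have 3: "\<forall>\<^sub>F t in at_right (0::real). 0 < t" by (rule eventually_at_right_less)
  show ?thesis
    unfolding germ_degree_def
    using 1 2 3
  proof eventually_elim
    case (elim t)
    have eq: "vd r v < t \<longleftrightarrow> v = r" if "v \<in> verts G" for v
      using elim that r by (cases "v = r") (auto simp: not_less intro: less_imp_le)
    have "card {q \<in> points G w. gd (Vertex r) q = t} =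
      (\<Sum>e\<in>arcs G. of_bool (vd r (tail G e) < t \<and> 2 * t < height2 r e)
        + of_bool (vd r (head G e) < t \<and> 2 * t < height2 r e))"
    proof (rule card_sphere[OF r])
      show "vd r v \<noteq> t" if "v \<in> verts G" for v
        using elim that r by (cases "v = r") auto
      show "height2 r e \<noteq> 2 * t" if "e \<in> arcs G" for e
        using elim that by force
    qed
    also have "\<dots> = vdegree G r"
      unfolding degree_eq_sum[OF finite_arcs]
      by (rule sum.cong) (use elim eq in \<open>auto simp: field_simps\<close>)
    finally show ?case .
  qed
qed

lemma split_arc_total_length:
  assumes "finite (arcs G)" "e \<in> arcs G" "e' \<notin> arcs G"
  shows "total_length (split_arc G e v' e') (split_length w e s e') = total_length G w"
proof -
  have "(\<Sum>a\<in>arcs G. split_length w e s e' a) = (\<Sum>a\<in>arcs G. if a = e then w a + (s - w e) else w a)"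
    using assms by (intro sum.cong) (auto simp: split_length_def)
  also have "\<dots> = (\<Sum>a\<in>arcs G. w a + (if a = e then s - w e else 0))"
    by (intro sum.cong) auto
  finally show ?thesis
    using assms by (simp add: total_length_def split_arc_def sum.distrib) (simp add: split_length_def)
qed

lemma split_arc_degree_new:
  assumes "wf_digraph G" "finite (arcs G)" "e \<in> arcs G" "e' \<notin> arcs G" "v' \<notin> verts G"
  shows "vdegree (split_arc G e v' e') v' = 2"
proof -
  interpret wf_digraph G by fact
  have "in_arcs (split_arc G e v' e') v' = {e}" "out_arcs (split_arc G e v' e') v' = {e'}"
    using assms head_in_verts tail_in_verts
    by (auto simp: in_arcs_def out_arcs_def split_arc_def split: if_splits)
  then show ?thesis by (simp add: vdegree_def in_degree_def out_degree_def)
qed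

text \<open>Subdividing at the point turns it into a vertex of degree two. The assumptions on the
  types provide the fresh vertex and arc.\<close>

lemma germ_degree_Inner:
  fixes G :: "('v, 'e) pre_digraph"
  assumes "metric_graph G w" "e \<in> arcs G" "0 < s" "s < w e"
    and inf: "infinite (UNIV :: 'v set)" "infinite (UNIV :: 'e set)"
  shows "germ_degree G w (Inner e s) 2"
proof -
  interpret metric_graph G w by fact
  obtain v' where v': "v' \<notin> verts G" using ex_new_if_finite[OF inf(1) finite_verts] by blast
  obtain e' where e': "e' \<notin> arcs G" using ex_new_if_finite[OF inf(2) finite_arcs] by blast
  let ?H = "split_arc G e v' e'" and ?w = "split_length w e s e'"
  interpret H: metric_graph ?H ?w using split_arc_metric_graph assms(1-4) v' e' .
  obtain f where f: "isometry_map ?H ?w G w f" "f (Vertex v') = Inner e s"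
    using split_arc_isometry[OF assms(1-4) v' e'] by blast
  have v: "v' \<in> verts ?H" by (simp add: split_arc_def)
  have "germ_degree ?H ?w (Vertex v') 2"
    using H.germ_degree_Vertex[OF v] split_arc_degree_new[OF wf_digraph_axioms finite_arcs assms(2) e' v'] by simp
  with germ_degree_isometry[OF f(1), of "Vertex v'" 2] v f(2) show ?thesis by simp
qed

section \<open>Isometry invariants\<close>

text \<open>The integral formula is evaluated at a vertex of \<open>G\<close> and at its image. The
  image may lie inside an arc of \<open>H\<close>, and then \<open>H\<close> is subdivided
  there.\<close>

lemma isometric_total_length:
  fixes G :: "('v, 'e) pre_digraph" and H :: "('v2, 'e2) pre_digraph"
  assumes G: "metric_graph G w" and H: "metric_graph H w'" and iso: "isometric G w H w'"
    and inf: "infinite (UNIV :: 'v2 set)" "infinite (UNIV :: 'e2 set)"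
  shows "total_length H w' = total_length G w"
proof -
  interpret G: metric_graph G w by fact
  interpret H: metric_graph H w' by fact
  obtain f where f: "isometry_map G w H w' f" using iso isometric_iff by metis
  obtain r where r: "r \<in> verts G" using G.verts_nonempty by blast
  then have fr: "f (Vertex r) \<in> points H w'"
    using f by (auto simp: isometry_map_def bij_betw_def)
  have "((\<lambda>t. real (card {q \<in> points H w'. graph_dist H w' (f (Vertex r)) q = t}))
    has_integral total_length H w') UNIV"
  proof (cases "f (Vertex r)")
    case (Vertex v)
    with fr H.length_has_integral[of v] show ?thesis by simp
  next
    case (Inner e s)
    then have e: "e \<in> arcs H" "0 < s" "s < w' e" using fr by (auto simp: points_def)
    obtain v' where v': "v' \<notin> verts H" using ex_new_if_finite[OF inf(1) H.finite_verts] by blast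
    obtain e' where e': "e' \<notin> arcs H" using ex_new_if_finite[OF inf(2) H.finite_arcs] by blast
    let ?K = "split_arc H e v' e'" and ?k = "split_length w' e s e'"
    interpret K: metric_graph ?K ?k using split_arc_metric_graph[OF H e v' e'] .
    obtain g where g: "isometry_map ?K ?k H w' g" "g (Vertex v') = Inner e s"
      using split_arc_isometry[OF H e v' e'] by blast
    have v: "v' \<in> verts ?K" by (simp add: split_arc_def)
    then show ?thesis
      using K.length_has_integral[OF v] isometry_card_sphere[OF g(1), of "Vertex v'"] g(2) Inner
        split_arc_total_length[OF H.finite_arcs e(1) e'] by simp
  qed
  then have "((\<lambda>t. real (card {q \<in> points G w. graph_dist G w (Vertex r) q = t}))
    has_integral total_length H w') UNIV"
    using isometry_card_sphere[OF f, of "Vertex r"] r by simp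
  with G.length_has_integral[OF r] show ?thesis using has_integral_unique by blast
qed

text \<open>\<open>germ_degree\<close> is preserved and equals two inside arcs, so a vertex of any
  other degree must go to a vertex. Vertices of degree two are metrically invisible and are left
  out.\<close>

lemma isometric_degrees:
  fixes G :: "('v, 'e) pre_digraph" and H :: "('v2, 'e2) pre_digraph"
  assumes G: "metric_graph G w" and H: "metric_graph H w'" and iso: "isometric G w H w'"
    and infG: "infinite (UNIV :: 'v set)" "infinite (UNIV :: 'e set)"
    and infH: "infinite (UNIV :: 'v2 set)" "infinite (UNIV :: 'e2 set)"
  obtains \<phi> where "bij_betw \<phi> {v \<in> verts G. vdegree G v \<noteq> 2} {v \<in> verts H. vdegree H v \<noteq> 2}"
    "\<And>v. v \<in> verts G \<Longrightarrow> vdegree G v \<noteq> 2 \<Longrightarrow> vdegree H (\<phi> v) = vdegree G v"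
proof -
  interpret G: metric_graph G w by fact
  interpret H: metric_graph H w' by fact
  obtain f where f: "isometry_map G w H w' f" using iso isometric_iff by metis
  then have bij: "bij_betw f (points G w) (points H w')" by (simp add: isometry_map_def)
  have gG: "\<exists>n. germ_degree G w p n \<and> (n \<noteq> 2 \<longleftrightarrow> (\<exists>v\<in>verts G. p = Vertex v \<and> vdegree G v \<noteq> 2))
      \<and> (\<forall>v. p = Vertex v \<longrightarrow> vdegree G v = n)"
    if "p \<in> points G w" for p
    using that germ_degree_Inner[OF G _ _ _ infG] G.germ_degree_Vertex
    by (cases p) (fastforce simp: points_def)+
  have gH: "\<exists>n. germ_degree H w' p n \<and> (n \<noteq> 2 \<longleftrightarrow> (\<exists>v\<in>verts H. p = Vertex v \<and> vdegree H v \<noteq> 2))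
      \<and> (\<forall>v. p = Vertex v \<longrightarrow> vdegree H v = n)"
    if "p \<in> points H w'" for p
    using that germ_degree_Inner[OF H _ _ _ infH] H.germ_degree_Vertex
    by (cases p) (fastforce simp: points_def)+
  have key: "(\<exists>v\<in>verts G. p = Vertex v \<and> vdegree G v = n) \<longleftrightarrow> (\<exists>v\<in>verts H. f p = Vertex v \<and> vdegree H v = n)"
    if p: "p \<in> points G w" and "n \<noteq> 2" for p n
  proof -
    have fp: "f p \<in> points H w'" using bij p by (auto simp: bij_betw_def)
    obtain m where m: "germ_degree G w p m" "m \<noteq> 2 \<longleftrightarrow> (\<exists>v\<in>verts G. p = Vertex v \<and> vdegree G v \<noteq> 2)"
      "\<forall>v. p = Vertex v \<longrightarrow> vdegree G v = m" using gG[OF p] by blast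
    obtain k where k: "germ_degree H w' (f p) k" "k \<noteq> 2 \<longleftrightarrow> (\<exists>v\<in>verts H. f p = Vertex v \<and> vdegree H v \<noteq> 2)"
      "\<forall>v. f p = Vertex v \<longrightarrow> vdegree H v = k" using gH[OF fp] by blast
    have "k = m" using m(1) k(1) germ_degree_isometry[OF f p] germ_degree_unique by metis
    with m k \<open>n \<noteq> 2\<close> show ?thesis by metis
  qed
  define \<phi> where "\<phi> v = (case f (Vertex v) of Vertex u \<Rightarrow> u | _ \<Rightarrow> undefined)" for v
  have \<phi>: "f (Vertex v) = Vertex (\<phi> v)" "\<phi> v \<in> verts H" "vdegree H (\<phi> v) = vdegree G v"
    if "v \<in> verts G" "vdegree G v \<noteq> 2" for v
    using key[of "Vertex v" "vdegree G v"] that by (auto simp: \<phi>_def)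
  have "bij_betw \<phi> {v \<in> verts G. vdegree G v \<noteq> 2} {v \<in> verts H. vdegree H v \<noteq> 2}"
    unfolding bij_betw_def
  proof (intro conjI inj_onI equalityI subsetI)
    fix u v assume uv: "u \<in> {v \<in> verts G. vdegree G v \<noteq> 2}" "v \<in> {v \<in> verts G. vdegree G v \<noteq> 2}" "\<phi> u = \<phi> v"
    then have "f (Vertex u) = f (Vertex v)" using \<phi> by auto
    with uv bij show "u = v" by (auto simp: bij_betw_def inj_on_eq_iff)
  next
    fix v assume "v \<in> \<phi> ` {v \<in> verts G. vdegree G v \<noteq> 2}"
    with \<phi> show "v \<in> {v \<in> verts H. vdegree H v \<noteq> 2}" by auto
  next
    fix v assume v: "v \<in> {v \<in> verts H. vdegree H v \<noteq> 2}"
    then have "Vertex v \<in> f ` points G w" using bij by (auto simp: bij_betw_def)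
    then obtain p where p: "p \<in> points G w" "Vertex v = f p" by blast
    with key[OF p(1), of "vdegree H v"] v obtain u where "u \<in> verts G" "p = Vertex u" "vdegree G u = vdegree H v"
      by (metis (mono_tags, lifting) mem_Collect_eq)
    with v p \<phi>(1)[of u] show "v \<in> \<phi> ` {v \<in> verts G. vdegree G v \<noteq> 2}" by auto
  qed
  with \<phi>(3) that show thesis by blast
qed

lemma num_leaves_eq: "num_leaves G = card {v \<in> verts G. vdegree G v = 1}"
  by (simp add: num_leaves_def vdegree_def)

lemma (in metric_graph) sum_degree_minus_2:
  "(\<Sum>v\<in>verts G. real (vdegree G v) - 2) = 2 * real_of_int (cyc G) - 2"
  using sum_degree_mult[of "\<lambda>_. 1"] by (simp add: sum_subtractf cyc_def)

text \<open>The sum of \<open>deg v - 2\<close>, which is \<open>2 * cyc - 2\<close>, ignores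
  vertices of degree two, so both numbers are determined by the bijection of
  \<open>isometric_degrees\<close>.\<close>

lemma
  fixes G :: "('v, 'e) pre_digraph" and H :: "('v2, 'e2) pre_digraph"
  assumes G: "metric_graph G w" and H: "metric_graph H w'" and iso: "isometric G w H w'"
    and infG: "infinite (UNIV :: 'v set)" "infinite (UNIV :: 'e set)"
    and infH: "infinite (UNIV :: 'v2 set)" "infinite (UNIV :: 'e2 set)"
  shows isometric_num_leaves: "num_leaves H = num_leaves G"
    and isometric_cyc: "cyc H = cyc G"
proof -
  interpret G: metric_graph G w by fact
  interpret H: metric_graph H w' by fact
  obtain \<phi> where \<phi>: "bij_betw \<phi> {v \<in> verts G. vdegree G v \<noteq> 2} {v \<in> verts H. vdegree H v \<noteq> 2}"
    "\<And>v. v \<in> verts G \<Longrightarrow> vdegree G v \<noteq> 2 \<Longrightarrow> vdegree H (\<phi> v) = vdegree G v"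
    using isometric_degrees[OF assms] by blast
  have "bij_betw \<phi> {v \<in> verts G. vdegree G v = 1} {v \<in> verts H. vdegree H v = 1}"
  proof -
    have "bij_betw \<phi> {v \<in> {v \<in> verts G. vdegree G v \<noteq> 2}. vdegree G v = 1}
        {v \<in> {v \<in> verts H. vdegree H v \<noteq> 2}. vdegree H v = 1}"
      by (rule bij_betw_Collect[OF \<phi>(1)]) (use \<phi>(2) in auto)
    moreover have "{v \<in> {v \<in> verts G. vdegree G v \<noteq> 2}. vdegree G v = 1} = {v \<in> verts G. vdegree G v = 1}"
      "{v \<in> {v \<in> verts H. vdegree H v \<noteq> 2}. vdegree H v = 1} = {v \<in> verts H. vdegree H v = 1}" by auto
    ultimately show ?thesis by simp
  qed
  then show "num_leaves H = num_leaves G" by (simp add: num_leaves_eq bij_betw_same_card)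
  have "(\<Sum>v\<in>verts G. real (vdegree G v) - 2) = (\<Sum>v\<in>{v \<in> verts G. vdegree G v \<noteq> 2}. real (vdegree G v) - 2)"
    by (rule sum.mono_neutral_right) auto
  also have "\<dots> = (\<Sum>v\<in>{v \<in> verts H. vdegree H v \<noteq> 2}. real (vdegree H v) - 2)"
    unfolding sum.reindex_bij_betw[OF \<phi>(1), of "\<lambda>v. real (vdegree H v) - 2", symmetric]
    by (rule sum.cong) (use \<phi>(2) in auto)
  also have "\<dots> = (\<Sum>v\<in>verts H. real (vdegree H v) - 2)"
    by (rule sum.mono_neutral_left) auto
  finally show "cyc H = cyc G" using G.sum_degree_minus_2 H.sum_degree_minus_2 by simp
qed

section \<open>Shortest path trees\<close>

context metric_graph
begin

text \<open>The arc \<open>e\<close> is tight for \<open>r\<close>: its point farthest from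
  \<open>r\<close> is the end \<open>a\<close>, and it can be the last arc of a shortest path from
  \<open>r\<close> to \<open>a\<close>.\<close>

definition tops :: "'v \<Rightarrow> 'e \<Rightarrow> 'v \<Rightarrow> bool" where
  "tops r e a \<longleftrightarrow> (\<exists>u. joins G e u a \<and> vd r a = vd r u + w e)"

lemma tops_arc: "tops r e a \<Longrightarrow> e \<in> arcs G \<and> a \<in> verts G"
  using joins_verts by (auto simp: tops_def joins_def)

lemma tops_unique: "tops r e a \<Longrightarrow> tops r e b \<Longrightarrow> a = b"
  using length_pos[of e] by (auto simp: tops_def joins_def)

lemma tops_height2: "tops r e a \<Longrightarrow> height2 r e = 2 * vd r a"
  by (auto simp: tops_def joins_def height2_def)

lemma ex_tops: "r \<in> verts G \<Longrightarrow> v \<in> verts G \<Longrightarrow> v \<noteq> r \<Longrightarrow> \<exists>e. tops r e v"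
  using dist_parent by (auto simp: tops_def)

text \<open>Choosing a tight arc \<open>par v\<close> for each \<open>v \<noteq> r\<close> is
  injective, since an arc tops at most one vertex; nothing else is needed of the tree. Summing
  \<open>height2\<close> over all arcs gives the length plus the sum of
  \<open>deg v * vd r v\<close>, and the chosen arcs account for \<open>2 * vd r v\<close> each,
  which turns \<open>deg v\<close> into \<open>deg v - 2\<close>.\<close>

lemma shortest_path_tree:
  assumes r: "r \<in> verts G"
  obtains N where "N \<subseteq> arcs G" "int (card N) = cyc G"
    "total_length G w = (\<Sum>e\<in>N. height2 r e) - (\<Sum>v\<in>verts G. (real (vdegree G v) - 2) * vd r v)"
    "\<And>e. e \<in> arcs G \<Longrightarrow> e \<notin> N \<Longrightarrow> \<exists>a. a \<noteq> r \<and> tops r e a"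
    "\<And>a. a \<in> verts G \<Longrightarrow> a \<noteq> r \<Longrightarrow> \<exists>!e. e \<in> arcs G - N \<and> tops r e a"
proof -
  from ex_tops[OF r] obtain par where par: "\<And>v. v \<in> verts G - {r} \<Longrightarrow> tops r (par v) v"
    by (metis Diff_iff singletonI)
  let ?T = "par ` (verts G - {r})"
  have inj: "inj_on par (verts G - {r})"
    using par tops_unique by (intro inj_onI) metis
  have T: "?T \<subseteq> arcs G" using par tops_arc by blast
  define N where "N = arcs G - ?T"
  have AN: "arcs G - N = ?T" using T by (auto simp: N_def)
  have cT: "card ?T = card (verts G) - 1"
    using card_image[OF inj] r by (simp add: card_Diff_singleton)
  have "0 < card (verts G)" using r by (auto simp: card_gt_0_iff)
  moreover have "card N = card (arcs G) - card ?T" "card ?T \<le> card (arcs G)"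
    unfolding N_def using T by (auto intro: card_Diff_subset card_mono)
  ultimately have card: "int (card N) = cyc G"
    using cT by (simp add: cyc_def)
  have "(\<Sum>e\<in>?T. height2 r e) = (\<Sum>v\<in>verts G - {r}. height2 r (par v))"
    by (simp add: sum.reindex[OF inj])
  also have "\<dots> = (\<Sum>v\<in>verts G - {r}. 2 * vd r v)"
    by (rule sum.cong) (use par tops_height2 in auto)
  also have "\<dots> = (\<Sum>v\<in>verts G. 2 * vd r v)"
    using r by (subst sum.remove[of "verts G" r]) auto
  finally have sumT: "(\<Sum>e\<in>?T. height2 r e) = (\<Sum>v\<in>verts G. 2 * vd r v)" .
  have "total_length G w = (\<Sum>e\<in>arcs G. height2 r e) - (\<Sum>e\<in>arcs G. vd r (tail G e) + vd r (head G e))"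
    by (simp add: total_length_def height2_def sum_subtractf[symmetric])
  also have "(\<Sum>e\<in>arcs G. vd r (tail G e) + vd r (head G e)) = (\<Sum>v\<in>verts G. real (vdegree G v) * vd r v)"
    using sum_degree_mult[of "vd r"] by simp
  also have "(\<Sum>e\<in>arcs G. height2 r e) = (\<Sum>e\<in>N. height2 r e) + (\<Sum>e\<in>?T. height2 r e)"
    unfolding N_def using sum.subset_diff[OF T finite_arcs] .
  finally have len: "total_length G w
      = (\<Sum>e\<in>N. height2 r e) - (\<Sum>v\<in>verts G. (real (vdegree G v) - 2) * vd r v)"
    unfolding sumT by (simp add: left_diff_distrib sum_subtractf)
  show thesis
  proof (rule that[OF _ card len])
    show "N \<subseteq> arcs G" by (auto simp: N_def)
    show "\<exists>a. a \<noteq> r \<and> tops r e a" if "e \<in> arcs G" "e \<notin> N" for e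
    proof -
      have "e \<in> ?T" using that AN by blast
      with par show ?thesis by blast
    qed
    show "\<exists>!e. e \<in> arcs G - N \<and> tops r e a" if a: "a \<in> verts G" "a \<noteq> r" for a
      unfolding AN
    proof (rule ex1I[of _ "par a"])
      show "par a \<in> ?T \<and> tops r (par a) a" using a par by auto
      fix e assume "e \<in> ?T \<and> tops r e a"
      then show "e = par a" using par tops_unique by (metis imageE)
    qed
  qed
qed

section \<open>Degrees and leaves\<close>

lemma sum_subset_le_degree:
  assumes "S \<subseteq> arcs G"
  shows "(\<Sum>e\<in>S. of_bool (tail G e = v) + of_bool (head G e = v)) \<le> vdegree G v"
  unfolding degree_eq_sum[OF finite_arcs] using assms by (intro sum_mono2) auto

lemma degree_pos: "v \<in> verts G \<Longrightarrow> 1 \<le> vdegree G v"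
proof -
  assume "v \<in> verts G"
  then obtain e u where "joins G e u v" using incident_arc by blast
  then show ?thesis using sum_subset_le_degree[of "{e}" v] by (auto simp: joins_def)
qed

lemma leaf_arc:
  assumes "v \<in> verts G" "vdegree G v = 1"
  obtains e u where "joins G e u v" "u \<noteq> v"
    "\<And>a. a \<in> arcs G \<Longrightarrow> tail G a = v \<or> head G a = v \<Longrightarrow> a = e"
proof -
  obtain e u where e: "joins G e u v" using incident_arc[OF assms(1)] .
  have "u \<noteq> v" using e sum_subset_le_degree[of "{e}" v] assms by (auto simp: joins_def)
  moreover have "a = e" if "a \<in> arcs G" "tail G a = v \<or> head G a = v" for a
  proof (rule ccontr)
    assume "a \<noteq> e"
    then show False
      using e that sum_subset_le_degree[of "{a, e}" v] assms by (auto simp: joins_def split: if_splits)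
  qed
  ultimately show thesis using that e by blast
qed

lemma leaf_dist:
  assumes e: "joins G e u x" and only: "\<And>a. a \<in> arcs G \<Longrightarrow> tail G a = x \<or> head G a = x \<Longrightarrow> a = e"
    and "u \<noteq> x" "v \<in> verts G" "v \<noteq> x"
  shows "vd v x = vd v u + w e" "vd x v = vd u v + w e"
proof -
  have "x \<in> verts G" using joins_verts[OF e] by simp
  then obtain a z where a: "joins G a z x" "vd v x = vd v z + w a"
    using dist_parent[of v x] assms(4,5) by blast
  then have "a = e" using only[of a] by (auto simp: joins_def)
  with a e \<open>u \<noteq> x\<close> show "vd v x = vd v u + w e" by (auto simp: joins_def)
  then show "vd x v = vd u v + w e" by (simp add: vd_commute)
qed

end

lemma isometry_degree:
  assumes G: "metric_graph G w" and H: "metric_graph H w'" and f: "isometry_map G w H w' f"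
    and v: "v \<in> verts G" and fv: "f (Vertex v) = Vertex u"
  shows "u \<in> verts H" "vdegree H u = vdegree G v"
proof -
  interpret G: metric_graph G w by fact
  interpret H: metric_graph H w' by fact
  have vp: "Vertex v \<in> points G w" using v by simp
  then have "f (Vertex v) \<in> points H w'" using f by (auto simp: isometry_map_def bij_betw_def)
  then show u: "u \<in> verts H" using fv by simp
  have "germ_degree G w (Vertex v) (vdegree H u)"
    using germ_degree_isometry[OF f vp] H.germ_degree_Vertex[OF u] fv by simp
  then show "vdegree H u = vdegree G v"
    using G.germ_degree_Vertex[OF v] germ_degree_unique by blast
qed

section \<open>Deleting a leaf\<close>

definition delete_leaf :: "('v, 'e) pre_digraph \<Rightarrow> 'v \<Rightarrow> 'e \<Rightarrow> ('v, 'e) pre_digraph" where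
  "delete_leaf G x p = \<lparr> verts = verts G - {x}, arcs = arcs G - {p}, tail = tail G, head = head G \<rparr>"

lemma delete_leaf_simps [simp]:
  "verts (delete_leaf G x p) = verts G - {x}" "arcs (delete_leaf G x p) = arcs G - {p}"
  "tail (delete_leaf G x p) = tail G" "head (delete_leaf G x p) = head G"
  by (simp_all add: delete_leaf_def)

lemma
  assumes G: "metric_graph G w" and p: "joins G p y x" "y \<noteq> x"
    and only: "\<And>a. a \<in> arcs G \<Longrightarrow> tail G a = x \<or> head G a = x \<Longrightarrow> a = p"
    and more: "arcs G \<noteq> {p}"
  shows delete_leaf_metric_graph: "metric_graph (delete_leaf G x p) w" (is ?thesis1)
    and delete_leaf_dist: "u \<in> verts G \<Longrightarrow> u \<noteq> x \<Longrightarrow> v \<in> verts G \<Longrightarrow> v \<noteq> x \<Longrightarrow>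
      graph_dist (delete_leaf G x p) w (Vertex u) (Vertex v) = graph_dist G w (Vertex u) (Vertex v)"
    and delete_leaf_diam: "diam (delete_leaf G x p) w \<le> diam G w"
    and delete_leaf_total_length: "total_length (delete_leaf G x p) w = total_length G w - w p"
    and delete_leaf_cyc: "cyc (delete_leaf G x p) = cyc G"
    and delete_leaf_degree: "v \<noteq> x \<Longrightarrow>
      vdegree (delete_leaf G x p) v = (if v = y then vdegree G v - 1 else vdegree G v)"
proof -
  interpret metric_graph G w by fact
  let ?H = "delete_leaf G x p"
  have pa: "p \<in> arcs G" and xy: "x \<in> verts G" "y \<in> verts G"
    using p joins_verts by (auto simp: joins_def)
  have noninc: "tail G a \<noteq> x" "head G a \<noteq> x" if "a \<in> arcs G" "a \<noteq> p" for a
    using only that by auto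
  show H: ?thesis1
  proof (rule metric_graphI)
    fix S assume S: "S \<subseteq> verts ?H" "S \<noteq> {}"
      and cl: "\<And>e. e \<in> arcs ?H \<Longrightarrow> tail ?H e \<in> S \<longleftrightarrow> head ?H e \<in> S"
    define S' where "S' = (if y \<in> S then insert x S else S)"
    have "S' = verts G"
    proof (rule closed_set_eq_verts)
      fix e assume e: "e \<in> arcs G"
      show "tail G e \<in> S' \<longleftrightarrow> head G e \<in> S'"
      proof (cases "e = p")
        case True
        then show ?thesis using p S by (auto simp: joins_def S'_def)
      next
        case False
        then show ?thesis using cl[of e] e noninc[OF e] by (auto simp: S'_def)
      qed
    qed (use S xy in \<open>auto simp: S'_def\<close>)
    then show "S = verts ?H" using S p(2) xy by (auto simp: S'_def split: if_splits)
  qed (use more noninc pa length_pos in auto)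
  interpret H: metric_graph ?H w by fact
  \<comment> \<open>Collapsing the pendant arc to its foot \<open>y\<close> is 1-Lipschitz and fixes
    all other points, so distances between them are the same in the smaller graph.\<close>
  define \<rho> where "\<rho> q = (case q of Vertex v \<Rightarrow> if v = x then Vertex y else Vertex v
    | Inner a t \<Rightarrow> if a = p then Vertex y else Inner a t)" for q :: "('a, 'b) mg_point"
  have ptH: "H.pt a t = pt a t" for a t by (simp add: point_at_def)
  have \<rho>p: "\<rho> (pt p t) = Vertex y" for t
    using p by (auto simp: joins_def \<rho>_def point_at_def)
  have \<rho>a: "\<rho> (pt a t) = pt a t" if "a \<in> arcs G" "a \<noteq> p" for a t
    using noninc[OF that] that by (auto simp: \<rho>_def point_at_def)
  have sub: "q \<in> points G w" "\<rho> q = q" if "q \<in> points ?H w" for q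
    using that by (auto simp: points_def \<rho>_def split: if_splits)
  have le: "gd q q' \<le> H.gd q q'" if "q \<in> points ?H w" "q' \<in> points ?H w" for q q'
    using H.dist_map_le[OF G, of "\<lambda>q. q"] that sub dist_segment by (simp add: ptH)
  have "H.gd (\<rho> q) (\<rho> q') \<le> gd q q'" if "q \<in> points G w" "q' \<in> points G w" for q q'
  proof (rule dist_map_le[OF H])
    show "\<rho> q \<in> points ?H w" if "q \<in> points G w" for q
      using that xy p by (auto simp: points_def \<rho>_def)
    fix e s t assume "e \<in> arcs G" "s \<in> {0..w e}" "t \<in> {0..w e}"
    then show "H.gd (\<rho> (pt e s)) (\<rho> (pt e t)) \<le> \<bar>s - t\<bar>"
      using H.dist_segment[of e s t] xy p(2) by (cases "e = p") (simp_all add: \<rho>p \<rho>a ptH)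
  qed (use that in auto)
  with le sub have eq: "H.gd q q' = gd q q'" if "q \<in> points ?H w" "q' \<in> points ?H w" for q q'
    using that by (metis antisym)
  then show "u \<in> verts G \<Longrightarrow> u \<noteq> x \<Longrightarrow> v \<in> verts G \<Longrightarrow> v \<noteq> x \<Longrightarrow> H.vd u v = vd u v" by simp
  show "diam ?H w \<le> diam G w"
    using eq sub dist_le_diam by (intro H.diam_le) simp
  show "total_length ?H w = total_length G w - w p"
    using pa by (simp add: total_length_def sum_diff1)
  have "card (verts G) > 0" "card (arcs G) > 0" using xy pa by (auto simp: card_gt_0_iff)
  then show "cyc ?H = cyc G"
    using pa xy by (simp add: cyc_def)
  show "vdegree ?H v = (if v = y then vdegree G v - 1 else vdegree G v)" if "v \<noteq> x"
  proof -
    have "vdegree G v = (of_bool (tail G p = v) + of_bool (head G p = v)) + vdegree ?H v"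
      using pa sum.remove[OF finite_arcs pa, of "\<lambda>e. of_bool (tail G e = v) + of_bool (head G e = v) :: nat"]
      by (simp add: degree_eq_sum)
    then show ?thesis using p that by (auto simp: joins_def)
  qed
qed

section \<open>Removing a vertex of degree two\<close>

definition merge_arcs :: "('v, 'e) pre_digraph \<Rightarrow> 'v \<Rightarrow> 'e \<Rightarrow> 'e \<Rightarrow> 'v \<Rightarrow> 'v \<Rightarrow> ('v, 'e) pre_digraph" where
  "merge_arcs G v e1 e2 p q = \<lparr> verts = verts G - {v}, arcs = arcs G - {e2},
     tail = (tail G)(e1 := p), head = (head G)(e1 := q) \<rparr>"

lemma degree_two_arcs:
  assumes "metric_graph G w" and "joins G e1 p v" "joins G e2 v q" "e1 \<noteq> e2" "vdegree G v = 2"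
  shows "p \<noteq> v" "q \<noteq> v" "\<And>a. a \<in> arcs G \<Longrightarrow> tail G a = v \<or> head G a = v \<Longrightarrow> a = e1 \<or> a = e2"
proof -
  interpret metric_graph G w by fact
  show "p \<noteq> v" "q \<noteq> v"
    using assms sum_subset_le_degree[of "{e1, e2}" v] by (auto simp: joins_def split: if_splits)
  show "a = e1 \<or> a = e2" if "a \<in> arcs G" "tail G a = v \<or> head G a = v" for a
  proof (rule ccontr)
    assume "\<not> (a = e1 \<or> a = e2)"
    then have "(\<Sum>e\<in>{a, e1, e2}. of_bool (tail G e = v) + of_bool (head G e = v)) \<ge> (3::nat)"
      using assms(2-4) that by (auto simp: joins_def)
    then show False using assms that sum_subset_le_degree[of "{a, e1, e2}" v] by (auto simp: joins_def)
  qed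
qed

text \<open>Subdividing the merged arc at \<open>w e1\<close> gives back \<open>G\<close> up to the
  orientation of arcs, so the isometry comes from \<open>split_arc_isometry\<close> and
  \<open>relabel_isometry\<close>.\<close>

lemma
  assumes G: "metric_graph G w" and e: "joins G e1 p v" "joins G e2 v q" "e1 \<noteq> e2"
    and deg: "vdegree G v = 2"
  shows merge_arcs_metric_graph: "metric_graph (merge_arcs G v e1 e2 p q) (w(e1 := w e1 + w e2))"
    and merge_arcs_isometry: "\<exists>f. isometry_map G w (merge_arcs G v e1 e2 p q) (w(e1 := w e1 + w e2)) f
      \<and> (\<forall>u\<in>verts G - {v}. f (Vertex u) = Vertex u)"
proof -
  interpret metric_graph G w by fact
  let ?M = "merge_arcs G v e1 e2 p q" and ?m = "w(e1 := w e1 + w e2)"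
  note d2 = degree_two_arcs[OF assms]
  have a: "e1 \<in> arcs G" "e2 \<in> arcs G" and v: "p \<in> verts G" "v \<in> verts G" "q \<in> verts G"
    using e joins_verts by (auto simp: joins_def)
  have noninc: "tail G b \<noteq> v" "head G b \<noteq> v" if "b \<in> arcs G" "b \<noteq> e1" "b \<noteq> e2" for b
    using d2(3) that by auto
  show M: "metric_graph ?M ?m"
  proof (rule metric_graphI)
    fix S assume S: "S \<subseteq> verts ?M" "S \<noteq> {}"
      and cl: "\<And>b. b \<in> arcs ?M \<Longrightarrow> tail ?M b \<in> S \<longleftrightarrow> head ?M b \<in> S"
    have pq: "p \<in> S \<longleftrightarrow> q \<in> S" using cl[of e1] a e(3) by (simp add: merge_arcs_def)
    define S' where "S' = (if p \<in> S then insert v S else S)"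
    have "S' = verts G"
    proof (rule closed_set_eq_verts)
      fix b assume b: "b \<in> arcs G"
      consider "b = e1" | "b = e2" | "b \<noteq> e1" "b \<noteq> e2" by blast
      then show "tail G b \<in> S' \<longleftrightarrow> head G b \<in> S'"
      proof cases
        case 3
        then show ?thesis using cl[of b] b noninc[OF b] by (auto simp: S'_def merge_arcs_def)
      qed (use e pq S d2 in \<open>auto simp: joins_def S'_def merge_arcs_def\<close>)
    qed (use S v in \<open>auto simp: S'_def merge_arcs_def\<close>)
    then show "S = verts ?M" using S v d2 by (auto simp: S'_def merge_arcs_def split: if_splits)
  qed (use a e(3) v d2 noninc length_pos in \<open>auto simp: merge_arcs_def add_pos_pos\<close>)
  interpret M: metric_graph ?M ?m by fact
  have s: "e1 \<in> arcs ?M" "0 < w e1" "w e1 < ?m e1" "v \<notin> verts ?M" "e2 \<notin> arcs ?M"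
    using a e(3) length_pos by (auto simp: merge_arcs_def)
  let ?K = "split_arc ?M e1 v e2" and ?k = "split_length ?m e1 (w e1) e2"
  have K: "metric_graph ?K ?k" using split_arc_metric_graph[OF M s] .
  obtain f where f: "isometry_map ?K ?k ?M ?m f" "\<And>u. u \<in> verts ?M \<Longrightarrow> f (Vertex u) = Vertex u"
    using split_arc_isometry[OF M s] by blast
  have KG: "verts ?K = verts G" "arcs ?K = arcs G"
    using a v by (auto simp: split_arc_def merge_arcs_def)
  obtain g where g: "isometry_map G w ?K ?k g" "\<And>u. g (Vertex u) = Vertex u"
  proof (rule relabel_isometry[OF G K, of "\<lambda>u. u" "\<lambda>e. e"])
    show "?k b = w b" for b
      using e(3) by (simp add: split_length_def)
    show "joins ?K b (tail G b) (head G b)" if "b \<in> arcs G" for b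
      using e that a unfolding joins_def KG by (auto simp: split_arc_def merge_arcs_def)
  qed (use KG in \<open>auto simp: bij_betw_def\<close>)
  have "isometry_map G w ?M ?m (f \<circ> g)" using isometry_map_comp[OF g(1) f(1)] .
  moreover have "(f \<circ> g) (Vertex u) = Vertex u" if "u \<in> verts G - {v}" for u
    using that f(2)[of u] g(2) by (simp add: merge_arcs_def)
  ultimately show "\<exists>f. isometry_map G w ?M ?m f \<and> (\<forall>u\<in>verts G - {v}. f (Vertex u) = Vertex u)"
    by blast
qed

section \<open>Reduced models\<close>

text \<open>The types of \<open>G\<close> may be too small to offer fresh vertices and arcs, so
  everything is moved to \<open>nat\<close>. For the same reason the invariants are compared along
  the explicit bijections here, not through the general isometry invariance.\<close>

lemma nat_model:
  fixes G :: "('v, 'e) pre_digraph"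
  assumes G: "metric_graph G w"
  obtains H :: "(nat, nat) pre_digraph" and w' where "metric_graph H w'" "isometric G w H w'"
    "total_length H w' = total_length G w" "cyc H = cyc G" "num_leaves H = num_leaves G"
proof -
  interpret metric_graph G w by fact
  obtain \<phi> where "bij_betw \<phi> (verts G) {0..<card (verts G)}"
    using ex_bij_betw_finite_nat[OF finite_verts] by blast
  then have \<phi>: "inj_on \<phi> (verts G)" by (simp add: bij_betw_def)
  obtain \<psi> where "bij_betw \<psi> (arcs G) {0..<card (arcs G)}"
    using ex_bij_betw_finite_nat[OF finite_arcs] by blast
  then have \<psi>: "inj_on \<psi> (arcs G)" by (simp add: bij_betw_def)
  let ?i = "inv_into (arcs G) \<psi>"
  define H :: "(nat, nat) pre_digraph" where
    "H = \<lparr> verts = \<phi> ` verts G, arcs = \<psi> ` arcs G, tail = \<lambda>a. \<phi> (tail G (?i a)), head = \<lambda>a. \<phi> (head G (?i a)) \<rparr>"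
  define w' where "w' a = w (?i a)" for a
  have i: "?i (\<psi> e) = e" if "e \<in> arcs G" for e using \<psi> that by simp
  have H: "metric_graph H w'"
  proof (rule metric_graphI)
    fix S assume S: "S \<subseteq> verts H" "S \<noteq> {}"
      and cl: "\<And>b. b \<in> arcs H \<Longrightarrow> tail H b \<in> S \<longleftrightarrow> head H b \<in> S"
    have "{v \<in> verts G. \<phi> v \<in> S} = verts G"
    proof (rule closed_set_eq_verts)
      fix e assume e: "e \<in> arcs G"
      then show "tail G e \<in> {v \<in> verts G. \<phi> v \<in> S} \<longleftrightarrow> head G e \<in> {v \<in> verts G. \<phi> v \<in> S}"
        using cl[of "\<psi> e"] i[OF e] by (simp add: H_def)
    qed (use S in \<open>auto simp: H_def\<close>)
    then show "S = verts H" using S by (auto simp: H_def)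
  qed (use arcs_nonempty length_pos i in \<open>auto simp: H_def w'_def\<close>)
  interpret H: metric_graph H w' by fact
  have ends: "joins H (\<psi> e) (\<phi> (tail G e)) (\<phi> (head G e))" "w' (\<psi> e) = w e" if "e \<in> arcs G" for e
    using that i by (auto simp: joins_def H_def w'_def)
  obtain f where f: "isometry_map G w H w' f" "\<And>v. f (Vertex v) = Vertex (\<phi> v)"
    by (rule relabel_isometry[OF G H, of \<phi> \<psi>]) (use \<phi> \<psi> ends in \<open>auto simp: bij_betw_def H_def\<close>)
  have "total_length H w' = (\<Sum>e\<in>arcs G. w' (\<psi> e))"
    by (simp add: total_length_def H_def sum.reindex[OF \<psi>])
  then have len: "total_length H w' = total_length G w"
    using ends(2) by (simp add: total_length_def)
  have cyc: "cyc H = cyc G"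
    using card_image[OF \<phi>] card_image[OF \<psi>] by (simp add: cyc_def H_def)
  have "vdegree H (\<phi> v) = vdegree G v" if "v \<in> verts G" for v
    using isometry_degree[OF G H f(1) that f(2)] by simp
  then have "{v \<in> verts H. vdegree H v = 1} = \<phi> ` {v \<in> verts G. vdegree G v = 1}"
    by (auto simp: H_def)
  then have "num_leaves H = num_leaves G"
    using inj_on_subset[OF \<phi>] by (simp add: num_leaves_eq card_image)
  with H f(1) len cyc that show thesis using isometric_iff by blast
qed

text \<open>In a reduced graph the weight \<open>deg v - 2\<close> vanishes nowhere, so tight
  weighted sums say something about every vertex.\<close>

definition reduced :: "('v, 'e) pre_digraph \<Rightarrow> bool" where
  "reduced G \<longleftrightarrow> (\<forall>v\<in>verts G. vdegree G v \<noteq> 2)"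

text \<open>Take an isometric model with the fewest vertices. A vertex of degree two that lies on
  two different arcs could be merged away; otherwise it carries a loop and nothing else, and
  connectedness makes the graph a circle.\<close>

lemma reduced_model:
  fixes G :: "(nat, nat) pre_digraph"
  assumes G: "metric_graph G w"
  obtains H :: "(nat, nat) pre_digraph" and w' where "metric_graph H w'" "isometric G w H w'"
    "reduced H \<or> (\<exists>v e. verts H = {v} \<and> arcs H = {e})"
proof -
  define P where "P X \<longleftrightarrow> metric_graph (fst X) (snd X) \<and> isometric G w (fst X) (snd X)"
    for X :: "(nat, nat) pre_digraph \<times> (nat \<Rightarrow> real)"
  have "P (G, w)" using G isometric_refl by (simp add: P_def)
  from ex_has_least_nat[of P, OF this, of "\<lambda>X. card (verts (fst X))"]
  obtain X where X: "P X" "\<And>Y. P Y \<Longrightarrow> card (verts (fst X)) \<le> card (verts (fst Y))" by blast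
  define H w' where "H = fst X" and "w' = snd X"
  have H: "metric_graph H w'" and iso: "isometric G w H w'"
    using X(1) by (auto simp: P_def H_def w'_def)
  have min: "card (verts H) \<le> card (verts K)" if "metric_graph K k" "isometric G w K k"
    for K :: "(nat, nat) pre_digraph" and k
    using X(2)[of "(K, k)"] that by (simp add: P_def H_def)
  interpret H: metric_graph H w' by fact
  have "\<exists>e. verts H = {v} \<and> arcs H = {e}" if v: "v \<in> verts H" "vdegree H v = 2" for v
  proof -
    obtain e1 p where e1: "joins H e1 p v" using H.incident_arc[OF v(1)] .
    have only: "a = e1" if a: "a \<in> arcs H" "tail H a = v \<or> head H a = v" for a
    proof (rule ccontr)
      assume "a \<noteq> e1"
      then obtain q where q: "joins H a v q" "e1 \<noteq> a" using a by (auto simp: joins_def)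
      obtain f where "isometry_map H w' (merge_arcs H v e1 a p q) (w'(e1 := w' e1 + w' a)) f"
        using merge_arcs_isometry[OF H e1 q v(2)] by blast
      then have "isometric G w (merge_arcs H v e1 a p q) (w'(e1 := w' e1 + w' a))"
        using iso isometric_trans isometric_iff by blast
      then have "card (verts H) \<le> card (verts H - {v})"
        using min[OF merge_arcs_metric_graph[OF H e1 q v(2)]] by (simp add: merge_arcs_def)
      then show False using v(1) card_Diff1_less[OF H.finite_verts v(1)] by linarith
    qed
    have "p = v"
    proof (rule ccontr)
      assume "p \<noteq> v"
      have "vdegree H v = (\<Sum>e\<in>arcs H. if e = e1 then 1 else 0)"
        unfolding degree_eq_sum[OF H.finite_arcs]
      proof (rule sum.cong[OF refl])
        fix e assume e: "e \<in> arcs H"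
        show "of_bool (tail H e = v) + of_bool (head H e = v) = (if e = e1 then 1 else 0 :: nat)"
        proof (cases "e = e1")
          case True
          then show ?thesis using e1 \<open>p \<noteq> v\<close> by (auto simp: joins_def)
        next
          case False
          then have "tail H e \<noteq> v" "head H e \<noteq> v" using only[OF e] by blast+
          with False show ?thesis by simp
        qed
      qed
      with v(2) show False by (simp split: if_splits)
    qed
    have "{v} = verts H"
    proof (rule H.closed_set_eq_verts)
      fix e assume "e \<in> arcs H"
      then show "tail H e \<in> {v} \<longleftrightarrow> head H e \<in> {v}"
        using only[of e] e1 \<open>p = v\<close> by (auto simp: joins_def)
    qed (use v in auto)
    moreover have "arcs H = {e1}"
    proof (intro equalityI subsetI)
      fix a assume a: "a \<in> arcs H"
      then have "tail H a = v" using H.tail_in_verts \<open>{v} = verts H\<close> by blast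
      then show "a \<in> {e1}" using only[OF a] by simp
    qed (use e1 in \<open>simp add: joins_def\<close>)
    ultimately show ?thesis by blast
  qed
  then have "reduced H \<or> (\<exists>v e. verts H = {v} \<and> arcs H = {e})"
    unfolding reduced_def by blast
  with that[OF H iso] show thesis by blast
qed

section \<open>Subdividing at a given point\<close>

context metric_graph
begin

text \<open>Collects the facts about a subdivision that are used later. Distances from the new
  vertex are expressed by distances in \<open>G\<close>, so an argument with an interior point as
  root can be carried out in the subdivided graph and read off in \<open>G\<close>.\<close>

definition splits_at :: "'e \<Rightarrow> real \<Rightarrow> 'v \<Rightarrow> 'e \<Rightarrow> bool" where
  "splits_at e s v' e' \<longleftrightarrow>
     (let K = split_arc G e v' e'; k = split_length w e s e' in
       v' \<notin> verts G \<and> e' \<notin> arcs G \<and> metric_graph K k \<and> isometric G w K k \<and>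
       (\<forall>u\<in>verts G. graph_dist K k (Vertex v') (Vertex u)
         = min (vd u (tail G e) + s) (vd u (head G e) + w e - s)) \<and>
       (\<forall>u\<in>verts G. \<forall>v\<in>verts G. graph_dist K k (Vertex u) (Vertex v) = vd u v) \<and>
       (\<forall>u\<in>verts G. vdegree K u = vdegree G u) \<and> vdegree K v' = 2 \<and> cyc K = cyc G
       \<and> total_length K k = total_length G w)"

lemma splits_atD:
  assumes "splits_at e s v' e'"
  shows "v' \<notin> verts G" "e' \<notin> arcs G"
    "metric_graph (split_arc G e v' e') (split_length w e s e')"
    "isometric G w (split_arc G e v' e') (split_length w e s e')"
    "\<And>u. u \<in> verts G \<Longrightarrow> graph_dist (split_arc G e v' e') (split_length w e s e') (Vertex v') (Vertex u)
      = min (vd u (tail G e) + s) (vd u (head G e) + w e - s)"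
    "\<And>u v. u \<in> verts G \<Longrightarrow> v \<in> verts G \<Longrightarrow>
      graph_dist (split_arc G e v' e') (split_length w e s e') (Vertex u) (Vertex v) = vd u v"
    "\<And>u. u \<in> verts G \<Longrightarrow> vdegree (split_arc G e v' e') u = vdegree G u"
    "vdegree (split_arc G e v' e') v' = 2"
    "cyc (split_arc G e v' e') = cyc G"
    "total_length (split_arc G e v' e') (split_length w e s e') = total_length G w"
  using assms unfolding splits_at_def Let_def by simp_all

lemma ex_splits_at:
  assumes e: "e \<in> arcs G" and s: "0 < s" "s < w e"
    and inf: "infinite (UNIV :: 'v set)" "infinite (UNIV :: 'e set)"
  shows "\<exists>v' e'. splits_at e s v' e'"
proof -
  obtain v' where v': "v' \<notin> verts G" using ex_new_if_finite[OF inf(1) finite_verts] by blast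
  obtain e' where e': "e' \<notin> arcs G" using ex_new_if_finite[OF inf(2) finite_arcs] by blast
  note G = metric_graph_axioms
  let ?K = "split_arc G e v' e'" and ?k = "split_length w e s e'"
  have K: "metric_graph ?K ?k" using split_arc_metric_graph[OF G e s v' e'] .
  interpret K: metric_graph ?K ?k by fact
  obtain f where f: "isometry_map ?K ?k G w f" "f (Vertex v') = Inner e s"
    "\<And>v. v \<in> verts G \<Longrightarrow> f (Vertex v) = Vertex v"
    using split_arc_isometry[OF G e s v' e'] by blast
  have vK: "v' \<in> verts ?K" "u \<in> verts G \<Longrightarrow> u \<in> verts ?K" for u by (auto simp: split_arc_def)
  have gd: "K.gd x y = gd (f x) (f y)" if "x \<in> points ?K ?k" "y \<in> points ?K ?k" for x y
    using f(1) that by (simp add: isometry_map_def)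
  have "isometric G w ?K ?k" using f(1) isometric_iff isometric_sym by blast
  moreover have "K.vd v' u = min (vd u (tail G e) + s) (vd u (head G e) + w e - s)" if "u \<in> verts G" for u
  proof -
    have "K.vd v' u = gd (Vertex u) (pt e s)"
      using gd[of "Vertex v'" "Vertex u"] vK that f s dist_commute by (simp add: point_at_def)
    then show ?thesis using dist_point_at[OF that e, of s] s by simp
  qed
  moreover have "K.vd u v = vd u v" if "u \<in> verts G" "v \<in> verts G" for u v
    using gd[of "Vertex u" "Vertex v"] vK that f(3) by simp
  moreover have "vdegree ?K u = vdegree G u" if "u \<in> verts G" for u
    using isometry_degree(2)[OF K G f(1) vK(2) f(3)] that by metis
  moreover have "vdegree ?K v' = 2" using split_arc_degree_new[OF wf_digraph_axioms finite_arcs e e' v'] .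
  moreover have "cyc ?K = cyc G" using v' e' by (simp add: cyc_def split_arc_def)
  moreover have "total_length ?K ?k = total_length G w" using split_arc_total_length[OF finite_arcs e e'] .
  ultimately show ?thesis using v' e' K unfolding splits_at_def Let_def by (intro exI[of _ v'] exI[of _ e']) simp
qed

end

section \<open>Moments\<close>

text \<open>This and \<open>sum_le_0_imp_eq_0\<close> serve the equality cases: a tight estimate of
  a sum is tight in each term.\<close>

lemma sum_eq_const_bound:
  fixes f :: "'a \<Rightarrow> real"
  assumes "finite A" "\<And>a. a \<in> A \<Longrightarrow> f a \<le> c" "real (card A) * c \<le> sum f A" "a \<in> A"
  shows "f a = c"
proof -
  have "(\<Sum>a\<in>A. c - f a) \<le> 0" using assms(3) by (simp add: sum_subtractf)
  then have "(\<Sum>a\<in>A. c - f a) = 0" using assms(2) by (intro antisym sum_nonneg) auto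
  then have "c - f a = 0"
    using sum_nonneg_eq_0_iff[of A "\<lambda>a. c - f a"] assms by auto
  then show ?thesis by simp
qed

lemma sum_le_0_imp_eq_0:
  fixes f :: "'a \<Rightarrow> real"
  assumes "finite A" "\<And>a. a \<in> A \<Longrightarrow> 0 \<le> f a" "sum f A \<le> 0" "a \<in> A"
  shows "f a = 0"
proof -
  have "sum f A = 0" using assms(2,3) sum_nonneg[of A f] by (intro antisym) auto
  then show ?thesis using sum_nonneg_eq_0_iff[OF assms(1), of f] assms(2,4) by simp
qed

context metric_graph
begin

text \<open>Negative only at leaves and zero only in degree two, since every vertex has an
  arc.\<close>

definition weight :: "'v \<Rightarrow> real" where
  "weight v = real (vdegree G v) - 2"

definition moment :: "'v \<Rightarrow> real" where
  "moment r = (\<Sum>v\<in>verts G. weight v * vd r v)"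

abbreviation k :: real where "k \<equiv> real_of_int (cyc G)"

lemma sum_weight: "(\<Sum>v\<in>verts G. weight v) = 2 * k - 2"
  using sum_degree_minus_2 by (simp add: weight_def)

definition cotree :: "'v \<Rightarrow> 'e set \<Rightarrow> bool" where
  "cotree r N \<longleftrightarrow> N \<subseteq> arcs G \<and> real (card N) = k \<and>
     total_length G w + moment r = (\<Sum>e\<in>N. height2 r e) \<and>
     (\<forall>e\<in>arcs G - N. \<exists>a. a \<noteq> r \<and> tops r e a) \<and>
     (\<forall>a\<in>verts G - {r}. \<exists>!e. e \<in> arcs G - N \<and> tops r e a)"

lemma ex_cotree: "r \<in> verts G \<Longrightarrow> \<exists>N. cotree r N"
proof -
  assume r: "r \<in> verts G"
  show ?thesis
  proof (rule shortest_path_tree[OF r])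
    fix N assume N: "N \<subseteq> arcs G" "int (card N) = cyc G"
      "total_length G w = (\<Sum>e\<in>N. height2 r e) - (\<Sum>v\<in>verts G. (real (vdegree G v) - 2) * vd r v)"
      "\<And>e. e \<in> arcs G \<Longrightarrow> e \<notin> N \<Longrightarrow> \<exists>a. a \<noteq> r \<and> tops r e a"
      "\<And>a. a \<in> verts G \<Longrightarrow> a \<noteq> r \<Longrightarrow> \<exists>!e. e \<in> arcs G - N \<and> tops r e a"
    have "real (card N) = k" using N(2) by (metis of_int_of_nat_eq)
    moreover have "total_length G w + moment r = (\<Sum>e\<in>N. height2 r e)"
      using N(3) by (simp add: moment_def weight_def)
    ultimately show "\<exists>N. cotree r N"
      using N(1,4,5) unfolding cotree_def by (intro exI[of _ N]) simp
  qed
qed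

lemma cotreeD:
  assumes "cotree r N"
  shows "N \<subseteq> arcs G" "finite N" "real (card N) = k"
    "total_length G w + moment r = (\<Sum>e\<in>N. height2 r e)"
    "\<And>e. e \<in> arcs G \<Longrightarrow> e \<notin> N \<Longrightarrow> \<exists>a. a \<noteq> r \<and> tops r e a"
    "\<And>a. a \<in> verts G \<Longrightarrow> a \<noteq> r \<Longrightarrow> \<exists>!e. e \<in> arcs G - N \<and> tops r e a"
  using assms finite_subset[OF _ finite_arcs] unfolding cotree_def by simp_all

lemma tops_iff:
  assumes "r \<in> verts G" "e \<in> arcs G"
  shows "(\<exists>a. tops r e a) \<longleftrightarrow> \<bar>vd r (tail G e) - vd r (head G e)\<bar> = w e"
proof
  assume "\<exists>a. tops r e a"
  then show "\<bar>vd r (tail G e) - vd r (head G e)\<bar> = w e"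
    using length_pos[OF assms(2)] by (auto simp: tops_def joins_def)
next
  assume "\<bar>vd r (tail G e) - vd r (head G e)\<bar> = w e"
  then have "tops r e (if vd r (tail G e) \<le> vd r (head G e) then head G e else tail G e)"
    using assms(2) by (auto simp: tops_def joins_def)
  then show "\<exists>a. tops r e a" by blast
qed

lemma moment_le:
  assumes r: "r \<in> verts G" and E: "\<And>e. e \<in> arcs G \<Longrightarrow> height2 r e \<le> E"
  shows "total_length G w + moment r \<le> k * E"
proof -
  obtain N where "cotree r N" using ex_cotree[OF r] by blast
  note N = cotreeD[OF this]
  have "(\<Sum>e\<in>N. height2 r e) \<le> real (card N) * E"
    by (rule sum_bounded_above) (use E N(1) in blast)
  then show ?thesis using N(3,4) by simp
qed

end

text \<open>The subdividing vertex has weight zero, so the moment in the new graph is a sum over the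
  old vertices, even if the root is the new vertex.\<close>

lemma split_arc_moment:
  assumes G: "metric_graph G w" and K: "metric_graph (split_arc G e v' e') k'"
    and v': "v' \<notin> verts G" and deg: "vdegree (split_arc G e v' e') v' = 2"
    "\<And>u. u \<in> verts G \<Longrightarrow> vdegree (split_arc G e v' e') u = vdegree G u"
  shows "metric_graph.moment (split_arc G e v' e') k' r
    = (\<Sum>v\<in>verts G. metric_graph.weight G v * graph_dist (split_arc G e v' e') k' (Vertex r) (Vertex v))"
proof -
  interpret G: metric_graph G w by fact
  interpret K: metric_graph "split_arc G e v' e'" k' by fact
  have "verts (split_arc G e v' e') = insert v' (verts G)" by (simp add: split_arc_def)
  then show ?thesis
    using v' deg by (simp add: K.moment_def K.weight_def G.weight_def)
qed

context metric_graph
begin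

text \<open>This is \<open>moment_le\<close> with an arbitrary point of an arc as root, obtained by
  making that point a vertex.\<close>

lemma moment_point_le:
  assumes e: "e \<in> arcs G" and t: "t \<in> {0..w e}"
    and inf: "infinite (UNIV :: 'v set)" "infinite (UNIV :: 'e set)"
  shows "total_length G w + (\<Sum>v\<in>verts G. weight v * gd (Vertex v) (pt e t)) \<le> k * (2 * diam G w)"
proof -
  consider "t = 0" | "t = w e" | "0 < t" "t < w e" using t by force
  then show ?thesis
  proof cases
    case 1
    then show ?thesis
      using moment_le[of "tail G e" "2 * diam G w"] height2_le_diam e
      by (simp add: moment_def vd_commute)
  next
    case 2
    then show ?thesis
      using moment_le[of "head G e" "2 * diam G w"] height2_le_diam e
      by (simp add: moment_def vd_commute)
  next
    case 3
    obtain v' e' where "splits_at e t v' e'" using ex_splits_at[OF e 3 inf] by blast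
    note K = splits_atD[OF this]
    interpret K: metric_graph "split_arc G e v' e'" "split_length w e t e'" by fact
    have "K.moment v' = (\<Sum>v\<in>verts G. weight v * gd (Vertex v) (pt e t))"
      using split_arc_moment[OF metric_graph_axioms K(3,1,8,7)] K(5) dist_point_at[OF _ e t] by simp
    moreover have "v' \<in> verts (split_arc G e v' e')" by (simp add: split_arc_def)
    ultimately show ?thesis
      using K.moment_le[of v' "2 * diam G w"] K.height2_le_diam isometric_diam[OF K(4)] K(9,10) by simp
  qed
qed

section \<open>Graphs without leaves\<close>

text \<open>Equality forces every vertex to have the same moment \<open>(k - 1) * D\<close>. The
  moment of a midpoint is no larger, while a midpoint is at least as far from each vertex as its two
  ends are on average; hence distances from vertices are linear along all arcs. So highest points
  are vertices, and counting weights decides the rest.\<close>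

lemma leafless_extremal:
  assumes inf: "infinite (UNIV :: 'v set)" "infinite (UNIV :: 'e set)"
    and deg: "\<And>v. v \<in> verts G \<Longrightarrow> 3 \<le> vdegree G v"
    and len: "total_length G w = (k + 1) * diam G w"
  obtains u q where "u \<noteq> q" "verts G = {u, q}"
    "\<And>e. e \<in> arcs G \<Longrightarrow> joins G e u q \<and> w e = diam G w"
proof -
  let ?D = "diam G w"
  have W: "1 \<le> weight v" if "v \<in> verts G" for v
    using deg[OF that] by (simp add: weight_def)
  obtain u where u: "u \<in> verts G" using verts_nonempty by blast
  have "weight u \<le> (\<Sum>v\<in>verts G. weight v)"
    by (rule member_le_sum) (use u W in \<open>force+\<close>)
  then have "3 \<le> 2 * k" using W[OF u] sum_weight by simp
  \<comment> \<open>Integrality of \<open>cyc G\<close> improves the bound \<open>3 / 2\<close> to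
    \<open>2\<close>.\<close>
  then have "real_of_int 3 \<le> real_of_int (2 * cyc G)" by simp
  then have "2 \<le> cyc G" by (simp only: of_int_le_iff)
  then have k2: "2 \<le> k" by simp
  have up: "moment r \<le> (k - 1) * ?D" if "r \<in> verts G" for r
    using moment_le[OF that height2_le_diam[OF that]] len by (simp add: algebra_simps)
  have low: "moment r = (k - 1) * ?D" if r: "r \<in> verts G" for r
  proof -
    obtain N where "cotree r N" using ex_cotree[OF r] by blast
  note N = cotreeD[OF this]
    note fin = N(2)
    have ne: "N \<noteq> {}" using N(3) k2 by auto
    have "Max (height2 r ` N) \<in> height2 r ` N" using fin ne by (intro Max_in) auto
    then obtain e where e: "e \<in> N" "height2 r e = Max (height2 r ` N)" by auto
    then have max: "height2 r a \<le> height2 r e" if "a \<in> N" for a using that fin by simp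
    have ea: "e \<in> arcs G" using e N(1) by blast
    define t where "t = (vd r (head G e) - vd r (tail G e) + w e) / 2"
    note t = top_point[OF r ea, folded t_def]
    have 1: "total_length G w + moment r \<le> k * height2 r e"
      using sum_bounded_above[of N "height2 r" "height2 r e"] max N(3,4) by simp
    have 2: "(\<Sum>v\<in>verts G. weight v * gd (Vertex v) (pt e t)) \<le> (k - 1) * ?D"
      using moment_point_le[OF ea t(1) inf] len by (simp add: algebra_simps)
    have "(\<Sum>v\<in>verts G. weight v * (height2 r e / 2))
      \<le> (\<Sum>v\<in>verts G. weight v * (vd r v + gd (Vertex v) (pt e t)))"
    proof (intro sum_mono mult_left_mono)
      fix v assume "v \<in> verts G"
      then show "height2 r e / 2 \<le> vd r v + gd (Vertex v) (pt e t)"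
        using dist_triangle[of "Vertex r" "Vertex v" "pt e t"] r t pt_in_points[OF ea] by simp
    qed (use W in force)
    then have "(2 * k - 2) * (height2 r e / 2) \<le> moment r + (k - 1) * ?D"
      unfolding sum_distrib_right[symmetric] sum_weight using 2
      by (simp add: moment_def distrib_left sum.distrib)
    then have 3: "(k - 1) * height2 r e \<le> moment r + (k - 1) * ?D" by (simp add: field_simps)
    \<comment> \<open>Eliminating \<open>moment r\<close> from 1 and 3 leaves an estimate for the
      highest point alone: its distance from \<open>r\<close> is the diameter.\<close>
    with 1 len have "2 * ?D \<le> height2 r e" by (simp add: algebra_simps)
    then have "(k - 1) * (2 * ?D) \<le> (k - 1) * height2 r e" using k2 by (intro mult_left_mono) auto
    with 3 have "(k - 1) * ?D \<le> moment r" by (simp add: algebra_simps)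
    with up[OF r] show ?thesis by simp
  qed
  have tight: "\<bar>vd v (tail G e) - vd v (head G e)\<bar> = w e" if e: "e \<in> arcs G" and v: "v \<in> verts G" for e v
  proof -
    have we: "w e / 2 \<in> {0..w e}" using length_pos[OF e] by simp
    \<comment> \<open>The weighted excess, as seen from \<open>v\<close>, of the distance to the
      midpoint over the average distance to the ends.\<close>
    let ?f = "\<lambda>v. weight v * ((w e - \<bar>vd v (tail G e) - vd v (head G e)\<bar>) / 2)"
    have "(\<Sum>v\<in>verts G. ?f v) = (\<Sum>v\<in>verts G. weight v * gd (Vertex v) (pt e (w e / 2)))
        - moment (tail G e) / 2 - moment (head G e) / 2"
    proof -
      have "?f v = weight v * gd (Vertex v) (pt e (w e / 2)) - weight v * vd (tail G e) v / 2
          - weight v * vd (head G e) v / 2" if "v \<in> verts G" for v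
      proof -
        have "gd (Vertex v) (pt e (w e / 2)) - vd (tail G e) v / 2 - vd (head G e) v / 2
            = (w e - \<bar>vd v (tail G e) - vd v (head G e)\<bar>) / 2"
          using dist_point_at[OF that e we] vd_commute[of v]
          by (auto simp: min_def abs_if field_simps)
        from arg_cong[OF this, of "\<lambda>x. weight v * x"] show ?thesis
          by (simp only: right_diff_distrib times_divide_eq_right[symmetric])
      qed
      then have "(\<Sum>v\<in>verts G. ?f v) = (\<Sum>v\<in>verts G. weight v * gd (Vertex v) (pt e (w e / 2))
          - weight v * vd (tail G e) v / 2 - weight v * vd (head G e) v / 2)"
        by (rule sum.cong[OF refl])
      then show ?thesis
        by (simp only: moment_def sum_subtractf sum_divide_distrib)
    qed
    also have "\<dots> \<le> 0"
      using moment_point_le[OF e we inf] low[of "tail G e"] low[of "head G e"] e len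
      by (simp add: algebra_simps)
    finally have "?f v = 0"
      using e W dist_arc_abs[OF joins_ends[OF e]] v
      by (intro sum_le_0_imp_eq_0[of "verts G" ?f v]) (auto intro!: mult_nonneg_nonneg, force)
    then show ?thesis using W[OF v] by auto
  qed
  obtain N where "cotree u N" using ex_cotree[OF u] by blast
  note N = cotreeD[OF this]
  note finN = N(2)
  have "N \<noteq> {}" using N(3) k2 by auto
  have hN: "height2 u e = 2 * ?D" if "e \<in> N" for e
    by (rule sum_eq_const_bound[OF finN _ _ that])
      (use N(1,3,4) u height2_le_diam len low[OF u] in \<open>auto simp: algebra_simps\<close>)
  have topD: "\<exists>a. tops u e a \<and> vd u a = ?D" if "e \<in> N" for e
  proof -
    have "e \<in> arcs G" using that N(1) by blast
    with tight[OF this u] tops_iff[OF u] obtain a where "tops u e a" by blast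
    then show ?thesis using tops_height2[of u e a] hN[OF that] by auto
  qed
  obtain e0 where "e0 \<in> N" using \<open>N \<noteq> {}\<close> by blast
  with topD obtain q where q: "tops u e0 q" "vd u q = ?D" by blast
  have qv: "q \<in> verts G" using tops_arc q by blast
  have uq: "u \<noteq> q" using q(2) diam_pos u by auto
  \<comment> \<open>The moments of \<open>u\<close> and \<open>q\<close> add up to the total weight
    times \<open>D\<close>, so no vertex can lie off the geodesics from \<open>u\<close> to
    \<open>q\<close>.\<close>
  have between: "vd u v + vd q v = ?D" if "v \<in> verts G" for v
  proof -
    have "(\<Sum>v\<in>verts G. weight v * (vd u v + vd q v - ?D)) = moment u + moment q - (2 * k - 2) * ?D"
      by (simp add: moment_def algebra_simps sum.distrib sum_subtractf flip: sum_distrib_left)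
        (simp add: sum_weight algebra_simps)
    also have "\<dots> = 0" using low[OF u] low[OF qv] by (simp add: algebra_simps)
    finally have "weight v * (vd u v + vd q v - ?D) = 0"
      using vd_triangle[OF u _ qv] vd_commute[of q] q(2) W that
      by (intro sum_le_0_imp_eq_0[of "verts G" "\<lambda>v. weight v * (vd u v + vd q v - ?D)"])
        (auto intro!: mult_nonneg_nonneg, force)
    then show ?thesis using W[OF that] by auto
  qed
  have topq: "tops u e q" if "e \<in> N" for e
  proof -
    obtain a where a: "tops u e a" "vd u a = ?D" using topD[OF \<open>e \<in> N\<close>] by blast
    then have "a \<in> verts G" "vd q a = 0" using tops_arc between[of a] by auto
    then have "a = q" using vd_pos[OF qv, of a] by auto
    with a show ?thesis by simp
  qed
  obtain e1 where e1: "e1 \<in> arcs G - N" "tops u e1 q" using N(6)[OF qv] uq by blast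
  \<comment> \<open>All \<open>k\<close> omitted arcs and the tree arc \<open>e1\<close> end in
    \<open>q\<close>, so its weight is at least \<open>k - 1\<close>. With \<open>vd u q = D\<close>
    this already exhausts the moment of \<open>u\<close>, which leaves no room for a third
    vertex.\<close>
  have "card (insert e1 N) \<le> (\<Sum>e\<in>insert e1 N. of_bool (tail G e = q) + of_bool (head G e = q))"
    unfolding card_eq_sum by (rule sum_mono) (use topq e1 in \<open>auto simp: tops_def joins_def\<close>)
  also have "\<dots> \<le> vdegree G q" by (rule sum_subset_le_degree) (use e1 N(1) in auto)
  finally have Wq: "k - 1 \<le> weight q" using N(3) e1 finN by (simp add: weight_def)
  have V: "v = u \<or> v = q" if v: "v \<in> verts G" for v
  proof (rule ccontr)
    assume neq: "\<not> (v = u \<or> v = q)"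
    have "weight q * vd u q + weight v * vd u v = (\<Sum>a\<in>{q, v}. weight a * vd u a)"
      using neq by (subst sum.insert) auto
    also have "\<dots> \<le> moment u"
      unfolding moment_def using v qv W vd_nonneg[OF u]
      by (intro sum_mono2) (auto intro!: mult_nonneg_nonneg, force)
    also have "\<dots> \<le> weight q * ?D"
      using low[OF u] Wq diam_pos by (simp add: mult_right_mono)
    finally have "weight v * vd u v \<le> 0" using q(2) by simp
    then show False using W[OF v] vd_pos[OF u v] neq by (auto simp: mult_le_0_iff)
  qed
  show thesis
  proof (rule that[OF uq])
    show "verts G = {u, q}" using V u qv by blast
    fix e assume e: "e \<in> arcs G"
    then have "tail G e \<noteq> head G e" using tight[OF e u] length_pos[OF e] by auto
    then show "joins G e u q \<and> w e = ?D"
      using e tight[OF e u] V[of "tail G e"] V[of "head G e"] q(2) u diam_pos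
      by (auto simp: joins_def)
  qed
qed

end

section \<open>Graphs with one leaf\<close>

text \<open>Here \<open>x\<close> is the leaf and \<open>u\<close> the foot of its arc.\<close>

definition pendant :: "('v, 'e) pre_digraph \<Rightarrow> 'e \<Rightarrow> 'v \<Rightarrow> 'v \<Rightarrow> bool" where
  "pendant G e u x \<longleftrightarrow> joins G e u x \<and> u \<noteq> x \<and>
     (\<forall>a\<in>arcs G. tail G a = x \<or> head G a = x \<longrightarrow> a = e)"

context metric_graph
begin

lemma ex_pendant:
  assumes "x \<in> verts G" "vdegree G x = 1"
  shows "\<exists>e u. pendant G e u x"
proof (rule leaf_arc[OF assms])
  fix e u
  assume "joins G e u x" "u \<noteq> x" "\<And>a. a \<in> arcs G \<Longrightarrow> tail G a = x \<or> head G a = x \<Longrightarrow> a = e"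
  then have "pendant G e u x" unfolding pendant_def by blast
  then show ?thesis by blast
qed

text \<open>
  Two geodesics from \<open>q\<close> to \<open>x\<close> starting along different arcs meet for the first time at a vertex \<open>a\<close>,
  which therefore has two parents in the direction of \<open>q\<close>.
\<close>

lemma geodesics_meet:
  assumes x: "x \<in> verts G" "vdegree G x = 1" and ne: "e1 \<noteq> e2"
    and top: "tops x e1 q" "tops x e2 q"
  obtains a c1 c2 where "a \<noteq> x" "a \<noteq> q" "c1 \<noteq> c2" "tops q c1 a" "tops q c2 a" "vd x a + vd q a = vd x q"
proof -
  have q: "q \<in> verts G" using tops_arc[OF top(1)] by simp
  obtain z1 z2 where z1: "joins G e1 z1 q" "vd x q = vd x z1 + w e1"
    and z2: "joins G e2 z2 q" "vd x q = vd x z2 + w e2"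
    using top by (auto simp: tops_def)
  \<comment> \<open>One move along a tight arc towards \<open>x\<close>; along such moves distances
    add up exactly.\<close>
  define step where "step = {(a, b). \<exists>e. joins G e b a \<and> vd x a = vd x b + w e}"
  have stepD: "b \<in> verts G \<and> a \<in> verts G \<and> vd x b < vd x a" if s: "(a, b) \<in> step" for a b
  proof -
    obtain e where e: "joins G e b a" "vd x a = vd x b + w e" using s by (auto simp: step_def)
    then show ?thesis using joins_verts[OF e(1)] length_pos[OF joins_arc[OF e(1)]] by simp
  qed
  have desc: "b \<in> verts G \<and> vd x b \<le> vd x a \<and> vd a b = vd x a - vd x b"
    if "(a, b) \<in> step\<^sup>*" "a \<in> verts G" for a b
    using that
  proof (induction rule: rtrancl_induct)
    case base
    then show ?case by simp
  next
    case (step b c)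
    then obtain e where e: "joins G e c b" "vd x b = vd x c + w e" by (auto simp: step_def)
    have c: "c \<in> verts G" "vd x c < vd x b" using stepD[OF step.hyps(2)] by auto
    have "vd a c \<le> vd a b + w e" using dist_arc[OF _ step.prems, of e b c] e(1) by (simp add: joins_commute)
    moreover have "vd x a \<le> vd x c + vd c a" using vd_triangle x(1) c(1) step.prems by blast
    ultimately show ?case using step e c vd_commute[of c a] by simp
  qed
  have reach: "(z, x) \<in> step\<^sup>*" if "z \<in> verts G" for z
  proof -
    let ?R = "{v. (z, v) \<in> step\<^sup>*}"
    have R: "?R \<subseteq> verts G" using desc that by auto
    have fin: "finite ?R" using finite_subset[OF R finite_verts] .
    obtain v where v: "v \<in> ?R" "\<And>u. u \<in> ?R \<Longrightarrow> vd x v \<le> vd x u"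
    proof -
      have "z \<in> ?R" by simp
      with fin have "Min (vd x ` ?R) \<in> vd x ` ?R" by (intro Min_in) auto
      then obtain v where "v \<in> ?R" "vd x v = Min (vd x ` ?R)" by auto
      then show thesis using that[of v] fin by simp
    qed
    have "v = x"
    proof (rule ccontr)
      assume "v \<noteq> x"
      then obtain e u where e: "joins G e u v" "vd x v = vd x u + w e"
        using dist_parent[OF x(1), of v] v(1) R by blast
      then have s: "(v, u) \<in> step" by (auto simp: step_def)
      then have "u \<in> ?R" using v(1) by auto
      then show False using v(2) stepD[OF s] by fastforce
    qed
    with v show ?thesis by simp
  qed
  define R where "R z = {v. (z, v) \<in> step\<^sup>*}" for z
  have zv: "z1 \<in> verts G" "z2 \<in> verts G" using z1 z2 joins_verts by blast+
  have finR: "finite (R z1 \<inter> R z2)" using desc[OF _ zv(1)] by (auto simp: R_def intro: finite_subset[OF _ finite_verts])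
  have xR: "x \<in> R z1 \<inter> R z2" using reach zv by (simp add: R_def)
  \<comment> \<open>The highest common descendant of \<open>z1\<close> and \<open>z2\<close> is
    where two descents from \<open>q\<close> meet for the first time.\<close>
  obtain a where a: "a \<in> R z1 \<inter> R z2" "\<And>u. u \<in> R z1 \<inter> R z2 \<Longrightarrow> vd x u \<le> vd x a"
  proof -
    have "Max (vd x ` (R z1 \<inter> R z2)) \<in> vd x ` (R z1 \<inter> R z2)"
      using finR xR by (intro Max_in) auto
    then obtain a where "a \<in> R z1 \<inter> R z2" "vd x a = Max (vd x ` (R z1 \<inter> R z2))" by auto
    then show thesis using that[of a] finR by simp
  qed
  have qstep: "(q, z1) \<in> step" "(q, z2) \<in> step" using z1 z2 by (auto simp: step_def)
  \<comment> \<open>The last arc by which a descent starting with \<open>e\<close> arrives at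
    \<open>a\<close>; the vertex before \<open>a\<close> is \<open>q\<close> or still a descendant
    of \<open>z\<close>.\<close>
  have into: "\<exists>c v. joins G c v a \<and> vd x v = vd x a + w c \<and> (v = q \<and> c = e \<or> v \<in> R z) \<and> (q, v) \<in> step\<^sup>*"
    if "a \<in> R z" "joins G e z q" "vd x q = vd x z + w e" for z e
  proof (cases "a = z")
    case True
    then show ?thesis using that by (intro exI[of _ e] exI[of _ q]) (auto simp: joins_commute)
  next
    case False
    have qz: "(q, z) \<in> step" using that by (auto simp: step_def)
    from that(1) have "(z, a) \<in> step\<^sup>*" by (simp add: R_def)
    then obtain v where v: "(z, v) \<in> step\<^sup>*" "(v, a) \<in> step" using False by (metis rtranclE)
    then obtain c where "joins G c a v" "vd x v = vd x a + w c" by (auto simp: step_def)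
    with v qz show ?thesis
      by (intro exI[of _ c] exI[of _ v]) (auto simp: R_def joins_commute intro: converse_rtrancl_into_rtrancl)
  qed
  obtain c1 v1 where c1: "joins G c1 v1 a" "vd x v1 = vd x a + w c1" "v1 = q \<and> c1 = e1 \<or> v1 \<in> R z1" "(q, v1) \<in> step\<^sup>*"
    using into[of z1 e1] a z1 by blast
  obtain c2 v2 where c2: "joins G c2 v2 a" "vd x v2 = vd x a + w c2" "v2 = q \<and> c2 = e2 \<or> v2 \<in> R z2" "(q, v2) \<in> step\<^sup>*"
    using into[of z2 e2] a z2 by blast
  have qR: "q \<notin> R z1" "q \<notin> R z2"
    using desc[of z1 q] desc[of z2 q] zv stepD[OF qstep(1)] stepD[OF qstep(2)] by (auto simp: R_def)
  have aq: "(q, a) \<in> step\<^sup>*" using a(1) qstep by (auto simp: R_def intro: converse_rtrancl_into_rtrancl)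
  have av: "a \<in> verts G" "vd q a = vd x q - vd x a" using desc[OF aq q] by auto
  have pos: "0 < w c1" "0 < w c2"
    using length_pos[OF joins_arc[OF c1(1)]] length_pos[OF joins_arc[OF c2(1)]] by auto
  \<comment> \<open>A common last arc would start at a common descendant above \<open>a\<close>, or
    at \<open>q\<close>, where the arcs \<open>e1\<close> and \<open>e2\<close> differ.\<close>
  have "c1 \<noteq> c2"
  proof
    assume eq: "c1 = c2"
    have "v1 \<noteq> a" using c1(2) pos by auto
    then have v: "v1 = v2" using c1(1) c2(1) eq by (auto simp: joins_def)
    show False
    proof (cases "v1 = q")
      case True
      then show False using c1(3) c2(3) qR ne eq v by auto
    next
      case False
      then have "v1 \<in> R z1 \<inter> R z2" using c1(3) c2(3) v by auto
      from a(2)[OF this] show False using c1(2) pos by simp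
    qed
  qed
  moreover have "tops q c1 a" "tops q c2 a"
    using desc[OF c1(4) q] desc[OF c2(4) q] av c1(1,2) c2(1,2) by (auto simp: tops_def)
  moreover have "a \<noteq> q" using a(1) qR by auto
  \<comment> \<open>The leaf \<open>x\<close> has only one arc, so two different arcs cannot arrive
    there.\<close>
  moreover have "a \<noteq> x"
  proof
    assume "a = x"
    obtain e u where "pendant G e u x" using ex_pendant[OF x] by blast
    then have "c1 = e" "c2 = e" using c1(1) c2(1) \<open>a = x\<close> by (auto simp: joins_def pendant_def)
    with \<open>c1 \<noteq> c2\<close> show False by simp
  qed
  ultimately show thesis using that av by simp
qed

text \<open>The meeting vertex \<open>a\<close> is topped by two arcs but has only one tree arc, so
  one of the two is omitted. Its \<open>height2\<close> is \<open>2 * vd q a\<close>, and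
  \<open>a\<close> lies between \<open>x\<close> and \<open>q\<close> at distance at least
  \<open>\<mu>\<close> from \<open>x\<close>: this single arc loses \<open>2 * \<mu>\<close>. An arc
  that is not tight for \<open>q\<close> is omitted and differs from it, so in the case of equality
  it reaches full height.\<close>

lemma far_vertex:
  assumes x: "x \<in> verts G" "vdegree G x = 1" and ne: "e1 \<noteq> e2"
    and top: "tops x e1 q" "tops x e2 q"
    and mu: "\<And>v. v \<in> verts G \<Longrightarrow> v \<noteq> x \<Longrightarrow> v \<noteq> q \<Longrightarrow> \<mu> \<le> vd x v"
    and D: "diam G w \<le> D"
  shows "total_length G w + moment q \<le> 2 * k * D - 2 * \<mu>"
    "total_length G w + moment q = 2 * k * D - 2 * \<mu> \<Longrightarrow> e \<in> arcs G \<Longrightarrow> \<nexists>a. tops q e a \<Longrightarrow>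
      height2 q e = 2 * D"
proof -
  have q: "q \<in> verts G" using tops_arc[OF top(1)] by simp
  obtain a c1 c2 where a: "a \<noteq> x" "a \<noteq> q" "c1 \<noteq> c2" "tops q c1 a" "tops q c2 a" "vd x a + vd q a = vd x q"
    by (rule geodesics_meet[OF x ne top])
  then have av: "a \<in> verts G" using tops_arc by blast
  obtain N where "cotree q N" using ex_cotree[OF q] by blast
  note N = cotreeD[OF this]
  obtain c where c: "c \<in> N" "tops q c a"
    using N(6)[OF av a(2)] a(3-5) tops_arc by (metis Diff_iff)
  have hD: "height2 q e \<le> 2 * D" if "e \<in> N" for e
    using height2_le_diam[OF q, of e] that N(1) D by force
  have "vd x q \<le> D" using vd_le_diam[OF x(1) q] D by simp
  then have hc: "height2 q c \<le> 2 * D - 2 * \<mu>"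
    using tops_height2[OF c(2)] a(6) mu[OF av a(1,2)] by simp
  have split: "(\<Sum>e\<in>N. height2 q e) = height2 q c + (\<Sum>e\<in>N - {c}. height2 q e)"
    using sum.remove[OF N(2) c(1)] .
  have card: "real (card (N - {c})) = k - 1"
    using N(2,3) c(1) card_gt_0_iff[of N] by (auto simp: card_Diff_singleton)
  have "(\<Sum>e\<in>N - {c}. height2 q e) \<le> real (card (N - {c})) * (2 * D)"
    by (rule sum_bounded_above) (use hD in auto)
  then have le: "(\<Sum>e\<in>N - {c}. height2 q e) \<le> 2 * k * D - 2 * D"
    unfolding card by (simp add: algebra_simps)
  with hc show "total_length G w + moment q \<le> 2 * k * D - 2 * \<mu>"
    unfolding N(4) split by simp
  assume eq: "total_length G w + moment q = 2 * k * D - 2 * \<mu>" and e: "e \<in> arcs G" "\<nexists>a. tops q e a"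
  have "e \<in> N" "e \<noteq> c" using N(5)[OF e(1)] e c by auto
  moreover have "real (card (N - {c})) * (2 * D) \<le> (\<Sum>e\<in>N - {c}. height2 q e)"
    unfolding card using eq hc unfolding N(4) split by (simp add: algebra_simps)
  ultimately show "height2 q e = 2 * D"
    using sum_eq_const_bound[of "N - {c}" "height2 q" "2 * D" e] N(2) hD by simp
qed

text \<open>
  \<open>g\<close> is the distance from the highest point, seen from \<open>x\<close>, of the arc \<open>e\<close>, which may lie in the
  interior of \<open>e\<close>.
\<close>

lemma far_point:
  assumes inf: "infinite (UNIV :: 'v set)" "infinite (UNIV :: 'e set)"
    and x: "x \<in> verts G" "vdegree G x = 1"
    and mu: "\<And>v. v \<in> verts G \<Longrightarrow> v \<noteq> x \<Longrightarrow> \<mu> \<le> vd x v"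
    and D: "diam G w \<le> D" and N: "cotree x N" and e: "e \<in> N"
  shows "\<exists>g. (\<forall>v\<in>verts G. height2 x e / 2 \<le> vd x v + g v) \<and> g x = height2 x e / 2 \<and>
    total_length G w + (\<Sum>v\<in>verts G. weight v * g v) \<le> 2 * k * D - 2 * \<mu> \<and>
    (total_length G w + (\<Sum>v\<in>verts G. weight v * g v) = 2 * k * D - 2 * \<mu> \<longrightarrow>
      (\<forall>a\<in>arcs G. a \<noteq> e \<longrightarrow> \<bar>g (tail G a) - g (head G a)\<bar> \<noteq> w a \<longrightarrow>
        g (tail G a) + g (head G a) + w a = 2 * D)) \<and>
    ((\<exists>q. tops x e q \<and> (\<forall>v\<in>verts G. g v = vd q v)) \<or> (\<nexists>q. tops x e q) \<and> (\<forall>v\<in>verts G. 0 < g v))"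
proof (cases "\<exists>q. tops x e q")
  case True
  then obtain q where q: "tops x e q" by blast
  then have qv: "q \<in> verts G" and ea: "e \<in> arcs G" using tops_arc by auto
  have "q \<noteq> x" using q x(1) length_pos[OF ea] vd_nonneg joins_verts by (fastforce simp: tops_def)
  \<comment> \<open>Besides the omitted arc \<open>e\<close> also the tree arc of \<open>q\<close>
    ends in \<open>q\<close>; these are the two arcs that \<open>far_vertex\<close>
    requires.\<close>
  then obtain e' where e': "e' \<in> arcs G - N" "tops x e' q" using cotreeD(6)[OF N qv] by blast
  have ne: "e \<noteq> e'" using e e' by auto
  have mu': "\<mu> \<le> vd x v" if "v \<in> verts G" "v \<noteq> x" "v \<noteq> q" for v using mu that by simp
  note fv = far_vertex[OF x ne q e'(2) mu' D]
  have h: "height2 x e / 2 = vd x q" using tops_height2[OF q] by simp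
  show ?thesis
  proof (intro exI[of _ "vd q"] conjI ballI impI)
    show "height2 x e / 2 \<le> vd x v + vd q v" if "v \<in> verts G" for v
      using vd_triangle[OF x(1) that qv] vd_commute[of v q] h by simp
    show "vd q x = height2 x e / 2" using h vd_commute by simp
    show "total_length G w + (\<Sum>v\<in>verts G. weight v * vd q v) \<le> 2 * k * D - 2 * \<mu>"
      using fv(1) by (simp add: moment_def)
    show "vd q (tail G a) + vd q (head G a) + w a = 2 * D"
      if "total_length G w + (\<Sum>v\<in>verts G. weight v * vd q v) = 2 * k * D - 2 * \<mu>" "a \<in> arcs G"
        "\<bar>vd q (tail G a) - vd q (head G a)\<bar> \<noteq> w a" for a
      using fv(2)[of a] that tops_iff[OF qv that(2)] by (simp add: moment_def height2_def)
  qed (use q in blast)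
next
  case False
  have ea: "e \<in> arcs G" using e cotreeD(1)[OF N] by blast
  define t where "t = (vd x (head G e) - vd x (tail G e) + w e) / 2"
  note top = top_point[OF x(1) ea, folded t_def]
  \<comment> \<open>Otherwise the highest point would be an end of \<open>e\<close>. After
    subdividing there, both pieces of \<open>e\<close> end in the highest point.\<close>
  have t: "0 < t" "t < w e"
    using False tops_iff[OF x(1) ea] dist_arc_abs[OF joins_ends[OF ea] x(1)] by (auto simp: t_def abs_if split: if_splits)
  obtain v' e' where "splits_at e t v' e'" using ex_splits_at[OF ea t inf] by blast
  note K = splits_atD[OF this]
  let ?K = "split_arc G e v' e'" and ?k = "split_length w e t e'"
  interpret K: metric_graph ?K ?k by fact
  have vK: "verts ?K = insert v' (verts G)" and aK: "arcs ?K = insert e' (arcs G)"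
    by (simp_all add: split_arc_def)
  have ne: "e \<noteq> e'" using ea K(2) by auto
  have dK: "K.vd x v' = height2 x e / 2"
    using K(5)[OF x(1)] by (simp add: K.vd_commute) (simp add: t_def height2_def min_def field_simps)
  have top1: "K.tops x e v'"
    unfolding K.tops_def using dK K(6)[OF x(1), of "tail G e"] ne ea
    by (intro exI[of _ "tail G e"]) (auto simp: joins_def aK split_arc_def split_length_def t_def height2_def field_simps)
  have top2: "K.tops x e' v'"
    unfolding K.tops_def using dK K(6)[OF x(1), of "head G e"] ne ea
    by (intro exI[of _ "head G e"]) (auto simp: joins_def aK split_arc_def split_length_def t_def height2_def field_simps)
  have xK: "x \<in> verts ?K" "vdegree ?K x = 1" using x K(7) vK by auto
  have muK: "\<mu> \<le> K.vd x v" if "v \<in> verts ?K" "v \<noteq> x" "v \<noteq> v'" for v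
    using that mu K(6)[OF x(1)] by (simp add: vK)
  note len = K(10)
  have DK: "diam ?K ?k \<le> D" using isometric_diam[OF K(4)] D by simp
  note fv = K.far_vertex[OF xK ne top1 top2 muK DK]
  have mom: "K.moment v' = (\<Sum>v\<in>verts G. weight v * K.vd v' v)"
    using split_arc_moment[OF metric_graph_axioms K(3,1,8,7)] .
  have v'K: "v' \<in> verts ?K" by (simp add: vK)
  show ?thesis
  proof (intro exI[of _ "K.vd v'"] conjI ballI impI)
    show "height2 x e / 2 \<le> vd x v + K.vd v' v" if "v \<in> verts G" for v
      using K.vd_triangle[of x v v'] K(6)[OF x(1) that] that dK x(1) K.vd_commute[of v v'] by (simp add: vK)
    show "K.vd v' x = height2 x e / 2" using dK K.vd_commute by simp
    show "total_length G w + (\<Sum>v\<in>verts G. weight v * K.vd v' v) \<le> 2 * k * D - 2 * \<mu>"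
      using fv(1) mom len K(9) by simp
    show "K.vd v' (tail G a) + K.vd v' (head G a) + w a = 2 * D"
      if "total_length G w + (\<Sum>v\<in>verts G. weight v * K.vd v' v) = 2 * k * D - 2 * \<mu>" "a \<in> arcs G" "a \<noteq> e"
        "\<bar>K.vd v' (tail G a) - K.vd v' (head G a)\<bar> \<noteq> w a" for a
    proof -
      have "a \<noteq> e'" using that K(2) by auto
      then have a: "tail ?K a = tail G a" "head ?K a = head G a" "?k a = w a" "a \<in> arcs ?K"
        using that by (auto simp: split_arc_def split_length_def)
      have "\<nexists>b. K.tops v' a b" using that(4) K.tops_iff[OF v'K a(4)] a by simp
      with fv(2)[of a] that(1) a mom len K(9) show ?thesis by (simp add: K.height2_def)
    qed
    have "0 < K.vd v' v" if "v \<in> verts G" for v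
      using K.vd_pos[of v' v] that K(1) by (auto simp: vK)
    with False show "(\<exists>q. tops x e q \<and> (\<forall>v\<in>verts G. K.vd v' v = vd q v)) \<or>
      (\<nexists>q. tops x e q) \<and> (\<forall>v\<in>verts G. 0 < K.vd v' v)" by blast
  qed
qed

text \<open>The midpoint of \<open>e\<close> has distance \<open>D / 2 + m v\<close> from a vertex
  \<open>v\<close>, where \<open>m v\<close> is the distance from \<open>v\<close> to the nearer end
  of \<open>e\<close>. Seen from there, the highest point of \<open>e'\<close> lies at distance
  \<open>D + (m (tail G e') + m (head G e')) / 2\<close>, so both terms vanish.\<close>

lemma two_arcs_half:
  assumes inf: "infinite (UNIV :: 'v set)" "infinite (UNIV :: 'e set)"
    and D: "diam G w \<le> D" and e: "e \<in> arcs G" "w e = D" and e': "e' \<in> arcs G" "w e' = D" "e' \<noteq> e"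
  shows "tail G e' \<in> {tail G e, head G e}" "head G e' \<in> {tail G e, head G e}"
proof -
  have D0: "0 < D" using length_pos e by blast
  obtain v' a' where "splits_at e (D / 2) v' a'" using ex_splits_at[of e "D / 2"] e D0 inf by auto
  note K = splits_atD[OF this]
  let ?K = "split_arc G e v' a'" and ?k = "split_length w e (D / 2) a'"
  interpret K: metric_graph ?K ?k by fact
  have v'K: "v' \<in> verts ?K" by (simp add: split_arc_def)
  have "e' \<noteq> a'" using e'(1) K(2) by auto
  then have a: "e' \<in> arcs ?K" "tail ?K e' = tail G e'" "head ?K e' = head G e'" "?k e' = D"
    using e' by (auto simp: split_arc_def split_length_def)
  define m where "m v = min (vd v (tail G e)) (vd v (head G e))" for v
  have Km: "K.vd v' v = D / 2 + m v" if "v \<in> verts G" for v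
    using K(5)[OF that] e(2) by (simp add: m_def min_def)
  have m0: "0 \<le> m v" "m v = 0 \<Longrightarrow> v \<in> {tail G e, head G e}" if "v \<in> verts G" for v
    using that vd_nonneg[of v "tail G e"] vd_nonneg[of v "head G e"] vd_pos[of v "tail G e"]
      vd_pos[of v "head G e"] e(1) by (auto simp: m_def min_def split: if_splits)
  have "K.height2 v' e' \<le> 2 * D"
    using K.height2_le_diam[OF v'K a(1)] isometric_diam[OF K(4)] D by simp
  then have "m (tail G e') + m (head G e') \<le> 0"
    using Km e'(1) by (simp add: K.height2_def a)
  then have "m (tail G e') = 0" "m (head G e') = 0"
    using m0(1)[of "tail G e'"] m0(1)[of "head G e'"] e'(1) by auto
  then show "tail G e' \<in> {tail G e, head G e}" "head G e' \<in> {tail G e, head G e}"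
    using m0(2) e'(1) by auto
qed

text \<open>\<open>two_arcs_half\<close> alone would allow \<open>e'\<close> to be a loop at one end
  of \<open>e\<close>; applying it in both directions makes the sets of ends equal.\<close>

lemma two_arcs:
  assumes inf: "infinite (UNIV :: 'v set)" "infinite (UNIV :: 'e set)"
    and D: "diam G w \<le> D" and e: "joins G e u v" "w e = D" and e': "e' \<in> arcs G" "w e' = D"
  shows "joins G e' u v"
proof (cases "e' = e")
  case False
  have "e \<in> arcs G" using e by (simp add: joins_def)
  note half = two_arcs_half[OF inf D this e(2) e' False] two_arcs_half[OF inf D e' this e(2) False[symmetric]]
  have "{tail G e', head G e'} = {tail G e, head G e}" using half by blast
  also have "{tail G e, head G e} = {u, v}" using e(1) unfolding joins_def by blast
  finally show ?thesis using e'(1) unfolding joins_def doubleton_eq_iff by blast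
next
  case True
  then show ?thesis using e(1) by simp
qed

text \<open>Being longer than \<open>vd u v\<close>, none of these arcs is tight for
  \<open>u\<close>, so all are omitted from the tree; as there are \<open>k\<close> of them, nothing
  else is omitted.\<close>

lemma parallel_arcs_moment:
  assumes u: "u \<in> verts G" and N: "N \<subseteq> arcs G" "real (card N) = k"
    and par: "\<And>e. e \<in> N \<Longrightarrow> joins G e u v \<and> w e = D" and less: "vd u v < D"
  shows "cotree u N" "total_length G w + moment u = k * (vd u v + D)"
proof -
  obtain N' where coN': "cotree u N'" using ex_cotree[OF u] by blast
  note N' = cotreeD[OF this]
  have "e \<in> N'" if e: "e \<in> N" for e
  proof (rule ccontr)
    assume "e \<notin> N'"
    moreover have ea: "e \<in> arcs G" using N e by auto
    ultimately obtain a where "tops u e a" using N'(5) by blast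
    then have "\<bar>vd u (tail G e) - vd u (head G e)\<bar> = D" using tops_iff[OF u ea] par[OF e] by auto
    moreover have "0 \<le> vd u v" using vd_nonneg u joins_verts par[OF e] by blast
    ultimately show False using par[OF e] less u by (auto simp: joins_def)
  qed
  then have "N \<subseteq> N'" by blast
  moreover have "card N = card N'" using N(2) N'(3) by simp
  ultimately have "N = N'" using card_subset_eq[OF N'(2)] by blast
  then show "cotree u N" using coN' by simp
  have "height2 u e = vd u v + D" if "e \<in> N" for e
    using par[OF that] u by (auto simp: height2_def joins_def)
  then have "(\<Sum>e\<in>N. height2 u e) = k * (vd u v + D)" using N(2) by simp
  then show "total_length G w + moment u = k * (vd u v + D)" using N'(4) \<open>N = N'\<close> by simp
qed

lemma pendant_dist:
  assumes "pendant G e u x" "v \<in> verts G" "v \<noteq> x"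
  shows "vd v x = vd v u + w e" "vd x v = vd u v + w e"
proof -
  have j: "joins G e u x" "u \<noteq> x" "\<And>a. a \<in> arcs G \<Longrightarrow> tail G a = x \<or> head G a = x \<Longrightarrow> a = e"
    using assms(1) unfolding pendant_def by blast+
  from leaf_dist[OF j(1,3,2) assms(2,3)] show "vd v x = vd v u + w e" "vd x v = vd u v + w e" by simp_all
qed

lemma pendant_verts:
  assumes "pendant G e u x" shows "u \<in> verts G" "x \<in> verts G" "e \<in> arcs G" "u \<noteq> x" "0 < w e"
proof -
  have j: "joins G e u x" "u \<noteq> x" using assms by (simp_all add: pendant_def)
  show "u \<in> verts G" "x \<in> verts G" "e \<in> arcs G" "u \<noteq> x" "0 < w e"
    using joins_verts[OF j(1)] joins_arc[OF j(1)] length_pos[OF joins_arc[OF j(1)]] j(2) by simp_all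
qed

lemma pendant_dist_ge:
  assumes "pendant G e u x" "v \<in> verts G" "v \<noteq> x" shows "w e \<le> vd x v"
  using pendant_dist(2)[OF assms] vd_nonneg[OF pendant_verts(1)[OF assms(1)] assms(2)] by linarith

section \<open>The estimate for a single leaf and its case of equality\<close>

context
  fixes x :: 'v and p :: 'e and y :: 'v and D :: real
  assumes inf: "infinite (UNIV :: 'v set)" "infinite (UNIV :: 'e set)"
    and leaf: "pendant G p y x" "vdegree G x = 1"
    and branch: "\<And>v. v \<in> verts G \<Longrightarrow> v \<noteq> x \<Longrightarrow> 3 \<le> vdegree G v"
    and D: "diam G w \<le> D"
begin

lemma one_leaf_weight:
  "weight x = -1" "\<And>v. v \<in> verts G \<Longrightarrow> v \<noteq> x \<Longrightarrow> 1 \<le> weight v"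
  "(\<Sum>v\<in>verts G - {x}. weight v) = 2 * k - 1" "1 \<le> k"
proof -
  note pv = pendant_verts[OF leaf(1)]
  show x: "weight x = -1" using leaf(2) by (simp add: weight_def)
  show W: "1 \<le> weight v" if "v \<in> verts G" "v \<noteq> x" for v
    using branch[OF that] by (simp add: weight_def)
  show s: "(\<Sum>v\<in>verts G - {x}. weight v) = 2 * k - 1"
    using sum_weight sum.remove[OF finite_verts pv(2), of weight] x by simp
  have "weight y \<le> (\<Sum>v\<in>verts G - {x}. weight v)"
    by (rule member_le_sum) (use pv W in \<open>force+\<close>)
  then show "1 \<le> k" using s W[OF pv(1,4)] by simp
qed

text \<open>With \<open>E\<close> the height of the highest omitted arc and \<open>g\<close> the
  distance from its top, 1 and \<open>g2\<close> bound the two moments from above, and 5 bounds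
  their sum from below by the triangle inequality away from \<open>x\<close>. Together they give
  \<open>2 * total_length G w \<le> 2 * E + 2 * k * D - 2 * w p\<close>. In the case of equality all
  three are equations and \<open>E = D\<close>.\<close>

lemma one_leaf_estimate:
  assumes N: "cotree x N" and e: "e \<in> N"
    and max: "\<And>a. a \<in> N \<Longrightarrow> height2 x a \<le> height2 x e"
  shows "total_length G w \<le> (k + 1) * D - w p"
    and "total_length G w = (k + 1) * D - w p \<Longrightarrow> a \<in> N \<Longrightarrow> height2 x a = 2 * D"
    and "total_length G w = (k + 1) * D - w p \<Longrightarrow> \<exists>g.
      (\<forall>v\<in>verts G. vd x v + g v = D) \<and>
      (\<forall>a\<in>arcs G. a \<noteq> e \<longrightarrow> \<bar>g (tail G a) - g (head G a)\<bar> \<noteq> w a \<longrightarrow> g (tail G a) + g (head G a) + w a = 2 * D) \<and>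
      ((\<exists>q. tops x e q \<and> (\<forall>v\<in>verts G. g v = vd q v)) \<or> (\<nexists>q. tops x e q) \<and> (\<forall>v\<in>verts G. 0 < g v))"
proof -
  note pv = pendant_verts[OF leaf(1)]
  have mu: "w p \<le> vd x v" if "v \<in> verts G" "v \<noteq> x" for v using pendant_dist_ge[OF leaf(1) that] .
  define E where "E = height2 x e / 2"
  have E: "E \<le> D" using height2_le_diam[OF pv(2), of e] cotreeD(1)[OF N] e D by (auto simp: E_def)
  obtain g where g: "\<And>v. v \<in> verts G \<Longrightarrow> E \<le> vd x v + g v" "g x = E"
    and g2: "total_length G w + (\<Sum>v\<in>verts G. weight v * g v) \<le> 2 * k * D - 2 * w p"
    and g3: "\<And>a. total_length G w + (\<Sum>v\<in>verts G. weight v * g v) = 2 * k * D - 2 * w p \<Longrightarrow> a \<in> arcs G \<Longrightarrow>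
      a \<noteq> e \<Longrightarrow> \<bar>g (tail G a) - g (head G a)\<bar> \<noteq> w a \<Longrightarrow> g (tail G a) + g (head G a) + w a = 2 * D"
    and g4: "(\<exists>q. tops x e q \<and> (\<forall>v\<in>verts G. g v = vd q v)) \<or> (\<nexists>q. tops x e q) \<and> (\<forall>v\<in>verts G. 0 < g v)"
    using far_point[OF inf pv(2) leaf(2) mu D N e] unfolding E_def by blast
  let ?S = "verts G - {x}"
  have 1: "total_length G w + moment x \<le> k * (2 * E)"
    using sum_bounded_above[of N "height2 x" "2 * E"] max cotreeD(3,4)[OF N] by (simp add: E_def)
  have rem: "(\<Sum>v\<in>verts G. weight v * h v) = (\<Sum>v\<in>?S. weight v * h v) - h x" for h
    using sum.remove[OF finite_verts pv(2), of "\<lambda>v. weight v * h v"] one_leaf_weight(1) by simp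
  have "(\<Sum>v\<in>?S. weight v * E) \<le> (\<Sum>v\<in>?S. weight v * (vd x v + g v))"
  proof (intro sum_mono mult_left_mono)
    fix v assume "v \<in> ?S"
    then show "E \<le> vd x v + g v" "0 \<le> weight v" using g(1)[of v] one_leaf_weight(2)[of v] by auto
  qed
  then have 2: "(2 * k - 1) * E \<le> (\<Sum>v\<in>?S. weight v * vd x v) + (\<Sum>v\<in>?S. weight v * g v)"
    unfolding sum_distrib_right[symmetric] one_leaf_weight(3) by (simp add: distrib_left sum.distrib)
  have 3: "moment x = (\<Sum>v\<in>?S. weight v * vd x v)"
    using rem[of "vd x"] pv(2) by (simp add: moment_def)
  have 4: "(\<Sum>v\<in>verts G. weight v * g v) = (\<Sum>v\<in>?S. weight v * g v) - E"
    using rem[of g] g(2) by simp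
  have 5: "(2 * k - 2) * E \<le> moment x + (\<Sum>v\<in>verts G. weight v * g v)"
    using 2 3 4 by (simp add: algebra_simps)
  show "total_length G w \<le> (k + 1) * D - w p"
    using 1 5 g2 E by (simp add: algebra_simps)
  assume len: "total_length G w = (k + 1) * D - w p"
  have ED: "E = D" using 1 5 g2 E len by (simp add: algebra_simps)
  have tot: "total_length G w + moment x = 2 * k * D"
    "total_length G w + (\<Sum>v\<in>verts G. weight v * g v) = 2 * k * D - 2 * w p"
    "moment x + (\<Sum>v\<in>verts G. weight v * g v) = (2 * k - 2) * D"
    using 1 5 g2 len unfolding ED by (simp_all add: algebra_simps)
  show "height2 x a = 2 * D" if "a \<in> N" for a
    by (rule sum_eq_const_bound[OF cotreeD(2)[OF N] _ _ that])
      (use max tot cotreeD(3,4)[OF N] ED in \<open>auto simp: E_def algebra_simps\<close>)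
  have gD: "vd x v + g v = D" if v: "v \<in> verts G" for v
  proof (cases "v = x")
    case True
    then show ?thesis using g(2) ED pv(2) by simp
  next
    case False
    have "(\<Sum>v\<in>?S. weight v * (vd x v + g v - D))
        = (\<Sum>v\<in>?S. weight v * vd x v) + (\<Sum>v\<in>?S. weight v * g v) - (\<Sum>v\<in>?S. weight v) * D"
      by (simp add: algebra_simps sum.distrib sum_subtractf sum_distrib_left)
    also have "\<dots> \<le> 0" using tot(3) 3 4 ED unfolding one_leaf_weight(3) by (simp add: algebra_simps)
    finally have "weight v * (vd x v + g v - D) = 0"
      using one_leaf_weight(2) g(1) ED v False
      by (intro sum_le_0_imp_eq_0[of ?S "\<lambda>v. weight v * (vd x v + g v - D)"])
        (auto intro!: mult_nonneg_nonneg, force)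
    then show ?thesis using one_leaf_weight(2)[OF v False] by auto
  qed
  show "\<exists>g. (\<forall>v\<in>verts G. vd x v + g v = D) \<and>
      (\<forall>a\<in>arcs G. a \<noteq> e \<longrightarrow> \<bar>g (tail G a) - g (head G a)\<bar> \<noteq> w a \<longrightarrow> g (tail G a) + g (head G a) + w a = 2 * D) \<and>
      ((\<exists>q. tops x e q \<and> (\<forall>v\<in>verts G. g v = vd q v)) \<or> (\<nexists>q. tops x e q) \<and> (\<forall>v\<in>verts G. 0 < g v))"
    using gD g3[OF tot(2)] g4 by (intro exI[of _ g]) blast
qed

lemma ex_highest_cotree_arc:
  obtains N e where "cotree x N" "e \<in> N" "\<And>a. a \<in> N \<Longrightarrow> height2 x a \<le> height2 x e"
proof -
  obtain N where N: "cotree x N" using ex_cotree pendant_verts[OF leaf(1)] by blast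
  have "N \<noteq> {}" using cotreeD(3)[OF N] one_leaf_weight(4) by auto
  then have "Max (height2 x ` N) \<in> height2 x ` N" using cotreeD(2)[OF N] by (intro Max_in) auto
  then obtain e where "e \<in> N" "height2 x e = Max (height2 x ` N)" by auto
  then show thesis using that[OF N, of e] cotreeD(2)[OF N] by simp
qed

lemma one_leaf_length: "total_length G w \<le> (k + 1) * D - w p"
proof (rule ex_highest_cotree_arc)
  fix N e assume "cotree x N" "e \<in> N" "\<And>a. a \<in> N \<Longrightarrow> height2 x a \<le> height2 x e"
  then show ?thesis using one_leaf_estimate(1)[of N e] by blast
qed

text \<open>\<open>far_point\<close> says nothing about the height of the arc that carries the far
  point. Since \<open>k\<close> is at least two, each omitted arc can be compared with the top of
  another one.\<close>

lemma one_leaf_extremal: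
  assumes len: "total_length G w = (k + 1) * D - w p" and k2: "2 \<le> k"
  shows "\<exists>N u v. N \<subseteq> arcs G \<and> real (card N) = k \<and> (\<forall>a\<in>N. joins G a u v \<and> w a = D)
    \<and> D - 2 * w p \<le> vd u v"
proof (rule ex_highest_cotree_arc)
  fix N e0 assume N: "cotree x N" and e0: "e0 \<in> N" "\<And>a. a \<in> N \<Longrightarrow> height2 x a \<le> height2 x e0"
  note pv = pendant_verts[OF leaf(1)]
  note coN = cotreeD[OF N]
  have h: "height2 x a = 2 * D" if "a \<in> N" for a
    using one_leaf_estimate(2)[OF N e0 len that] .
  have ex_g: "\<exists>g. (\<forall>v\<in>verts G. vd x v + g v = D) \<and>
      (\<forall>a\<in>arcs G. a \<noteq> e \<longrightarrow> \<bar>g (tail G a) - g (head G a)\<bar> \<noteq> w a \<longrightarrow> g (tail G a) + g (head G a) + w a = 2 * D) \<and>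
      ((\<exists>q. tops x e q \<and> (\<forall>v\<in>verts G. g v = vd q v)) \<or> (\<nexists>q. tops x e q) \<and> (\<forall>v\<in>verts G. 0 < g v))"
    if "e \<in> N" for e
    by (rule one_leaf_estimate(3)[OF N that _ len]) (use h that in simp)
  have mom: "moment x = (k - 1) * D + w p"
    using coN(3,4) h len by (simp add: algebra_simps)
  \<comment> \<open>If one omitted arc had its top at a vertex \<open>q\<close>, all of them would
    end in \<open>q\<close>. Then \<open>q\<close> would have weight at least \<open>k - 1\<close>
    at distance \<open>D\<close>, and the remaining weights, at distance at least
    \<open>w p\<close>, would make the moment of \<open>x\<close> too large.\<close>
  have not_tight: "\<nexists>q. tops x e q" if e: "e \<in> N" for e
  proof
    assume "\<exists>q. tops x e q"
    with ex_g[OF e] obtain q g where g: "\<forall>v\<in>verts G. vd x v + g v = D" and q: "tops x e q"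
      "\<forall>v\<in>verts G. g v = vd q v" by blast
    have qv: "q \<in> verts G" using tops_arc[OF q(1)] by simp
    have qD: "vd x q = D" using tops_height2[OF q(1)] h[OF e] by simp
    have D0: "0 < D" using qD vd_pos[OF pv(2) qv] diam_pos D by linarith
    have qx: "q \<noteq> x" using qD D0 pv(2) by auto
    have top: "tops x a q" if a: "a \<in> N" for a
    proof -
      obtain g' where g': "\<forall>v\<in>verts G. vd x v + g' v = D"
        "(\<exists>q. tops x a q \<and> (\<forall>v\<in>verts G. g' v = vd q v)) \<or> (\<nexists>q. tops x a q) \<and> (\<forall>v\<in>verts G. 0 < g' v)"
        using ex_g[OF a] by blast
      have "g' q = 0" using g'(1) qv qD by fastforce
      then obtain q' where q': "tops x a q'" "\<forall>v\<in>verts G. g' v = vd q' v" using g'(2) qv by fastforce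
      then have "vd q' q = 0" using \<open>g' q = 0\<close> qv by simp
      then have "q' = q" using vd_pos[of q' q] tops_arc[OF q'(1)] qv by auto
      with q' show ?thesis by simp
    qed
    obtain e1 where e1: "e1 \<in> arcs G - N" "tops x e1 q" using coN(6)[OF qv qx] by blast
    have "card (insert e1 N) \<le> (\<Sum>e\<in>insert e1 N. of_bool (tail G e = q) + of_bool (head G e = q))"
      unfolding card_eq_sum by (rule sum_mono) (use top e1 in \<open>auto simp: tops_def joins_def\<close>)
    also have "\<dots> \<le> vdegree G q" by (rule sum_subset_le_degree) (use e1 coN(1) in auto)
    finally have Wq: "k - 1 \<le> weight q" using coN(2,3) e1 by (simp add: weight_def)
    let ?S = "verts G - {x}"
    have "(\<Sum>v\<in>?S. weight v * w p) + weight q * (D - w p)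
      = weight q * D + (\<Sum>v\<in>?S - {q}. weight v * w p)"
      using sum.remove[of ?S q "\<lambda>v. weight v * w p"] qv qx by (simp add: algebra_simps)
    also have "\<dots> \<le> weight q * vd x q + (\<Sum>v\<in>?S - {q}. weight v * vd x v)"
    proof (intro add_mono sum_mono mult_left_mono)
      fix v assume "v \<in> ?S - {q}"
      then show "w p \<le> vd x v" "0 \<le> weight v"
        using pendant_dist_ge[OF leaf(1), of v] one_leaf_weight(2)[of v] by auto
    qed (use qD one_leaf_weight(2)[OF qv qx] in auto)
    also have "\<dots> = (\<Sum>v\<in>?S. weight v * vd x v)"
      using sum.remove[of ?S q "\<lambda>v. weight v * vd x v"] qv qx by simp
    also have "\<dots> = moment x"
      using sum.remove[OF finite_verts pv(2), of "\<lambda>v. weight v * vd x v"] pv(2) by (simp add: moment_def)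
    finally have "(2 * k - 1) * w p + weight q * (D - w p) \<le> (k - 1) * D + w p"
      unfolding sum_distrib_right[symmetric] one_leaf_weight(3) mom .
    moreover have "(k - 1) * (D - w p) \<le> weight q * (D - w p)"
      using Wq pendant_dist_ge[OF leaf(1) qv qx] qD by (intro mult_right_mono) auto
    ultimately have "(k - 1) * w p \<le> 0" by (simp add: algebra_simps)
    then show False using k2 pv(5) by (simp add: mult_le_0_iff)
  qed
  \<comment> \<open>\<open>e\<close> is not tight for \<open>g = D - vd x\<close>, so it has height
    \<open>D\<close> from the far point of \<open>e'\<close> as well as from \<open>x\<close>. The
    two equations determine \<open>w e\<close> and the sum of the distances of its ends.\<close>
  have par: "w e = D \<and> vd x (tail G e) + vd x (head G e) = D" if e: "e \<in> N" for e
  proof -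
    have "N - {e} \<noteq> {}"
    proof
      assume "N - {e} = {}"
      then have "card N \<le> 1" using card_mono[of "{e}" N] by auto
      then show False using coN(3) k2 by linarith
    qed
    then obtain e' where e': "e' \<in> N" "e \<noteq> e'" by blast
    obtain g where g: "\<forall>v\<in>verts G. vd x v + g v = D" "\<forall>a\<in>arcs G. a \<noteq> e' \<longrightarrow>
        \<bar>g (tail G a) - g (head G a)\<bar> \<noteq> w a \<longrightarrow> g (tail G a) + g (head G a) + w a = 2 * D"
      using ex_g[OF e'(1)] by blast
    have ea: "e \<in> arcs G" using e coN(1) by blast
    have gt: "g (tail G e) = D - vd x (tail G e)" "g (head G e) = D - vd x (head G e)"
    proof -
      have "vd x (tail G e) + g (tail G e) = D" "vd x (head G e) + g (head G e) = D"
        using bspec[OF g(1) tail_in_verts[OF ea]] bspec[OF g(1) head_in_verts[OF ea]] by auto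
      then show "g (tail G e) = D - vd x (tail G e)" "g (head G e) = D - vd x (head G e)" by linarith+
    qed
    have "\<bar>g (tail G e) - g (head G e)\<bar> \<noteq> w e"
      using not_tight[OF e] tops_iff[OF pv(2) ea] unfolding gt by (simp add: abs_minus_commute)
    then have "g (tail G e) + g (head G e) + w e = 2 * D" using bspec[OF g(2) ea] e'(2) by simp
    with h[OF e] show ?thesis unfolding gt height2_def by simp
  qed
  have e0a: "e0 \<in> arcs G" using e0 coN(1) by blast
  define u v where "u = tail G e0" and "v = head G e0"
  have uv: "joins G e0 u v" "u \<in> verts G" "v \<in> verts G"
    using e0a joins_ends by (auto simp: u_def v_def)
  have joins: "joins G a u v \<and> w a = D" if "a \<in> N" for a
    using two_arcs[OF inf D uv(1), of a] par[OF e0(1)] par[OF that] coN(1) that by blast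
  have fuv: "vd x u + vd x v = D" using par[OF e0(1)] by (simp add: u_def v_def)
  \<comment> \<open>An end at distance \<open>D\<close> would force the other end to be
    \<open>x\<close>, and then \<open>e0\<close> would be the pendant arc, which is tight.\<close>
  have nD: "vd x a \<noteq> D" if "a \<in> {u, v}" for a
  proof
    assume a: "vd x a = D"
    then have "vd x u = 0 \<or> vd x v = 0" using fuv that by force
    then have x: "x \<in> {u, v}" using vd_pos[OF pv(2) uv(2)] vd_pos[OF pv(2) uv(3)] by force
    then have "e0 = p" using leaf(1) uv(1) by (auto simp: pendant_def joins_def)
    moreover have "joins G p x y" using leaf(1) joins_commute[of G p x y] by (simp add: pendant_def)
    moreover have "vd x y = vd x x + w p" using pendant_dist(2)[OF leaf(1) pv(1,4)] pv by simp
    ultimately have "tops x e0 y" unfolding tops_def by blast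
    then show False using not_tight[OF e0(1)] by blast
  qed
  have ux: "u \<noteq> x" "v \<noteq> x" using nD[of u] nD[of v] fuv pv(2) by auto
  have D': "vd x u = vd y u + w p" "vd x v = vd y v + w p"
    using pendant_dist(2)[OF leaf(1)] uv ux by auto
  have less: "vd u v < D"
    using D' fuv vd_triangle[OF uv(2) pv(1) uv(3)] vd_commute[of u y] pv(5) by linarith
  have "total_length G w + moment u = k * (vd u v + D)"
    by (rule parallel_arcs_moment(2)[OF uv(2) coN(1,3) joins less])
  moreover have "total_length G w + moment v = k * (vd v u + D)"
  proof (rule parallel_arcs_moment(2)[OF uv(3) coN(1,3)])
    show "joins G e v u \<and> w e = D" if "e \<in> N" for e
      using joins[OF that] joins_commute[of G e u v] by simp
    show "vd v u < D" using less vd_commute by simp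
  qed
  ultimately have "moment u + moment v = 2 * k * vd u v - 2 * D + 2 * w p"
    using len vd_commute[of v u] by (simp add: algebra_simps)
  \<comment> \<open>The weights away from \<open>x\<close> sum to \<open>2 * k - 1\<close>, and the
    distances of any vertex to \<open>u\<close> and \<open>v\<close> add up to at least
    \<open>vd u v\<close>. The leaf itself contributes exactly \<open>- D\<close>.\<close>
  moreover have "(2 * k - 1) * vd u v - D \<le> moment u + moment v"
  proof -
    have "(\<Sum>a\<in>verts G - {x}. weight a * vd u v) \<le> (\<Sum>a\<in>verts G - {x}. weight a * (vd u a + vd v a))"
    proof (intro sum_mono mult_left_mono)
      fix a assume "a \<in> verts G - {x}"
      then show "vd u v \<le> vd u a + vd v a" "0 \<le> weight a"
        using vd_triangle[OF uv(2) _ uv(3), of a] vd_commute[of a v] one_leaf_weight(2)[of a] by auto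
    qed
    also have "\<dots> = moment u + moment v + (vd u x + vd v x)"
      using sum.remove[OF finite_verts pv(2), of "\<lambda>a. weight a * (vd u a + vd v a)"] one_leaf_weight(1)
      by (simp add: moment_def distrib_left sum.distrib)
    finally show ?thesis
      unfolding sum_distrib_right[symmetric] one_leaf_weight(3)
      using fuv vd_commute[of u x] vd_commute[of v x] by simp
  qed
  ultimately have "D - 2 * w p \<le> vd u v" by (simp add: algebra_simps)
  with coN(1,3) joins show ?thesis by blast
qed

end

end

section \<open>The length bound for graphs with leaves\<close>

context metric_graph
begin

text \<open>Degree two is excluded, and if the foot were a leaf too, the pendant arc would be the
  whole graph by connectedness.\<close>

lemma leaf_neighbor:
  assumes red: "reduced G" and p: "pendant G p y x" and more: "arcs G \<noteq> {p}"
  shows "3 \<le> vdegree G y"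
proof (rule ccontr)
  assume "\<not> 3 \<le> vdegree G y"
  moreover note pv = pendant_verts[OF p]
  ultimately have "vdegree G y = 1"
    using degree_pos[OF pv(1)] red pv(1) unfolding reduced_def by force
  then obtain e u where e: "pendant G e u y" using ex_pendant[OF pv(1)] by blast
  have "p = e" using p e unfolding pendant_def joins_def by blast
  have inc: "a = p" if "a \<in> arcs G" "tail G a \<in> {x, y} \<or> head G a \<in> {x, y}" for a
    using that p e \<open>p = e\<close> unfolding pendant_def by blast
  have "{x, y} = verts G"
  proof (rule closed_set_eq_verts)
    fix a assume a: "a \<in> arcs G"
    show "tail G a \<in> {x, y} \<longleftrightarrow> head G a \<in> {x, y}"
      using inc[OF a] p unfolding pendant_def joins_def by blast
  qed (use pv in auto)
  then have "arcs G = {p}" using inc pv(3) tail_in_verts by blast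
  with more show False by simp
qed

lemma single_arc:
  assumes p: "pendant G p y x" and one: "arcs G = {p}"
  shows "verts G = {x, y}" "cyc G = 0" "total_length G w = w p" "vd x y = w p"
proof -
  note pv = pendant_verts[OF p]
  have "v \<in> {x, y}" if v: "v \<in> verts G" for v
  proof -
    obtain e u where e: "joins G e u v" using incident_arc[OF v] .
    then have "e = p" using one unfolding joins_def by blast
    then show ?thesis using e p unfolding pendant_def joins_def by blast
  qed
  then show V: "verts G = {x, y}" using pv by blast
  show "cyc G = 0" using V one pv(4) by (simp add: cyc_def)
  show "total_length G w = w p" by (simp add: total_length_def one)
  show "vd x y = w p" using pendant_dist(2)[OF p pv(1,4)] pv(1) by simp
qed

text \<open>
  Deleting the leaf \<open>x2\<close> may leave its neighbour \<open>y2\<close> with degree two. Then its two other arcs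
  \<open>e1\<close> and \<open>e2\<close> become one arc, called \<open>e1\<close> again.
\<close>

definition leaf_reduction ::
  "'v \<Rightarrow> 'e \<Rightarrow> 'v \<Rightarrow> 'v \<Rightarrow> 'e \<Rightarrow> 'e \<Rightarrow> 'v \<Rightarrow> 'v \<Rightarrow> ('v, 'e) pre_digraph \<Rightarrow> ('e \<Rightarrow> real) \<Rightarrow> bool" where
  "leaf_reduction x2 p2 y2 x1 e1 e2 q1 q2 J j \<longleftrightarrow>
     metric_graph J j \<and> diam J j \<le> diam G w \<and> cyc J = cyc G \<and>
     total_length J j = total_length G w - w p2 \<and>
     verts J \<subseteq> verts G - {x2} \<and> x1 \<in> verts J \<and> vdegree J x1 = 1 \<and>
     (\<forall>v\<in>verts J. v \<noteq> x1 \<longrightarrow> 3 \<le> vdegree J v) \<and>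
     (\<forall>u\<in>verts J. \<forall>v\<in>verts J. graph_dist J j (Vertex u) (Vertex v) = vd u v) \<and>
     (\<forall>e\<in>arcs J. e \<in> arcs G \<and> joins G e (tail J e) (head J e) \<and> j e = w e \<or>
        e = e1 \<and> e1 \<noteq> e2 \<and> tail J e = q1 \<and> head J e = q2 \<and> joins G e1 q1 y2 \<and> joins G e2 y2 q2 \<and>
        j e = w e1 + w e2 \<and> y2 \<notin> verts J \<and>
        (\<forall>a\<in>arcs G. tail G a = y2 \<or> head G a = y2 \<longrightarrow> a \<in> {p2, e1, e2}))"

lemma ex_leaf_reduction:
  assumes red: "reduced G" and more: "arcs G \<noteq> {p2}" and p2: "pendant G p2 y2 x2"
    and x: "x1 \<in> verts G" "x1 \<noteq> x2" "vdegree G x1 = 1"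
    and leaves: "\<And>v. v \<in> verts G \<Longrightarrow> vdegree G v = 1 \<Longrightarrow> v = x1 \<or> v = x2"
  shows "\<exists>e1 e2 q1 q2 J j. leaf_reduction x2 p2 y2 x1 e1 e2 q1 q2 J j"
proof -
  note pv = pendant_verts[OF p2]
  have p2': "joins G p2 y2 x2" "y2 \<noteq> x2" "\<And>a. a \<in> arcs G \<Longrightarrow> tail G a = x2 \<or> head G a = x2 \<Longrightarrow> a = p2"
    using p2 unfolding pendant_def by blast+
  note del = delete_leaf_metric_graph[OF metric_graph_axioms p2' more]
    delete_leaf_dist[OF metric_graph_axioms p2' more] delete_leaf_diam[OF metric_graph_axioms p2' more]
    delete_leaf_total_length[OF metric_graph_axioms p2' more] delete_leaf_cyc[OF metric_graph_axioms p2' more]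
    delete_leaf_degree[OF metric_graph_axioms p2' more]
  let ?K = "delete_leaf G x2 p2"
  interpret K: metric_graph ?K w by (rule del(1))
  have deg3: "3 \<le> vdegree G v" if "v \<in> verts G" "v \<noteq> x1" "v \<noteq> x2" for v
  proof -
    have "vdegree G v \<noteq> 1" using leaves[OF that(1)] that(2,3) by blast
    moreover have "vdegree G v \<noteq> 2" using red that(1) by (simp add: reduced_def)
    ultimately show ?thesis using degree_pos[OF that(1)] by simp
  qed
  have y3: "3 \<le> vdegree G y2" using leaf_neighbor[OF red p2 more] .
  then have yx1: "y2 \<noteq> x1" using x(3) by auto
  show ?thesis
  proof (cases "vdegree G y2 = 3")
    case False
    \<comment> \<open>Nothing has to be merged; with \<open>e1 = e2 = p2\<close> the alternative for
      a merged arc is void.\<close>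
    have "leaf_reduction x2 p2 y2 x1 p2 p2 y2 y2 ?K w"
      unfolding leaf_reduction_def
    proof (intro conjI ballI impI)
      show "3 \<le> vdegree ?K v" if v: "v \<in> verts ?K" "v \<noteq> x1" for v
        using deg3[of v] v del(6)[of v] y3 False by auto
      show "vdegree ?K x1 = 1" using del(6)[of x1] x yx1 by simp
      show "e \<in> arcs G \<and> joins G e (tail ?K e) (head ?K e) \<and> w e = w e \<or> P" if "e \<in> arcs ?K" for e P
        using that by (simp add: joins_def)
    qed (use del(1-5) x in auto)
    then show ?thesis by blast
  next
    case True
    then have yK: "vdegree ?K y2 = 2" using del(6)[of y2] p2'(2) by simp
    have y2K: "y2 \<in> verts ?K" using pv by simp
    obtain e1 q1 where e1: "joins ?K e1 q1 y2" using K.incident_arc[OF y2K] .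
    \<comment> \<open>If \<open>e1\<close> were the only arc at \<open>y2\<close>, degree two would
      make it a loop, which separates \<open>y2\<close> from \<open>x1\<close>.\<close>
    have "\<exists>e2\<in>arcs ?K. e2 \<noteq> e1 \<and> (tail G e2 = y2 \<or> head G e2 = y2)"
    proof (rule ccontr)
      assume no: "\<not> ?thesis"
      show False
      proof (cases "q1 = y2")
        case True
        have V: "{y2} = verts ?K"
        proof (rule K.closed_set_eq_verts)
          fix a assume a: "a \<in> arcs ?K"
          show "tail ?K a \<in> {y2} \<longleftrightarrow> head ?K a \<in> {y2}"
          proof (cases "a = e1")
            case True
            then show ?thesis using e1 \<open>q1 = y2\<close> by (simp add: joins_def)
          next
            case False
            then show ?thesis using no a by auto
          qed
        qed (use y2K in auto)
        have "x1 \<in> {y2}" unfolding V using x by simp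
        then show False using yx1 by simp
      next
        case False
        have "vdegree ?K y2 = (\<Sum>e\<in>arcs ?K. if e = e1 then 1 else 0)"
          unfolding degree_eq_sum[OF K.finite_arcs]
        proof (rule sum.cong[OF refl])
          fix e assume e: "e \<in> arcs ?K"
          show "of_bool (tail ?K e = y2) + of_bool (head ?K e = y2) = (if e = e1 then 1 else 0 :: nat)"
          proof (cases "e = e1")
            case True
            then show ?thesis using e1 False by (auto simp: joins_def)
          next
            case False
            then have "\<not> (tail G e = y2 \<or> head G e = y2)" using no e by blast
            with False show ?thesis by simp
          qed
        qed
        with yK show False by (simp split: if_splits)
      qed
    qed
    then obtain e2 where e2: "e2 \<in> arcs ?K" "e1 \<noteq> e2" "tail G e2 = y2 \<or> head G e2 = y2" by blast
    then obtain q2 where q2: "joins ?K e2 y2 q2" by (auto simp: joins_def)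
    let ?J = "merge_arcs ?K y2 e1 e2 q1 q2" and ?j = "w(e1 := w e1 + w e2)"
    have J: "metric_graph ?J ?j" using merge_arcs_metric_graph[OF del(1) e1 q2 e2(2) yK] .
    interpret J: metric_graph ?J ?j by (rule J)
    obtain f where f: "isometry_map ?K w ?J ?j f" "\<forall>u\<in>verts ?K - {y2}. f (Vertex u) = Vertex u"
      using merge_arcs_isometry[OF del(1) e1 q2 e2(2) yK] by blast
    note d2 = degree_two_arcs[OF del(1) e1 q2 e2(2) yK]
    have vJ: "verts ?J = verts G - {x2, y2}" by (auto simp: merge_arcs_def)
    have degJ: "vdegree ?J v = vdegree G v" if "v \<in> verts ?J" for v
      using isometry_degree(2)[OF del(1) J f(1), of v v] f(2) that del(6)[of v] vJ by simp
    have "leaf_reduction x2 p2 y2 x1 e1 e2 q1 q2 ?J ?j"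
      unfolding leaf_reduction_def
    proof (intro conjI ballI impI)
      show "diam ?J ?j \<le> diam G w"
        using isometric_diam[of ?K w ?J ?j] f(1) isometric_iff del(3) by metis
      have "card (arcs ?K) > 0" "card (verts ?K) > 0"
        unfolding card_gt_0_iff using e2(1) y2K K.finite_arcs K.finite_verts by blast+
      then have "cyc ?J = cyc ?K"
        using e2(1) y2K unfolding cyc_def by (simp add: merge_arcs_def card_Diff_singleton)
      then show "cyc ?J = cyc G" using del(5) by simp
      have "total_length ?J ?j = (\<Sum>e\<in>arcs ?K - {e2}. if e = e1 then w e + w e2 else w e)"
        unfolding total_length_def by (rule sum.cong) (auto simp: merge_arcs_def)
      also have "\<dots> = (\<Sum>e\<in>arcs ?K - {e2}. w e + (if e = e1 then w e2 else 0))"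
        by (rule sum.cong) auto
      also have "\<dots> = (\<Sum>e\<in>arcs ?K - {e2}. w e) + w e2"
      proof -
        have "e1 \<in> arcs ?K - {e2}" using e1 e2(2) joins_arc[OF e1] by simp
        then show ?thesis using K.finite_arcs unfolding sum.distrib by simp
      qed
      also have "\<dots> = total_length ?K w"
        unfolding total_length_def using sum.remove[OF K.finite_arcs e2(1), of w] by simp
      finally show "total_length ?J ?j = total_length G w - w p2" using del(4) by simp
      show "verts ?J \<subseteq> verts G - {x2}" "x1 \<in> verts ?J" using vJ x yx1 by auto
      show "vdegree ?J x1 = 1" using degJ x vJ yx1 by simp
      show "3 \<le> vdegree ?J v" if "v \<in> verts ?J" "v \<noteq> x1" for v
        using deg3[of v] degJ[OF that(1)] that vJ by simp
      show "J.vd u v = vd u v" if uv: "u \<in> verts ?J" "v \<in> verts ?J" for u v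
      proof -
        have "u \<in> verts ?K - {y2}" "v \<in> verts ?K - {y2}" using uv vJ by auto
        then have "J.vd u v = K.vd u v"
          using f unfolding isometry_map_def by (metis DiffD1 K.Vertex_in_points)
        also have "\<dots> = vd u v" using del(2)[of u v] uv vJ by simp
        finally show ?thesis .
      qed
      fix e assume e: "e \<in> arcs ?J"
      show "e \<in> arcs G \<and> joins G e (tail ?J e) (head ?J e) \<and> ?j e = w e \<or>
        e = e1 \<and> e1 \<noteq> e2 \<and> tail ?J e = q1 \<and> head ?J e = q2 \<and> joins G e1 q1 y2 \<and> joins G e2 y2 q2 \<and>
        ?j e = w e1 + w e2 \<and> y2 \<notin> verts ?J \<and>
        (\<forall>a\<in>arcs G. tail G a = y2 \<or> head G a = y2 \<longrightarrow> a \<in> {p2, e1, e2})"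
      proof (cases "e = e1")
        case False
        then show ?thesis using e by (simp add: merge_arcs_def joins_def)
      next
        case True
        have "joins G e1 q1 y2" "joins G e2 y2 q2" using e1 q2 by (simp_all add: joins_def)
        moreover have "a \<in> {p2, e1, e2}" if "a \<in> arcs G" "tail G a = y2 \<or> head G a = y2" for a
          using d2(3)[of a] that by auto
        ultimately show ?thesis using True e2(2) vJ by (simp add: merge_arcs_def)
      qed
    qed (rule J)
    then show ?thesis by blast
  qed
qed

text \<open>The pendant arc of \<open>x1\<close> survives or is one of the two merged arcs, so it
  can only become longer.\<close>

lemma leaf_reduction_pendant:
  assumes J: "leaf_reduction x2 p2 y2 x1 e1 e2 q1 q2 J j" and p1: "pendant G p1 y1 x1"
    and p: "pendant J p y x1"
  shows "w p1 \<le> j p"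
proof -
  interpret J: metric_graph J j using J by (simp add: leaf_reduction_def)
  have only: "a = p1" if "a \<in> arcs G" "tail G a = x1 \<or> head G a = x1" for a
    using p1 that unfolding pendant_def by blast
  have pa: "p \<in> arcs J" "tail J p = x1 \<or> head J p = x1"
    using p unfolding pendant_def joins_def by blast+
  from J pa(1) consider "p \<in> arcs G" "joins G p (tail J p) (head J p)" "j p = w p"
    | "tail J p = q1" "head J p = q2" "joins G e1 q1 y2" "joins G e2 y2 q2" "j p = w e1 + w e2"
    unfolding leaf_reduction_def by blast
  then show ?thesis
  proof cases
    case 1
    then have "p = p1" using only[of p] pa(2) unfolding joins_def by blast
    with 1 show ?thesis by simp
  next
    case 2
    then have "e1 = p1 \<or> e2 = p1" using only[of e1] only[of e2] pa(2) by (auto simp: joins_def)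
    moreover have "0 < w e1" "0 < w e2"
      using length_pos[OF joins_arc[OF 2(3)]] length_pos[OF joins_arc[OF 2(4)]] by simp_all
    ultimately show ?thesis using 2(5) by auto
  qed
qed

lemma leaves_two:
  assumes "num_leaves G = 2"
  shows "\<exists>x1 x2 p1 p2 y1 y2. x1 \<noteq> x2 \<and> pendant G p1 y1 x1 \<and> pendant G p2 y2 x2
    \<and> vdegree G x1 = 1 \<and> vdegree G x2 = 1 \<and> w p2 \<le> w p1
    \<and> (\<forall>v\<in>verts G. vdegree G v = 1 \<longrightarrow> v = x1 \<or> v = x2)"
proof -
  obtain a b where ab: "{v \<in> verts G. vdegree G v = 1} = {a, b}" "a \<noteq> b"
    using assms unfolding num_leaves_eq by (metis card_2_iff)
  then have "a \<in> verts G" "vdegree G a = 1" "b \<in> verts G" "vdegree G b = 1" by auto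
  then obtain p y q z where "pendant G p y a" "pendant G q z b" using ex_pendant by meson
  moreover have "\<forall>v\<in>verts G. vdegree G v = 1 \<longrightarrow> v = a \<or> v = b" using ab(1) by blast
  ultimately show ?thesis
    using ab(2) \<open>vdegree G a = 1\<close> \<open>vdegree G b = 1\<close> by (metis linear)
qed

end

lemma isometric_reduced_model:
  fixes G :: "(nat, nat) pre_digraph"
  assumes G: "metric_graph G w"
  shows "\<exists>(H :: (nat, nat) pre_digraph) w'. metric_graph H w' \<and> isometric G w H w'
    \<and> (reduced H \<or> (\<exists>v e. verts H = {v} \<and> arcs H = {e})) \<and> diam H w' = diam G w
    \<and> total_length H w' = total_length G w \<and> cyc H = cyc G \<and> num_leaves H = num_leaves G"
proof (rule reduced_model[OF G])
  fix H :: "(nat, nat) pre_digraph" and w'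
  assume H: "metric_graph H w'" "isometric G w H w'" "reduced H \<or> (\<exists>v e. verts H = {v} \<and> arcs H = {e})"
  have "diam H w' = diam G w" using isometric_diam[OF H(2)] .
  moreover have "total_length H w' = total_length G w"
    using isometric_total_length[OF G H(1,2)] by simp
  moreover have "cyc H = cyc G" "num_leaves H = num_leaves G"
    using isometric_cyc[OF G H(1,2)] isometric_num_leaves[OF G H(1,2)] by simp_all
  ultimately show ?thesis using H by blast
qed

text \<open>With two leaves, the term \<open>- j p\<close> of the one-leaf bound pays for the
  deleted arc, because \<open>h p2 \<le> h p1\<close> and \<open>h p1 \<le> j p\<close>. With more
  leaves, a deletion may cost \<open>D / 2\<close>, the share of one leaf on the right-hand side.
  Vertices of degree two created by a deletion disappear in the reduced model taken at the next
  step.\<close>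

lemma length_bound:
  fixes G :: "(nat, nat) pre_digraph"
  assumes "metric_graph G w" "2 \<le> num_leaves G" "diam G w \<le> D"
  shows "total_length G w \<le> (real_of_int (cyc G) + real (num_leaves G) / 2) * D"
  using assms
proof (induction "num_leaves G" arbitrary: G w rule: less_induct)
  case less
  obtain H :: "(nat, nat) pre_digraph" and h where H: "metric_graph H h" "isometric G w H h"
    "reduced H \<or> (\<exists>v e. verts H = {v} \<and> arcs H = {e})" "diam H h = diam G w"
    "total_length H h = total_length G w" "cyc H = cyc G" "num_leaves H = num_leaves G"
    using isometric_reduced_model[OF less.prems(1)] by blast
  interpret H: metric_graph H h by (rule H(1))
  have two: "2 \<le> num_leaves H" and D: "diam H h \<le> D" using less.prems H(4,7) by simp_all
  let ?L = "{v \<in> verts H. vdegree H v = 1}"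
  have red: "reduced H"
  proof (rule ccontr)
    assume "\<not> reduced H"
    then obtain v where "verts H = {v}" using H(3) by blast
    then have "card ?L \<le> card {v}" by (intro card_mono) auto
    then show False using two by (simp add: num_leaves_eq)
  qed
  have "total_length H h \<le> (H.k + real (num_leaves H) / 2) * D"
  proof (cases "\<exists>p y x. pendant H p y x \<and> arcs H = {p}")
    case True
    then obtain p y x where p: "pendant H p y x" "arcs H = {p}" by blast
    note s = H.single_arc[OF p] and pv = H.pendant_verts[OF p(1)]
    have "card ?L \<le> card {x, y}" using s(1) by (intro card_mono) auto
    then have "num_leaves H = 2" using two pv(4) by (simp add: num_leaves_eq)
    then show ?thesis using s H.vd_le_diam[OF pv(2,1)] D by simp
  next
    case False
    show ?thesis
    proof (cases "num_leaves H = 2")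
      case True
      obtain x1 x2 p1 p2 y1 y2 where x: "x1 \<noteq> x2" "pendant H p1 y1 x1" "pendant H p2 y2 x2"
        "vdegree H x1 = 1" "vdegree H x2 = 1" "h p2 \<le> h p1"
        "\<forall>v\<in>verts H. vdegree H v = 1 \<longrightarrow> v = x1 \<or> v = x2"
        using H.leaves_two[OF True] by blast
      have "arcs H \<noteq> {p2}" using False x(3) by blast
      then obtain e1 e2 q1 q2 J j where J: "H.leaf_reduction x2 p2 y2 x1 e1 e2 q1 q2 J j"
        using H.ex_leaf_reduction[OF red _ x(3) H.pendant_verts(2)[OF x(2)] x(1) x(4)] x(7) by blast
      interpret J: metric_graph J j using J by (simp add: H.leaf_reduction_def)
      have Jx: "x1 \<in> verts J" "vdegree J x1 = 1" "diam J j \<le> D" "cyc J = cyc H"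
        "total_length J j = total_length H h - h p2"
        "\<And>v. v \<in> verts J \<Longrightarrow> v \<noteq> x1 \<Longrightarrow> 3 \<le> vdegree J v"
        using J D by (auto simp: H.leaf_reduction_def)
      obtain p y where p: "pendant J p y x1" using J.ex_pendant[OF Jx(1,2)] by blast
      have "total_length J j \<le> (J.k + 1) * D - j p"
        by (rule J.one_leaf_length[OF _ _ p Jx(2,6,3)]) auto
      then show ?thesis
        using H.leaf_reduction_pendant[OF J x(2) p] x(6) Jx(4,5) True by simp
    next
      case False
      with two have three: "3 \<le> num_leaves H" by simp
      have L: "finite ?L" by simp
      \<comment> \<open>Two leaves whose pendant arcs are both longer than \<open>D / 2\<close>
        would be more than \<open>D\<close> apart, since the foot of one is not the other
        leaf.\<close>
      have "\<exists>x\<in>?L. \<exists>p y. pendant H p y x \<and> h p \<le> D / 2"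
      proof (rule ccontr)
        assume no: "\<not> ?thesis"
        have "\<not> card ?L \<le> Suc 0" using two unfolding num_leaves_eq by simp
        then obtain a b where ab: "a \<in> ?L" "b \<in> ?L" "a \<noteq> b"
          unfolding card_le_Suc0_iff_eq[OF L] by blast
        obtain p y where p: "pendant H p y a" using H.ex_pendant ab(1) by blast
        obtain q z where q: "pendant H q z b" using H.ex_pendant ab(2) by blast
        have big: "D / 2 < h p" "D / 2 < h q"
        proof -
          show "D / 2 < h p" using no ab(1) p by (meson not_le)
          show "D / 2 < h q" using no ab(2) q by (meson not_le)
        qed
        have "y \<noteq> b"
        proof
          assume "y = b"
          then have "arcs H \<noteq> {p}" using \<open>\<not> (\<exists>p y x. pendant H p y x \<and> arcs H = {p})\<close> p by blast
          then show False using H.leaf_neighbor[OF red p] ab(2) \<open>y = b\<close> by simp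
        qed
        then have "H.vd a b = H.vd y z + h q + h p"
          using H.pendant_dist(2)[OF p, of b] H.pendant_dist(1)[OF q, of y] ab
            H.pendant_verts(1)[OF p] by simp
        moreover have "H.vd a b \<le> D" using H.vd_le_diam[of a b] ab D by simp
        moreover have "0 \<le> H.vd y z"
          using H.vd_nonneg[OF H.pendant_verts(1)[OF p] H.pendant_verts(1)[OF q]] .
        ultimately show False using big by simp
      qed
      then obtain x p y where x: "x \<in> ?L" "pendant H p y x" "h p \<le> D / 2" by blast
      have more: "arcs H \<noteq> {p}" using \<open>\<not> (\<exists>p y x. pendant H p y x \<and> arcs H = {p})\<close> x(2) by blast
      have p': "joins H p y x" "y \<noteq> x" "\<And>a. a \<in> arcs H \<Longrightarrow> tail H a = x \<or> head H a = x \<Longrightarrow> a = p"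
        using x(2) unfolding pendant_def by blast+
      note del = delete_leaf_metric_graph[OF H(1) p' more] delete_leaf_diam[OF H(1) p' more]
        delete_leaf_total_length[OF H(1) p' more] delete_leaf_cyc[OF H(1) p' more]
        delete_leaf_degree[OF H(1) p' more]
      let ?K = "delete_leaf H x p"
      have y3: "3 \<le> vdegree H y" using H.leaf_neighbor[OF red x(2) more] .
      have "vdegree ?K v = 1 \<longleftrightarrow> vdegree H v = 1" if "v \<noteq> x" for v
        using del(5)[of v] that y3 by auto
      then have "{v \<in> verts ?K. vdegree ?K v = 1} = ?L - {x}" by auto
      then have leaves: "num_leaves ?K = num_leaves H - 1"
        using x(1) L unfolding num_leaves_eq by simp
      have "total_length ?K h \<le> (real_of_int (cyc ?K) + real (num_leaves ?K) / 2) * D"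
        by (rule less.hyps) (use leaves three H(7) del(1,2) D in auto)
      then have "total_length H h - h p \<le> (H.k + (real (num_leaves H) - 1) / 2) * D"
        using del(3,4) leaves three by (simp add: of_nat_diff)
      then show ?thesis using x(3) by (simp add: algebra_simps diff_divide_distrib)
    qed
  qed
  then show ?case using H(5-7) by simp
qed

section \<open>Extremal graphs with leaves\<close>

context metric_graph
begin

text \<open>Deleting \<open>x2\<close> gives an extremal graph \<open>J\<close> with one leaf, whose
  long arcs have to be found again in \<open>G\<close>. The difficulty is that an arc of
  \<open>J\<close> may be composed of two arcs through \<open>y2\<close>. For \<open>k = 1\<close>
  only an arc of length at least \<open>D\<close> is obtained; a longer one is cut to length
  \<open>D\<close> later.\<close>

lemma two_leaf_parallel:
  assumes inf: "infinite (UNIV :: 'v set)" "infinite (UNIV :: 'e set)"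
    and red: "reduced G" and more: "arcs G \<noteq> {p2}"
    and p1: "pendant G p1 y1 x1" and p2: "pendant G p2 y2 x2" and x: "x1 \<noteq> x2" "vdegree G x1 = 1"
    and leaves: "\<And>v. v \<in> verts G \<Longrightarrow> vdegree G v = 1 \<Longrightarrow> v = x1 \<or> v = x2"
    and le: "w p2 \<le> w p1" and D: "diam G w \<le> D" and len: "total_length G w = (k + 1) * D"
  shows "1 \<le> k"
    and "2 \<le> k \<Longrightarrow> \<exists>N u v. N \<subseteq> arcs G \<and> real (card N) = k \<and> (\<forall>a\<in>N. joins G a u v \<and> w a = D)
      \<and> u \<notin> {x1, x2} \<and> v \<notin> {x1, x2}"
    and "k = 1 \<Longrightarrow> \<exists>e\<in>arcs G. D \<le> w e \<and> tail G e \<notin> {x1, x2} \<and> head G e \<notin> {x1, x2}"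
proof -
  note pv1 = pendant_verts[OF p1] and pv2 = pendant_verts[OF p2]
  obtain e1 e2 q1 q2 J j where red: "leaf_reduction x2 p2 y2 x1 e1 e2 q1 q2 J j"
    using ex_leaf_reduction[OF red more p2 pv1(2) x leaves] by blast
  interpret J: metric_graph J j using red by (simp add: leaf_reduction_def)
  have J: "x1 \<in> verts J" "vdegree J x1 = 1" "diam J j \<le> D" "cyc J = cyc G"
    "total_length J j = total_length G w - w p2" "verts J \<subseteq> verts G - {x2}"
    using red D by (auto simp: leaf_reduction_def)
  have J3: "\<And>v. v \<in> verts J \<Longrightarrow> v \<noteq> x1 \<Longrightarrow> 3 \<le> vdegree J v"
    using red by (auto simp: leaf_reduction_def)
  have Jd: "J.vd u v = vd u v" if "u \<in> verts J" "v \<in> verts J" for u v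
    using red that by (auto simp: leaf_reduction_def)
  obtain p y where p: "pendant J p y x1" using J.ex_pendant[OF J(1,2)] by blast
  note pvJ = J.pendant_verts[OF p]
  note J_ctx = inf p J(2) J3 J(3)
  show k1: "1 \<le> k" using J.one_leaf_weight(4)[OF J_ctx] J(4) by simp
  have "total_length J j \<le> (k + 1) * D - j p" using J.one_leaf_length[OF J_ctx] J(4) by simp
  then have lam: "j p = w p1" "w p2 = w p1"
    using leaf_reduction_pendant[OF red p1 p] le len J(5) by simp_all
  have lenJ: "total_length J j = (k + 1) * D - j p" using len J(5) lam by simp
  define normal where "normal e \<longleftrightarrow> e \<in> arcs G \<and> joins G e (tail J e) (head J e) \<and> j e = w e" for e
  have special: "e = e1" "e1 \<noteq> e2" "tail J e = q1" "head J e = q2" "joins G e1 q1 y2" "joins G e2 y2 q2"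
    "j e = w e1 + w e2" "y2 \<notin> verts J"
    "\<And>a. a \<in> arcs G \<Longrightarrow> tail G a = y2 \<or> head G a = y2 \<Longrightarrow> a \<in> {p2, e1, e2}"
    if e: "e \<in> arcs J" "\<not> normal e" for e
    using red e unfolding leaf_reduction_def normal_def by blast+
  have joinsG: "joins G e a b" if "normal e" "joins J e a b" for e a b
    using that unfolding normal_def joins_def by blast
  \<comment> \<open>A shortest path to \<open>y2\<close> cannot come from the dead end
    \<open>x2\<close>, so it arrives by one of the two merged arcs.\<close>
  have dist_y2: "vd r y2 = vd r q1 + w e1 \<or> vd r y2 = vd r q2 + w e2"
    if e: "e \<in> arcs J" "\<not> normal e" and r: "r \<in> verts J" for e r
  proof -
    note sp = special[OF e]
    have rG: "r \<in> verts G" "r \<noteq> y2" "r \<noteq> x2" using r sp(8) J(6) by auto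
    obtain a z where a: "joins G a z y2" "vd r y2 = vd r z + w a"
      using dist_parent[OF rG(1) pv2(1)] rG(2) by metis
    have qJ: "q1 \<noteq> y2" "q2 \<noteq> y2" using sp(3,4,8) e(1) J.tail_in_verts J.head_in_verts by blast+
    have "a \<in> {p2, e1, e2}" using sp(9)[OF joins_arc[OF a(1)]] a(1) unfolding joins_def by blast
    moreover have "a \<noteq> p2"
    proof
      assume "a = p2"
      then have "z = x2" using a(1) p2 unfolding pendant_def joins_def by blast
      then show False using a(2) \<open>a = p2\<close> pendant_dist(1)[OF p2 rG(1,3)] pv2(5) by simp
    qed
    moreover have "z = q1" if "a = e1"
      using a(1) sp(5) qJ(1) unfolding that joins_def by blast
    moreover have "z = q2" if "a = e2"
      using a(1) sp(6) qJ(2) unfolding that joins_def by blast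
    ultimately show ?thesis using a(2) by blast
  qed
  show "\<exists>N u v. N \<subseteq> arcs G \<and> real (card N) = k \<and> (\<forall>a\<in>N. joins G a u v \<and> w a = D)
      \<and> u \<notin> {x1, x2} \<and> v \<notin> {x1, x2}" if k2: "2 \<le> k"
  proof -
    have "2 \<le> J.k" "total_length J j = (J.k + 1) * D - j p" using k2 lenJ J(4) by simp_all
    then obtain N u v where N: "N \<subseteq> arcs J" "real (card N) = J.k" "\<forall>a\<in>N. joins J a u v \<and> j a = D"
      "D - 2 * j p \<le> J.vd u v"
      using J.one_leaf_extremal[OF J_ctx] by blast
    have two: "\<exists>e'\<in>N. e' \<noteq> e" for e
    proof (rule ccontr)
      assume "\<not> (\<exists>e'\<in>N. e' \<noteq> e)"
      then have "N \<subseteq> {e}" by blast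
      then have "card N \<le> 1" using card_mono[of "{e}" N] by simp
      then show False using N(2) k2 J(4) by simp
    qed
    obtain e0 where "e0 \<in> N" using two by blast
    then have uvJ: "u \<in> verts J" "v \<in> verts J" using N(3) J.joins_verts by blast+
    then have uvG: "u \<in> verts G" "v \<in> verts G" "u \<noteq> x2" "v \<noteq> x2" using J(6) by auto
    have all_normal: "normal e" if e: "e \<in> N" for e
    proof (rule ccontr)
      assume nn: "\<not> normal e"
      have eJ: "e \<in> arcs J" using e N(1) by blast
      note sp = special[OF eJ nn]
      obtain e' where e': "e' \<in> N" "e' \<noteq> e" using two by blast
      have "normal e'" using special(1)[of e'] special(1)[OF eJ nn] e' N(1) by blast
      then have e'G: "joins G e' u v" "w e' = D" "e' \<in> arcs G"
        using joinsG[of e' u v] N(3) e'(1) by (auto simp: normal_def)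
      \<comment> \<open>The highest point of the genuine arc \<open>e'\<close> is at most
        \<open>D\<close> away from \<open>x2\<close>. This is incompatible with a path of length
        \<open>D\<close> from \<open>u\<close> to \<open>v\<close> through \<open>y2\<close>,
        whichever way the distances from \<open>u\<close> and \<open>v\<close> to \<open>y2\<close>
        are attained.\<close>
      have "vd x2 u + vd x2 v \<le> D"
        using height2_le_diam[OF pv2(2) e'G(3)] D e'G(1,2) by (auto simp: height2_def joins_def)
      then have 1: "vd u y2 + vd v y2 + 2 * w p2 \<le> D"
        using pendant_dist(2)[OF p2 uvG(1,3)] pendant_dist(2)[OF p2 uvG(2,4)] vd_commute[of y2] by simp
      have 2: "D - 2 * w p2 \<le> vd u v" using N(4) lam Jd[OF uvJ] by simp
      have q: "q1 = u \<and> q2 = v \<or> q1 = v \<and> q2 = u" using N(3) e sp(3,4) unfolding joins_def by blast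
      have D': "w e1 + w e2 = D" using N(3) e sp(7) by simp
      have pos: "0 < w e1" "0 < w e2" using length_pos[OF joins_arc[OF sp(5)]] length_pos[OF joins_arc[OF sp(6)]] .
      show False
        using q dist_y2[OF eJ nn uvJ(1)] dist_y2[OF eJ nn uvJ(2)] 1 2 D' pos pv2(5) vd_commute[of v u] uvG
          vd_nonneg[OF uvG(1,2)] by auto
    qed
    have NG: "N \<subseteq> arcs G" "\<forall>a\<in>N. joins G a u v \<and> w a = D"
      using all_normal joinsG N(3) unfolding normal_def by auto
    obtain e where e: "e \<in> N" "e \<noteq> p1" using two by blast
    have "u \<noteq> x1 \<and> v \<noteq> x1" using NG(2) e p1 unfolding pendant_def joins_def by blast
    then show ?thesis using NG N(2) J(4) uvG by (intro exI[of _ N] exI[of _ u] exI[of _ v]) simp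
  qed
  show "\<exists>e\<in>arcs G. D \<le> w e \<and> tail G e \<notin> {x1, x2} \<and> head G e \<notin> {x1, x2}" if k1: "k = 1"
  proof -
    \<comment> \<open>For \<open>k = 1\<close> the weights off the leaf sum to 1, so
      \<open>J\<close> consists of a pendant arc and a loop at its foot.\<close>
    have sumW: "(\<Sum>v\<in>verts J - {x1}. J.weight v) = 1"
      using J.one_leaf_weight(3)[OF J_ctx] J(4) k1 by simp
    have W1: "1 \<le> J.weight v" if "v \<in> verts J - {x1}" for v
      using J.one_leaf_weight(2)[OF J_ctx] that by blast
    have "real (card (verts J - {x1})) \<le> (\<Sum>v\<in>verts J - {x1}. J.weight v)"
      using sum_mono[of "verts J - {x1}" "\<lambda>_. 1" J.weight] W1 by simp
    then have "card (verts J - {x1}) \<le> Suc 0" using sumW by simp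
    then have "z = y" if "z \<in> verts J - {x1}" for z
      using that pvJ(1,4) card_le_Suc0_iff_eq[of "verts J - {x1}"] by auto
    then have VJ: "verts J = {x1, y}" using pvJ(1,2) by blast
    have "card (verts J) = 2" using VJ pvJ(4) by simp
    then have "card (arcs J) = 2" using J(4) k1 by (simp add: cyc_def)
    then have "card (arcs J - {p}) = 1" using pvJ(3) by simp
    then obtain l where l: "arcs J - {p} = {l}" by (rule card_1_singletonE)
    have lJ: "l \<in> arcs J" "l \<noteq> p" using l by blast+
    have "tail J l \<noteq> x1" "head J l \<noteq> x1" using lJ p unfolding pendant_def by blast+
    then have ly: "tail J l = y" "head J l = y"
      using VJ J.tail_in_verts[OF lJ(1)] J.head_in_verts[OF lJ(1)] by blast+
    have "total_length J j = j p + j l"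
      unfolding total_length_def using sum.remove[OF J.finite_arcs pvJ(3), of j] l by simp
    then have jl: "j l = 2 * D - 2 * w p2" using lenJ lam k1 by simp
    have y: "y \<notin> {x1, x2}" using pvJ(1,4) J(6) by blast
    have x12: "vd x1 x2 = vd x1 y2 + w p2" using pendant_dist(1)[OF p2 pv1(2) x(1)] .
    have xd: "vd x1 x2 \<le> D" using vd_le_diam[OF pv1(2) pv2(2)] D by simp
    show ?thesis
    proof (cases "normal l")
      case True
      have lG: "l \<in> arcs G" "joins G l y y" using True joinsG[OF True, of y y] lJ ly by (auto simp: normal_def joins_def)
      have "y2 \<noteq> x1"
        using leaf_neighbor[OF assms(3) p2 more] x(2) by auto
      then have "2 * w p2 \<le> D" using x12 xd pendant_dist_ge[OF p1 pv2(1)] lam by simp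
      then have "D \<le> w l" using True jl by (simp add: normal_def)
      moreover have "tail G l = y" "head G l = y" using lG(2) by (auto simp: joins_def)
      ultimately show ?thesis using lG(1) y by (intro bexI[of _ l]) simp_all
    next
      case False
      note sp = special[OF lJ(1) False]
      have q: "q1 = y" "q2 = y" using sp(3,4) ly by simp_all
      have "normal p" using special(1)[OF pvJ(3)] sp(1) lJ(2) by blast
      then have pG: "p \<in> arcs G" "joins G p y x1" using joinsG[of p y x1] p unfolding normal_def pendant_def by blast+
      then have "p = p1" using p1 unfolding pendant_def joins_def by blast
      then have "y = y1" using pG(2) p1 unfolding pendant_def joins_def by blast
      have y2x: "y2 \<noteq> x1" using sp(8) J(1) by blast
      have yG: "y \<in> verts G" using pvJ(1) J(6) by blast
      have "vd x1 x2 = vd y y2 + 2 * w p2"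
        using x12 pendant_dist(2)[OF p1 pv2(1) y2x] \<open>y = y1\<close> lam by simp
      then have 1: "vd y y2 + 2 * w p2 \<le> D" using xd by simp
      \<comment> \<open>One of the two arcs between \<open>y\<close> and \<open>y2\<close> realises
        their distance and has length at most \<open>D - 2 * w p2\<close>; as both together have
        length \<open>2 * D - 2 * w p2\<close>, the other has length at least
        \<open>D\<close>.\<close>
      have "vd y y2 = w e1 \<or> vd y y2 = w e2"
        using dist_y2[OF lJ(1) False pvJ(1)] q yG by simp
      then have "D \<le> w e2 \<or> D \<le> w e1" using 1 sp(7) jl by auto
      moreover have "joins G e1 y y2" "joins G e2 y y2" using sp(5,6) q joins_commute[of G e2] by simp_all
      ultimately obtain e where e: "joins G e y y2" "D \<le> w e" by blast
      have "y2 \<notin> {x1, x2}" using y2x pv2(4) by auto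
      moreover have "tail G e \<in> {y, y2}" "head G e \<in> {y, y2}" using e(1) by (auto simp: joins_def)
      ultimately show ?thesis using e joins_arc[OF e(1)] y by (intro bexI[of _ e]) auto
    qed
  qed
qed

lemma two_leaf_structure:
  assumes p1: "pendant G p1 y1 x1" and p2: "pendant G p2 y2 x2" and x: "x1 \<noteq> x2" "vdegree G x1 = 1" "vdegree G x2 = 1"
    and uv: "u \<in> verts G - {x1, x2}" "v \<in> verts G - {x1, x2}" "2 \<le> vdegree G u" "2 \<le> vdegree G v"
    and deg0: "\<forall>z\<in>verts G - {x1, x2}. z \<noteq> u \<longrightarrow> z \<noteq> v \<longrightarrow> 3 \<le> vdegree G z"
    and N0: "N \<subseteq> arcs G" "real (card N) = k" "1 \<le> k" "\<forall>a\<in>N. joins G a u v \<and> w a = D"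
    and D: "diam G w \<le> D" and len: "total_length G w = (k + 1) * D"
  shows "y1 \<notin> {x1, x2}" "y2 \<notin> {x1, x2}" "vd u v = D - 2 * w p1" "vd u v = D - 2 * w p2"
    and "\<And>z. z \<in> verts G - {x1, x2} \<Longrightarrow> vd u z + vd v z = vd u v" "cotree u N"
proof -
  note N = N0(1-3) bspec[OF N0(4)]
  have deg: "3 \<le> vdegree G z" if "z \<in> verts G - {x1, x2}" "z \<noteq> u" "z \<noteq> v" for z
    using deg0 that by blast
  note pv1 = pendant_verts[OF p1] and pv2 = pendant_verts[OF p2]
  have uvG: "u \<in> verts G" "v \<in> verts G" "u \<noteq> x1" "v \<noteq> x1" "u \<noteq> x2" "v \<noteq> x2" using uv by auto
  have swap: "y1 \<noteq> x2 \<and> y2 \<noteq> x1"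
  proof (rule ccontr)
    assume "\<not> ?thesis"
    then have "p1 = p2" using p1 p2 unfolding pendant_def joins_def by blast
    then have "y1 = x2" "y2 = x1" using p1 p2 x(1) unfolding pendant_def joins_def by blast+
    then show False
      using pendant_dist(2)[OF p1 uvG(1,3)] pendant_dist(2)[OF p2 uvG(1,5)] pv1(5) pv2(5) by simp
  qed
  then show y: "y1 \<notin> {x1, x2}" "y2 \<notin> {x1, x2}" using pv1(4) pv2(4) by auto
  have "N \<noteq> {}" using N(2,3) by auto
  then obtain e where e: "e \<in> N" by blast
  then have eG: "joins G e u v" "w e = D" "e \<in> arcs G" using N by auto
  have s_le: "vd r u + vd r v \<le> D" if "r \<in> verts G" for r
    using height2_le_diam[OF that eG(3)] D eG(1,2) by (auto simp: height2_def joins_def)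
  have sx1: "vd u x1 + vd v x1 = vd u y1 + vd v y1 + 2 * w p1"
    using pendant_dist(1)[OF p1] uvG by simp
  have sx2: "vd u x2 + vd v x2 = vd u y2 + vd v y2 + 2 * w p2"
    using pendant_dist(1)[OF p2] uvG by simp
  have tri: "vd u v \<le> vd u z + vd v z" if "z \<in> verts G" for z
    using vd_triangle[OF uvG(1) that uvG(2)] vd_commute[of z v] by simp
  have sD: "vd u x1 + vd v x1 \<le> D" "vd u x2 + vd v x2 \<le> D"
    using s_le[OF pv1(2)] s_le[OF pv2(2)] vd_commute[of x1] vd_commute[of x2] by simp_all
  have less: "vd u v < D" using tri[OF pv1(1)] sx1 sD(1) pv1(5) by linarith
  show "cotree u N" by (rule parallel_arcs_moment(1)[OF uvG(1) N(1,2,4) less])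
  have "total_length G w + moment u = k * (vd u v + D)"
    by (rule parallel_arcs_moment(2)[OF uvG(1) N(1,2,4) less])
  moreover have "total_length G w + moment v = k * (vd v u + D)"
  proof (rule parallel_arcs_moment(2)[OF uvG(2) N(1,2)])
    show "joins G a v u \<and> w a = D" if "a \<in> N" for a
      using N(4)[OF that] joins_commute[of G a u v] by simp
    show "vd v u < D" using less vd_commute by simp
  qed
  ultimately have mom: "moment u + moment v = 2 * k * vd u v - 2 * D"
    using len vd_commute[of v u] by (simp add: algebra_simps)
  let ?C = "verts G - {x1, x2}"
  have rem: "(\<Sum>z\<in>verts G. weight z * h z) = (\<Sum>z\<in>?C. weight z * h z) - h x1 - h x2" for h
  proof -
    have "(\<Sum>z\<in>verts G. weight z * h z) = weight x1 * h x1 + (weight x2 * h x2 + (\<Sum>z\<in>verts G - {x1} - {x2}. weight z * h z))"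
      using sum.remove[OF finite_verts pv1(2), of "\<lambda>z. weight z * h z"]
        sum.remove[of "verts G - {x1}" x2 "\<lambda>z. weight z * h z"] pv2(2) x(1) by simp
    moreover have "verts G - {x1} - {x2} = ?C" by blast
    ultimately show ?thesis using x(2,3) by (simp add: weight_def)
  qed
  have W0: "0 \<le> weight z" if "z \<in> ?C" for z
    using deg[OF that] uv(3,4) by (cases "z = u \<or> z = v") (auto simp: weight_def)
  have W1: "0 < weight z" if "z \<in> ?C" "z \<noteq> u" "z \<noteq> v" for z
    using deg[OF that] by (simp add: weight_def)
  have sumC: "(\<Sum>z\<in>?C. weight z) = 2 * k"
    using rem[of "\<lambda>_. 1"] sum_weight by simp
  have eq: "moment u + moment v = (\<Sum>z\<in>?C. weight z * (vd u z + vd v z))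
      - (vd u x1 + vd v x1) - (vd u x2 + vd v x2)"
    using rem[of "\<lambda>z. vd u z + vd v z"] by (simp add: moment_def distrib_left sum.distrib)
  have expand: "(\<Sum>z\<in>?C. weight z * (vd u z + vd v z - vd u v))
      = (\<Sum>z\<in>?C. weight z * (vd u z + vd v z)) - 2 * k * vd u v"
    unfolding sumC[symmetric] sum_distrib_right sum_subtractf[symmetric]
    by (rule sum.cong) (simp_all add: algebra_simps)
  have nonneg: "0 \<le> weight z * (vd u z + vd v z - vd u v)" if "z \<in> ?C" for z
    using W0[OF that] tri[of z] that by (intro mult_nonneg_nonneg) auto
  then have "0 \<le> (\<Sum>z\<in>?C. weight z * (vd u z + vd v z - vd u v))" by (rule sum_nonneg)
  then have sx: "vd u x1 + vd v x1 = D" "vd u x2 + vd v x2 = D"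
    and zero: "(\<Sum>z\<in>?C. weight z * (vd u z + vd v z - vd u v)) \<le> 0"
    using expand eq mom sD by linarith+
  show between: "vd u z + vd v z = vd u v" if z: "z \<in> ?C" for z
  proof (cases "z = u \<or> z = v")
    case True
    then show ?thesis using uvG vd_commute[of v u] by auto
  next
    case False
    have "weight z * (vd u z + vd v z - vd u v) = 0"
      by (rule sum_le_0_imp_eq_0[OF _ nonneg zero z]) simp_all
    then show ?thesis using W1[OF z] False by auto
  qed
  show "vd u v = D - 2 * w p1" using between[of y1] sx(1) sx1 y pv1(1) by auto
  show "vd u v = D - 2 * w p2" using between[of y2] sx(2) sx2 y pv2(1) by auto
qed

end

text \<open>\<open>p\<close> is a parent map along which \<open>f\<close> decreases by the edge
  length \<open>c\<close>. If the edges are together no longer than the height of one vertex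
  \<open>t\<close>, all of them lie on the way from \<open>r\<close> to \<open>t\<close>, so the
  tree is a path. The induction removes the highest vertex, which cannot be a parent.\<close>

lemma monotone_tree_length:
  fixes f c :: "'a \<Rightarrow> real"
  assumes "finite V" "r \<in> V" "f r = 0"
    and "\<And>v. v \<in> V - {r} \<Longrightarrow> p v \<in> V \<and> f v = f (p v) + c v \<and> 0 < c v"
  shows "(\<forall>t\<in>V. f t \<le> (\<Sum>v\<in>V - {r}. c v)) \<and>
    (\<forall>t\<in>V. (\<Sum>v\<in>V - {r}. c v) \<le> f t \<longrightarrow>
      inj_on f V \<and> (\<forall>v\<in>V - {r}. \<forall>z\<in>V. f (p v) < f z \<longrightarrow> f v \<le> f z))"
  using assms
proof (induction "card V" arbitrary: V rule: less_induct)
  case less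
  show ?case
  proof (cases "V = {r}")
    case True
    then show ?thesis using less.prems(3) by simp
  next
    case False
    let ?S = "V - {r}"
    have fin: "finite ?S" "?S \<noteq> {}" using less.prems(1,2) False by auto
    then have "Max (f ` ?S) \<in> f ` ?S" by (intro Max_in) auto
    then obtain m where m: "m \<in> ?S" "f m = Max (f ` ?S)" by (elim imageE) simp
    have max: "f v \<le> f m" if "v \<in> ?S" for v using that fin m(2) by simp
    note P = less.prems(4)
    have pm: "p m \<in> V - {m}" "f m = f (p m) + c m" "0 < c m" using P[OF m(1)] by auto
    have closed: "p v \<in> V - {m} \<and> f v = f (p v) + c v \<and> 0 < c v" if v: "v \<in> (V - {m}) - {r}" for v
    proof -
      have "v \<in> ?S" using v by blast
      from P[OF this] max[OF this] show ?thesis by auto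
    qed
    have "card (V - {m}) < card V" using m(1) less.prems(1) by (intro psubset_card_mono) auto
    note IH = less.hyps[OF this, OF _ _ less.prems(3) closed]
    have IH1: "f t \<le> (\<Sum>v\<in>(V - {m}) - {r}. c v)" if "t \<in> V - {m}" for t
      using IH that less.prems(1,2) m(1) by blast
    have IH2: "inj_on f (V - {m})" "\<And>v z. v \<in> (V - {m}) - {r} \<Longrightarrow> z \<in> V - {m} \<Longrightarrow> f (p v) < f z \<Longrightarrow> f v \<le> f z"
      if "t \<in> V - {m}" "(\<Sum>v\<in>(V - {m}) - {r}. c v) \<le> f t" for t
      using IH that less.prems(1,2) m(1) by blast+
    have "?S - {m} = (V - {m}) - {r}" by blast
    then have sum: "(\<Sum>v\<in>?S. c v) = c m + (\<Sum>v\<in>(V - {m}) - {r}. c v)"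
      using sum.remove[OF fin(1) m(1), of c] by simp
    have A: "f t \<le> (\<Sum>v\<in>?S. c v)" if "t \<in> V" for t
    proof (cases "t = m")
      case True
      then show ?thesis using IH1[OF pm(1)] pm(2) sum by simp
    next
      case False
      then show ?thesis using IH1[of t] that pm(3) sum by simp
    qed
    moreover have "inj_on f V \<and> (\<forall>v\<in>V - {r}. \<forall>z\<in>V. f (p v) < f z \<longrightarrow> f v \<le> f z)"
      if t: "t \<in> V" "(\<Sum>v\<in>?S. c v) \<le> f t" for t
    proof -
      have "t = m"
      proof (rule ccontr)
        assume "t \<noteq> m"
        then show False using IH1[of t] t pm(3) sum by simp
      qed
      then have le: "(\<Sum>v\<in>(V - {m}) - {r}. c v) \<le> f (p m)" using t(2) pm(2) sum by simp
      note I = IH2[OF pm(1) le]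
      have below: "f z \<le> f (p m)" if "z \<in> V - {m}" for z using IH1[OF that] le by simp
      have lt: "f z < f m" if "z \<in> V - {m}" for z using below[OF that] pm(2,3) by simp
      have "inj_on f V"
      proof (rule inj_onI)
        fix a b assume ab: "a \<in> V" "b \<in> V" "f a = f b"
        show "a = b"
        proof (cases "a = m \<or> b = m")
          case True
          show ?thesis
          proof (rule ccontr)
            assume "a \<noteq> b"
            then have "a = m \<and> b \<in> V - {m} \<or> b = m \<and> a \<in> V - {m}" using True ab by blast
            then show False using lt[of a] lt[of b] ab(3) by auto
          qed
        next
          case False
          then show ?thesis using inj_onD[OF I(1) ab(3)] ab by simp
        qed
      qed
      moreover have "f v \<le> f z" if v: "v \<in> V - {r}" "z \<in> V" "f (p v) < f z" for v z
      proof (cases "z = m")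
        case True
        then show ?thesis using max[OF v(1)] by simp
      next
        case z: False
        show ?thesis
        proof (cases "v = m")
          case True
          then show ?thesis using below[of z] z v by simp
        next
          case False
          then show ?thesis using I(2)[of v z] z v by simp
        qed
      qed
      ultimately show ?thesis by blast
    qed
    ultimately show ?thesis by blast
  qed
qed

context metric_graph
begin

text \<open>The arcs that are neither parallel nor pendant form a tree on \<open>C\<close>. Their
  total length \<open>(k + 1) * D - k * D - 2 * w p1\<close> equals \<open>vd u v\<close>, so
  \<open>monotone_tree_length\<close> makes it a path from \<open>u\<close> to \<open>v\<close>. An
  inner vertex of the path to which no pendant arc is attached would have degree two.\<close>

lemma two_leaf_path:
  assumes p1: "pendant G p1 y1 x1" and p2: "pendant G p2 y2 x2" and x: "x1 \<noteq> x2" "vdegree G x1 = 1" "vdegree G x2 = 1"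
    and uv: "u \<in> verts G - {x1, x2}" "v \<in> verts G - {x1, x2}" "2 \<le> vdegree G u" "2 \<le> vdegree G v"
    and deg0: "\<forall>z\<in>verts G - {x1, x2}. z \<noteq> u \<longrightarrow> z \<noteq> v \<longrightarrow> 3 \<le> vdegree G z"
    and N0: "N \<subseteq> arcs G" "real (card N) = k" "1 \<le> k" "\<forall>a\<in>N. joins G a u v \<and> w a = D"
    and D: "diam G w \<le> D" and len: "total_length G w = (k + 1) * D"
  defines "C \<equiv> verts G - {x1, x2}"
  shows "\<exists>par p. (\<forall>z\<in>C - {u}. joins G (par z) (p z) z \<and> p z \<in> C \<and> vd u z = vd u (p z) + w (par z)
        \<and> (\<forall>a\<in>C. vd u (p z) < vd u a \<longrightarrow> vd u z \<le> vd u a))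
      \<and> bij_betw par (C - {u}) (arcs G - N - {p1, p2}) \<and> inj_on (vd u) C \<and> C = {u, v, y1, y2}
      \<and> p1 \<in> arcs G - N \<and> p2 \<in> arcs G - N \<and> p1 \<noteq> p2"
proof -
  note st = two_leaf_structure[OF p1 p2 x uv deg0 N0 D len]
  note N = N0(1-3) bspec[OF N0(4)]
  have deg: "3 \<le> vdegree G z" if "z \<in> verts G - {x1, x2}" "z \<noteq> u" "z \<noteq> v" for z
    using deg0 that by blast
  note pv1 = pendant_verts[OF p1] and pv2 = pendant_verts[OF p2]
  note coN = cotreeD[OF st(6)]
  have uG: "u \<in> verts G" "u \<noteq> x1" "u \<noteq> x2" using uv by auto
  have ex: "\<exists>e. (e \<in> arcs G - N \<and> tops u e a) \<and> (\<forall>e'. e' \<in> arcs G - N \<and> tops u e' a \<longrightarrow> e' = e)"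
    if "a \<in> verts G" "a \<noteq> u" for a
    using coN(6)[OF that] by (elim ex1E) blast
  then have "\<exists>par. \<forall>a. a \<in> verts G \<and> a \<noteq> u \<longrightarrow> par a \<in> arcs G - N \<and> tops u (par a) a \<and>
      (\<forall>e'. e' \<in> arcs G - N \<and> tops u e' a \<longrightarrow> e' = par a)"
    by (intro choice) blast
  then obtain par where par: "\<And>a. a \<in> verts G \<Longrightarrow> a \<noteq> u \<Longrightarrow> par a \<in> arcs G - N"
    "\<And>a. a \<in> verts G \<Longrightarrow> a \<noteq> u \<Longrightarrow> tops u (par a) a"
    "\<And>a e. a \<in> verts G \<Longrightarrow> a \<noteq> u \<Longrightarrow> e \<in> arcs G - N \<Longrightarrow> tops u e a \<Longrightarrow> e = par a"
    by blast
  have "\<exists>p. \<forall>a. a \<in> verts G \<and> a \<noteq> u \<longrightarrow> joins G (par a) (p a) a \<and> vd u a = vd u (p a) + w (par a)"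
    using par(2) by (intro choice) (auto simp: tops_def)
  then obtain p where p: "\<And>a. a \<in> verts G \<Longrightarrow> a \<noteq> u \<Longrightarrow> joins G (par a) (p a) a"
    "\<And>a. a \<in> verts G \<Longrightarrow> a \<noteq> u \<Longrightarrow> vd u a = vd u (p a) + w (par a)" by blast
  have px1: "par x1 = p1" using p(1)[OF pv1(2)] uG(2) p1 unfolding pendant_def joins_def by blast
  have px2: "par x2 = p2" using p(1)[OF pv2(2)] uG(3) p2 unfolding pendant_def joins_def by blast
  have pN: "p1 \<in> arcs G - N" "p2 \<in> arcs G - N"
    using par(1)[OF pv1(2)] par(1)[OF pv2(2)] px1 px2 uG by auto
  have inj: "par a \<noteq> par b" if "a \<in> verts G" "b \<in> verts G" "a \<noteq> u" "b \<noteq> u" "a \<noteq> b" for a b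
    using par(2)[OF that(1,3)] par(2)[OF that(2,4)] that(5) tops_unique by metis
  have p12: "p1 \<noteq> p2" using inj[OF pv1(2) pv2(2)] uG x(1) px1 px2 by auto
  have zC: "par z \<in> arcs G - N - {p1, p2} \<and> joins G (par z) (p z) z \<and> p z \<in> C
      \<and> vd u z = vd u (p z) + w (par z)" if z: "z \<in> C - {u}" for z
  proof -
    have zG: "z \<in> verts G" "z \<noteq> u" "z \<noteq> x1" "z \<noteq> x2" using z by (auto simp: C_def)
    have ne: "par z \<noteq> p1" "par z \<noteq> p2"
      using inj[OF zG(1) pv1(2)] inj[OF zG(1) pv2(2)] zG uG px1 px2 by auto
    have "p z \<noteq> x1" "p z \<noteq> x2"
      using p(1)[OF zG(1,2)] ne p1 p2 unfolding pendant_def joins_def by blast+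
    then show ?thesis using par(1)[OF zG(1,2)] p[OF zG(1,2)] ne joins_verts[OF p(1)[OF zG(1,2)]]
      by (simp add: C_def)
  qed
  have bij: "bij_betw par (C - {u}) (arcs G - N - {p1, p2})"
    unfolding bij_betw_def
  proof (intro conjI inj_onI equalityI subsetI)
    fix a b assume "a \<in> C - {u}" "b \<in> C - {u}" "par a = par b"
    then show "a = b" using inj[of a b] by (auto simp: C_def)
  next
    fix e assume "e \<in> par ` (C - {u})"
    then show "e \<in> arcs G - N - {p1, p2}" using zC by blast
  next
    fix e assume e: "e \<in> arcs G - N - {p1, p2}"
    then obtain a where a: "a \<noteq> u" "tops u e a" using coN(5)[of e] by blast
    have aG: "a \<in> verts G" using tops_arc[OF a(2)] by simp
    have ep: "e = par a" using par(3)[OF aG a(1) _ a(2)] e by blast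
    then have "a \<in> C - {u}" using e px1 px2 a(1) aG by (auto simp: C_def)
    with ep show "e \<in> par ` (C - {u})" by blast
  qed
  have finC: "finite C" by (simp add: C_def)
  have uC: "u \<in> C" "v \<in> C" using uv by (simp_all add: C_def)
  have "(\<Sum>z\<in>C - {u}. w (par z)) = (\<Sum>e\<in>arcs G - N - {p1, p2}. w e)"
    by (rule sum.reindex_bij_betw[OF bij])
  also have "\<dots> = total_length G w - (\<Sum>e\<in>N. w e) - (w p1 + w p2)"
  proof -
    have "(\<Sum>e\<in>arcs G - N. w e) = (\<Sum>e\<in>arcs G - N - {p1, p2}. w e) + (\<Sum>e\<in>{p1, p2}. w e)"
      by (rule sum.subset_diff) (use pN in auto)
    moreover have "(\<Sum>e\<in>arcs G. w e) = (\<Sum>e\<in>arcs G - N. w e) + (\<Sum>e\<in>N. w e)"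
      by (rule sum.subset_diff) (use N(1) in auto)
    ultimately show ?thesis using p12 by (simp add: total_length_def)
  qed
  also have "\<dots> = vd u v"
    using N(2,4) len st(3,4) by (simp add: algebra_simps)
  finally have sum: "(\<Sum>z\<in>C - {u}. w (par z)) \<le> vd u v" by simp
  have u0: "vd u u = 0" using uG by simp
  have tree: "p z \<in> C \<and> vd u z = vd u (p z) + w (par z) \<and> 0 < w (par z)" if "z \<in> C - {u}" for z
    using zC[OF that] length_pos by blast
  have path: "inj_on (vd u) C" "\<And>z a. z \<in> C - {u} \<Longrightarrow> a \<in> C \<Longrightarrow> vd u (p z) < vd u a \<Longrightarrow> vd u z \<le> vd u a"
    using monotone_tree_length[where f = "vd u" and c = "\<lambda>z. w (par z)" and p = p, OF finC uC(1) u0 tree] sum uC(2)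
    by blast+
  have "z \<in> {u, v, y1, y2}" if z: "z \<in> C" for z
  proof (rule ccontr)
    assume nz: "z \<notin> {u, v, y1, y2}"
    then have "3 \<le> vdegree G z" using deg z by (simp add: C_def)
    moreover have "vdegree G z \<le> card {e \<in> arcs G. tail G e = z \<or> head G e = z}"
    proof -
      let ?A = "{e \<in> arcs G. tail G e = z \<or> head G e = z}"
      have "tail G e \<noteq> head G e" if e: "e \<in> ?A" for e
      proof
        assume loop: "tail G e = head G e"
        have "e \<in> arcs G - N - {p1, p2}"
          using e loop nz N(4) p1 p2 unfolding pendant_def joins_def by blast
        then obtain a where "a \<in> C - {u}" "e = par a" using bij unfolding bij_betw_def by blast
        then have "joins G e (p a) a" "vd u a = vd u (p a) + w e" "0 < w e" using zC tree by auto
        then show False using loop by (auto simp: joins_def)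
      qed
      then have "(\<Sum>e\<in>arcs G. of_bool (tail G e = z) + of_bool (head G e = z)) \<le> (\<Sum>e\<in>arcs G. of_bool (e \<in> ?A) :: nat)"
        by (intro sum_mono) auto
      also have "\<dots> = (\<Sum>e\<in>?A. 1)" by (rule sum.mono_neutral_cong_right) auto
      also have "\<dots> = card ?A" by simp
      finally show ?thesis by (simp add: degree_eq_sum)
    qed
    moreover have "card {e \<in> arcs G. tail G e = z \<or> head G e = z} \<le> 2"
    proof -
      let ?B = "par ` {a \<in> C - {u}. p a = z}"
      have "{e \<in> arcs G. tail G e = z \<or> head G e = z} \<subseteq> insert (par z) ?B"
      proof
        fix e assume e: "e \<in> {e \<in> arcs G. tail G e = z \<or> head G e = z}"
        have "e \<in> arcs G - N - {p1, p2}"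
          using e nz N(4) p1 p2 z unfolding pendant_def joins_def C_def by blast
        then obtain a where a: "a \<in> C - {u}" "e = par a" using bij unfolding bij_betw_def by blast
        then have "joins G e (p a) a" using zC by blast
        then have "z = a \<or> z = p a" using e unfolding joins_def by blast
        with a show "e \<in> insert (par z) ?B" by blast
      qed
      \<comment> \<open>Two children of \<open>z\<close> would both be the next higher vertex, hence
        have the same height.\<close>
      moreover have "card {a \<in> C - {u}. p a = z} \<le> Suc 0"
      proof (subst card_le_Suc0_iff_eq)
        show "\<forall>a\<in>{a \<in> C - {u}. p a = z}. \<forall>b\<in>{a \<in> C - {u}. p a = z}. a = b"
        proof (intro ballI)
          fix a b assume ab: "a \<in> {a \<in> C - {u}. p a = z}" "b \<in> {a \<in> C - {u}. p a = z}"
          then have "vd u z < vd u a" "vd u z < vd u b" using tree[of a] tree[of b] by auto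
          then have "vd u a = vd u b" using path(2)[of a b] path(2)[of b a] ab by force
          then show "a = b" using inj_onD[OF path(1)] ab by blast
        qed
      qed (use finC in simp)
      then have "card ?B \<le> 1" using card_image_le[of "{a \<in> C - {u}. p a = z}" par] finC by simp
      moreover have "finite ?B" using finC by simp
      ultimately show ?thesis
        using card_mono[of "insert (par z) ?B" "{e \<in> arcs G. tail G e = z \<or> head G e = z}"]
          card_insert_le_m1[of 2 ?B "par z"] by (simp add: card_insert_if split: if_splits)
    qed
    ultimately show False by simp
  qed
  then have "C = {u, v, y1, y2}" using uC st(1,2) pv1(1) pv2(1) by (auto simp: C_def)
  then show ?thesis using zC bij path pN p12
    by (intro exI[of _ par] exI[of _ p]) blast
qed

end

text \<open>Deleting any leaf and applying \<open>length_bound\<close> to the rest shows its pendant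
  arc to have length at least \<open>D / 2\<close>; two leaves are at most \<open>D\<close> apart,
  so all lengths equal \<open>D / 2\<close> and all feet agree. Seen from this foot
  \<open>c\<close>, omitted arcs have height at most \<open>D / 2\<close>, since a leaf is
  \<open>D / 2\<close> farther away. Comparison with the moment of \<open>c\<close> excludes further
  vertices.\<close>

lemma many_leaf_star:
  fixes G :: "(nat, nat) pre_digraph"
  assumes "metric_graph G w" and red: "reduced G" and leaves: "3 \<le> num_leaves G" and D: "diam G w \<le> D"
    and len: "total_length G w = (real_of_int (cyc G) + real (num_leaves G) / 2) * D"
  defines "L \<equiv> {v \<in> verts G. vdegree G v = 1}"
  shows "\<exists>y p. y \<notin> L \<and> verts G = insert y L \<and> (\<forall>x\<in>L. pendant G (p x) y x \<and> w (p x) = D / 2)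
    \<and> (\<forall>e\<in>arcs G - p ` L. joins G e y y \<and> w e = D)"
proof -
  interpret metric_graph G w by fact
  have finL: "finite L" and cardL: "card L = num_leaves G" by (simp_all add: L_def num_leaves_eq)
  have LG: "x \<in> verts G" "vdegree G x = 1" if "x \<in> L" for x using that by (auto simp: L_def)
  have D0: "0 < D" using diam_pos D by simp
  obtain p y where py: "\<And>x. x \<in> L \<Longrightarrow> pendant G (p x) (y x) x"
    using ex_pendant LG by metis
  have more: "arcs G \<noteq> {p x}" if "x \<in> L" for x
  proof
    assume "arcs G = {p x}"
    then have "L \<subseteq> {x, y x}" using single_arc(1)[OF py[OF that]] by (auto simp: L_def)
    then have "card L \<le> card {x, y x}" by (intro card_mono) auto
    also have "\<dots> \<le> 2" by (simp add: card_insert_if)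
    finally show False using leaves cardL by simp
  qed
  have y3: "3 \<le> vdegree G (y x)" "y x \<in> verts G" "y x \<notin> L" if "x \<in> L" for x
    using leaf_neighbor[OF red py[OF that] more[OF that]] pendant_verts(1)[OF py[OF that]] by (auto simp: L_def)
  have half: "D / 2 \<le> w (p x)" if xL: "x \<in> L" for x
  proof -
    have p': "joins G (p x) (y x) x" "y x \<noteq> x" "\<And>a. a \<in> arcs G \<Longrightarrow> tail G a = x \<or> head G a = x \<Longrightarrow> a = p x"
      using py[OF xL] unfolding pendant_def by blast+
    note del = delete_leaf_metric_graph[OF metric_graph_axioms p' more[OF xL]]
      delete_leaf_diam[OF metric_graph_axioms p' more[OF xL]]
      delete_leaf_total_length[OF metric_graph_axioms p' more[OF xL]]
      delete_leaf_cyc[OF metric_graph_axioms p' more[OF xL]]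
      delete_leaf_degree[OF metric_graph_axioms p' more[OF xL]]
    let ?K = "delete_leaf G x (p x)"
    have "vdegree ?K v = 1 \<longleftrightarrow> vdegree G v = 1" if "v \<noteq> x" for v
      using del(5)[of v] that y3(1)[OF xL] by auto
    then have "{v \<in> verts ?K. vdegree ?K v = 1} = L - {x}" by (auto simp: L_def)
    then have leavesK: "num_leaves ?K = num_leaves G - 1"
      using xL finL cardL unfolding num_leaves_eq[of ?K] by simp
    have "total_length ?K w \<le> (real_of_int (cyc ?K) + real (num_leaves ?K) / 2) * D"
      by (rule length_bound) (use leavesK leaves del(1,2) D in auto)
    then have "total_length G w - w (p x) \<le> (k + (real (num_leaves G) - 1) / 2) * D"
      using del(3,4) leavesK leaves by (simp add: of_nat_diff)
    then show ?thesis using len by (simp add: algebra_simps diff_divide_distrib)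
  qed
  have leaf_pair: "w (p a) = D / 2 \<and> w (p b) = D / 2 \<and> y a = y b"
    if ab: "a \<in> L" "b \<in> L" "a \<noteq> b" for a b
  proof -
    have yb: "y a \<noteq> b" using y3(3)[OF ab(1)] ab(2) by blast
    have "vd a b = vd (y a) (y b) + w (p b) + w (p a)"
      using pendant_dist(2)[OF py[OF ab(1)], of b] pendant_dist(1)[OF py[OF ab(2)], of "y a"] ab LG y3 yb by simp
    moreover have "vd a b \<le> D" using vd_le_diam[of a b] ab LG D by simp
    moreover have "0 \<le> vd (y a) (y b)" using vd_nonneg y3(2) ab by simp
    moreover have "y a = y b" if "vd (y a) (y b) = 0"
      using that vd_pos[of "y a" "y b"] y3(2) ab by fastforce
    ultimately show ?thesis using half[OF ab(1)] half[OF ab(2)] by force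
  qed
  have "\<not> card L \<le> Suc 0" using leaves cardL by simp
  then obtain a b where ab: "a \<in> L" "b \<in> L" "a \<noteq> b" unfolding card_le_Suc0_iff_eq[OF finL] by blast
  define c where "c = y a"
  have c: "c \<in> verts G" "c \<notin> L" using y3 ab by (auto simp: c_def)
  have star: "pendant G (p x) c x" "w (p x) = D / 2" if "x \<in> L" for x
    using leaf_pair[OF ab(1) that] leaf_pair[OF ab(1,2,3)] py[OF that] by (cases "x = a"; force simp: c_def)+
  obtain N where "cotree c N" using ex_cotree[OF c(1)] by blast
  note N = cotreeD[OF this]
  have dL: "vd c x = D / 2" if "x \<in> L" for x
    using pendant_dist(1)[OF star(1)[OF that] c(1)] c that star(2)[OF that] by auto
  have not_pendant: "e \<noteq> p x" if e: "e \<in> N" and xL: "x \<in> L" for e x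
  proof -
    have "x \<noteq> c" using c(2) xL by blast
    then obtain e' where e': "e' \<in> arcs G - N" "tops c e' x" using N(6)[OF LG(1)[OF xL]] by blast
    then have "e' = p x" using star(1)[OF xL] unfolding pendant_def tops_def joins_def by blast
    with e' e show ?thesis by blast
  qed
  have hN: "height2 c e \<le> D" if e: "e \<in> N" for e
  proof -
    have eG: "e \<in> arcs G" using e N(1) by blast
    have "tail G e \<noteq> a" "head G e \<noteq> a" using not_pendant[OF e ab(1)] star(1)[OF ab(1)] eG unfolding pendant_def by blast+
    then have "height2 a e = height2 c e + D"
      using pendant_dist(2)[OF star(1)[OF ab(1)]] star(2)[OF ab(1)] eG by (simp add: height2_def)
    then show ?thesis using height2_le_diam[OF LG(1)[OF ab(1)] eG] D by simp
  qed
  have up: "total_length G w + moment c \<le> k * D"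
    using sum_bounded_above[of N "height2 c" D] hN N(3,4) by simp
  have mom: "moment c = (\<Sum>v\<in>verts G - L. weight v * vd c v) - real (num_leaves G) / 2 * D"
  proof -
    have "moment c = (\<Sum>v\<in>verts G - L. weight v * vd c v) + (\<Sum>v\<in>L. weight v * vd c v)"
      unfolding moment_def by (rule sum.subset_diff) (auto simp: L_def)
    also have "(\<Sum>v\<in>L. weight v * vd c v) = (\<Sum>v\<in>L. - (D / 2))"
      by (rule sum.cong) (use dL LG(2) in \<open>auto simp: weight_def\<close>)
    finally show ?thesis using cardL by simp
  qed
  have W: "1 \<le> weight v" if "v \<in> verts G - L" for v
    using that degree_pos[of v] red by (force simp: L_def reduced_def weight_def)
  have nonneg: "0 \<le> weight v * vd c v" if "v \<in> verts G - L" for v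
    using W[OF that] vd_nonneg[OF c(1), of v] that by simp
  have zero: "(\<Sum>v\<in>verts G - L. weight v * vd c v) \<le> 0"
    using up len mom by (simp add: algebra_simps)
  have only_c: "v = c" if v: "v \<in> verts G - L" for v
  proof (rule ccontr)
    assume "v \<noteq> c"
    then have "0 < weight v * vd c v" using W[OF v] vd_pos[OF c(1), of v] v by auto
    moreover have "weight v * vd c v = 0"
      by (rule sum_le_0_imp_eq_0[OF _ nonneg zero v]) simp_all
    ultimately show False by simp
  qed
  then have V: "verts G = insert c L" using c(1) by (auto simp: L_def)
  have "(\<Sum>v\<in>verts G - L. weight v * vd c v) = 0"
    using zero sum_nonneg[of "verts G - L" "\<lambda>v. weight v * vd c v"] nonneg by force
  then have "real (card N) * D \<le> (\<Sum>e\<in>N. height2 c e)"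
    using N(3,4) len mom by (simp add: algebra_simps)
  then have heq: "height2 c e = D" if "e \<in> N" for e
    using sum_eq_const_bound[of N "height2 c" D e, OF N(2) hN _ that] by blast
  have loops: "joins G e c c \<and> w e = D" if e: "e \<in> arcs G - p ` L" for e
  proof -
    have inc: "tail G e \<notin> L \<and> head G e \<notin> L" using e star(1) unfolding pendant_def by blast
    then have ends: "tail G e = c" "head G e = c"
      using V e tail_in_verts[of e] head_in_verts[of e] by auto
    then have "\<nexists>b. tops c e b" using c(1) e length_pos[of e] tops_iff[OF c(1), of e] by simp
    then have "e \<in> N" using N(5)[of e] e by blast
    from heq[OF this] show ?thesis using ends e c(1) by (simp add: joins_def height2_def)
  qed
  show ?thesis using c(2) V star loops by (intro exI[of _ c] exI[of _ p]) blast
qed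

section \<open>Medusa graphs\<close>

lemma next_point:
  assumes "finite P" "p \<in> P" "q \<in> P" "p < q"
  shows "next_point P p \<in> P" "p < next_point P p" "next_point P p \<le> q"
proof -
  let ?A = "{q \<in> P. p < q}"
  have "Min ?A \<in> ?A" using assms by (intro Min_in) auto
  then show "next_point P p \<in> P" "p < next_point P p" by (simp_all add: next_point_def)
  show "next_point P p \<le> q" unfolding next_point_def using assms by (intro Min_le) auto
qed

lemma next_point_eqI:
  assumes "finite P" "q \<in> P" "p < q" "\<And>r. r \<in> P \<Longrightarrow> p < r \<Longrightarrow> q \<le> r"
  shows "next_point P p = q"
  unfolding next_point_def using assms by (intro Min_eqI) auto

text \<open>\<open>next_point P\<close> maps \<open>P - {b}\<close> bijectively onto
  \<open>P - {a}\<close>, so the sum telescopes.\<close>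

lemma sum_next_point:
  assumes P: "finite P" "a \<in> P" "b \<in> P" "\<And>p. p \<in> P \<Longrightarrow> a \<le> p" "\<And>p. p \<in> P \<Longrightarrow> p \<le> b"
  shows "(\<Sum>p\<in>P - {b}. next_point P p - p) = b - a"
proof -
  have lt: "p < b" if "p \<in> P - {b}" for p using P(5)[of p] that by auto
  note np = next_point[OF P(1) _ P(3) lt]
  have inj: "inj_on (next_point P) (P - {b})"
  proof (rule inj_onI)
    fix p q assume pq: "p \<in> P - {b}" "q \<in> P - {b}" "next_point P p = next_point P q"
    show "p = q"
    proof (rule ccontr)
      assume "p \<noteq> q"
      then have "p < q \<or> q < p" by auto
      then show False
        using next_point(3)[OF P(1), of p q] next_point(3)[OF P(1), of q p] np(2)[of p] np(2)[of q] pq by auto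
    qed
  qed
  have sub: "next_point P ` (P - {b}) \<subseteq> P - {a}"
    using np(1,2) P(4) by fastforce
  have "card (next_point P ` (P - {b})) = card (P - {a})"
    using card_image[OF inj] P(1-3) by simp
  then have "next_point P ` (P - {b}) = P - {a}"
    using card_subset_eq[OF _ sub] P(1) by simp
  then have "(\<Sum>p\<in>P - {b}. next_point P p) = (\<Sum>p\<in>P - {a}. p)"
    using sum.reindex[OF inj, of "\<lambda>p. p"] by simp
  moreover have "sum (\<lambda>p. p) P = a + (\<Sum>p\<in>P - {a}. p)" "sum (\<lambda>p. p) P = b + (\<Sum>p\<in>P - {b}. p)"
    using sum.remove[OF P(1,2), of "\<lambda>p. p"] sum.remove[OF P(1,3), of "\<lambda>p. p"] by simp_all
  ultimately show ?thesis by (simp add: sum_subtractf)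
qed

lemma finite_pendants [simp]: "finite (pendants lam l)"
  by (simp add: pendants_def)

lemma finite_base_points [simp]: "finite (base_points D lam l a)"
  by (simp add: base_points_def)

text \<open>The parameter conditions without the number of leaves, which is obtained afterwards from
  an isometry to a graph whose leaves are known.\<close>

definition medusa_range :: "real \<Rightarrow> real \<Rightarrow> nat \<Rightarrow> (nat \<Rightarrow> real) \<Rightarrow> bool" where
  "medusa_range D lam l a \<longleftrightarrow> 0 < D \<and> 0 \<le> lam \<and> lam \<le> D / 2 \<and> (\<forall>i<l. a i \<in> {0..D - 2 * lam})"

lemma medusa_parameters_iff:
  "medusa_parameters D lam k l a \<longleftrightarrow>
     medusa_range D lam l a \<and> (0 < lam \<longrightarrow> num_leaves (medusa D lam k l a) = l)"
  by (auto simp: medusa_parameters_def medusa_range_def)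

lemma base_points_bounds:
  assumes "medusa_range D lam l a" "p \<in> base_points D lam l a"
  shows "0 \<le> p" "p \<le> D - 2 * lam"
  using assms by (auto simp: medusa_range_def base_points_def pendants_def split: if_splits)

lemma base_points_ends: "0 \<in> base_points D lam l a" "D - 2 * lam \<in> base_points D lam l a"
  by (simp_all add: base_points_def)

lemma verts_medusa: "verts (medusa D lam k l a) = Base ` base_points D lam l a \<union> Leaf ` pendants lam l"
  by (simp add: medusa_def)

lemma arcs_medusa: "arcs (medusa D lam k l a) = Base_edge ` (base_points D lam l a - {D - 2 * lam})
    \<union> Parallel ` {..<k} \<union> Pendant ` pendants lam l"
  by (simp add: medusa_def)

lemma ends_medusa [simp]:
  "tail (medusa D lam k l a) (Base_edge p) = Base p"
  "tail (medusa D lam k l a) (Parallel i) = Base 0"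
  "tail (medusa D lam k l a) (Pendant i) = Base (a i)"
  "head (medusa D lam k l a) (Base_edge p) = Base (next_point (base_points D lam l a) p)"
  "head (medusa D lam k l a) (Parallel i) = Base (D - 2 * lam)"
  "head (medusa D lam k l a) (Pendant i) = Leaf i"
  by (simp_all add: medusa_def)

lemma medusa_length_simps [simp]:
  "medusa_length D lam l a (Base_edge p) = next_point (base_points D lam l a) p - p"
  "medusa_length D lam l a (Parallel i) = D"
  "medusa_length D lam l a (Pendant i) = lam"
  by (simp_all add: medusa_length_def)

text \<open>The hypothesis \<open>ne\<close> excludes the single point, where there is no
  arc.\<close>

lemma medusa_metric_graph:
  assumes M: "medusa_range D lam l a" and ne: "lam = D / 2 \<longrightarrow> 0 < k \<or> 0 < l"
  shows "metric_graph (medusa D lam k l a) (medusa_length D lam l a)"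
proof -
  let ?P = "base_points D lam l a" and ?d = "D - 2 * lam" and ?M = "medusa D lam k l a"
  have D: "0 < D" "0 \<le> lam" "lam \<le> D / 2" using M by (auto simp: medusa_range_def)
  have lt: "p < ?d" if "p \<in> ?P - {?d}" for p
    using base_points_bounds(2)[OF M, of p] that by auto
  have aP: "a i \<in> ?P" if "i \<in> pendants lam l" for i using that by (simp add: base_points_def)
  have np: "next_point ?P p \<in> ?P" "p < next_point ?P p" if "p \<in> ?P - {?d}" for p
    using next_point(1,2)[OF finite_base_points _ base_points_ends(2) lt[OF that]] that by auto
  show ?thesis
  proof (rule metric_graphI)
    show "finite (verts ?M)" "finite (arcs ?M)" by (simp_all add: verts_medusa arcs_medusa)
    show "arcs ?M \<noteq> {}"
    proof (cases "lam = D / 2")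
      case True
      then show ?thesis using ne D by (auto simp: arcs_medusa pendants_def)
    next
      case False
      then have "0 \<in> ?P - {?d}" using D base_points_ends by auto
      then show ?thesis by (auto simp: arcs_medusa)
    qed
    show "tail ?M e \<in> verts ?M" if "e \<in> arcs ?M" for e
      using that aP base_points_ends by (auto simp: arcs_medusa verts_medusa)
    show "head ?M e \<in> verts ?M" if "e \<in> arcs ?M" for e
      using that np(1) base_points_ends by (auto simp: arcs_medusa verts_medusa)
    show "0 < medusa_length D lam l a e" if e: "e \<in> arcs ?M" for e
    proof (cases e)
      case (Base_edge p)
      then have "p \<in> ?P - {?d}" using e by (auto simp: arcs_medusa)
      from np(2)[OF this] Base_edge show ?thesis by simp
    qed (use e D in \<open>auto simp: arcs_medusa pendants_def split: if_splits\<close>)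
    fix S assume S: "S \<subseteq> verts ?M" "S \<noteq> {}"
      and cl: "\<And>e. e \<in> arcs ?M \<Longrightarrow> tail ?M e \<in> S \<longleftrightarrow> head ?M e \<in> S"
    \<comment> \<open>Induction from right to left along the base edge.\<close>
    have base: "Base p \<in> S \<longleftrightarrow> Base ?d \<in> S" if "p \<in> ?P" for p
      using that
    proof (induction "card {q \<in> ?P. p < q}" arbitrary: p rule: less_induct)
      case less
      show ?case
      proof (cases "p = ?d")
        case False
        then have p: "p \<in> ?P - {?d}" using less.prems by blast
        then have n: "next_point ?P p \<in> ?P" "p < next_point ?P p" using np by auto
        have "{q \<in> ?P. next_point ?P p < q} \<subset> {q \<in> ?P. p < q}" using n by auto
        then have "card {q \<in> ?P. next_point ?P p < q} < card {q \<in> ?P. p < q}"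
          by (intro psubset_card_mono) auto
        from less.hyps[OF this n(1)] cl[of "Base_edge p"] p show ?thesis by (simp add: arcs_medusa)
      qed simp
    qed
    have leaf: "Leaf i \<in> S \<longleftrightarrow> Base ?d \<in> S" if "i \<in> pendants lam l" for i
      using cl[of "Pendant i"] base[OF aP[OF that]] that by (simp add: arcs_medusa)
    obtain z where z: "z \<in> S" "z \<in> verts ?M" using S by blast
    then have "Base ?d \<in> S" using base leaf unfolding verts_medusa by blast
    then have "verts ?M \<subseteq> S" using base leaf unfolding verts_medusa by blast
    then show "S = verts ?M" using S by blast
  qed
qed

lemma inj_medusa [simp]: "inj_on Base A" "inj_on Leaf B" "inj_on Base_edge A" "inj_on Parallel B" "inj_on Pendant B"
  by (simp_all add: inj_on_def)

lemma medusa_cyc: "cyc (medusa D lam k l a) = int k"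
proof -
  let ?P = "base_points D lam l a" and ?d = "D - 2 * lam"
  have "card (verts (medusa D lam k l a)) = card ?P + card (pendants lam l)"
    unfolding verts_medusa by (subst card_Un_disjoint) (auto simp: card_image)
  moreover have "card (arcs (medusa D lam k l a)) = card (?P - {?d}) + k + card (pendants lam l)"
    unfolding arcs_medusa by (subst card_Un_disjoint; (subst card_Un_disjoint)?) (auto simp: card_image)
  moreover have "card ?P > 0" using base_points_ends(1)[of D lam l a] by (auto simp: card_gt_0_iff)
  ultimately show ?thesis using base_points_ends(2)[of D lam l a] by (simp add: cyc_def)
qed

lemma medusa_total_length:
  assumes M: "medusa_range D lam l a"
  shows "total_length (medusa D lam k l a) (medusa_length D lam l a)
    = D - 2 * lam + real k * D + real (card (pendants lam l)) * lam"
proof -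
  let ?P = "base_points D lam l a" and ?d = "D - 2 * lam" and ?w = "medusa_length D lam l a"
  have "sum ?w (arcs (medusa D lam k l a))
      = sum ?w (Base_edge ` (?P - {?d})) + sum ?w (Parallel ` {..<k}) + sum ?w (Pendant ` pendants lam l)"
    unfolding arcs_medusa by (subst sum.union_disjoint; (subst sum.union_disjoint)?) auto
  moreover have "sum ?w (Base_edge ` (?P - {?d})) = ?d - 0"
    unfolding sum.reindex[OF inj_medusa(3)] o_def medusa_length_simps
    by (rule sum_next_point) (use base_points_ends base_points_bounds[OF M] in auto)
  moreover have "sum ?w (Parallel ` {..<k}) = real k * D" by (simp add: sum.reindex)
  moreover have "sum ?w (Pendant ` pendants lam l) = real (card (pendants lam l)) * lam"
    by (simp add: sum.reindex)
  ultimately show ?thesis by (simp add: total_length_def)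
qed

text \<open>For \<open>k = 0\<close> the graph is a segment with two leaves, so leaves are bounded
  and not excluded; two of them still give the value 1 for the maximum in the length
  formula.\<close>

lemma num_leaves_medusa_0: "num_leaves (medusa D 0 k 0 a) \<le> 2"
proof -
  have "verts (medusa D 0 k 0 a) = {Base 0, Base D}"
    by (auto simp: verts_medusa base_points_def pendants_def)
  moreover have "num_leaves (medusa D 0 k 0 a) \<le> card (verts (medusa D 0 k 0 a))"
    unfolding num_leaves_def by (rule card_mono) (auto simp: verts_medusa)
  ultimately show ?thesis by (simp add: card_insert_if split: if_splits)
qed

lemma infinite_medusa_types:
  "infinite (UNIV :: medusa_vertex set)" "infinite (UNIV :: medusa_edge set)"
proof -
  have "infinite (range Leaf)" "infinite (range Parallel)"
    by (simp_all add: finite_image_iff)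
  then show "infinite (UNIV :: medusa_vertex set)" "infinite (UNIV :: medusa_edge set)"
    using finite_subset[OF subset_UNIV] by blast+
qed

section \<open>Recognising Medusa graphs\<close>

text \<open>Any one of the parallel arcs can serve as the base edge.\<close>

lemma (in metric_graph) is_medusa_0:
  assumes V: "u \<noteq> q" "verts G = {u, q}" and arcs: "\<forall>e\<in>arcs G. joins G e u q \<and> w e = D" and D: "0 < D"
  shows "\<exists>k. is_medusa G w D 0 k 0"
proof -
  obtain e0 where e0: "e0 \<in> arcs G" using arcs_nonempty by blast
  let ?A = "arcs G - {e0}"
  define k where "k = card ?A"
  obtain h where h: "bij_betw h ?A {0..<k}"
    using ex_bij_betw_finite_nat[of ?A] finite_arcs by (auto simp: k_def)
  let ?a = "\<lambda>_::nat. 0::real"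
  let ?M = "medusa D 0 k 0 ?a" and ?m = "medusa_length D 0 0 ?a"
  have range: "medusa_range D 0 0 ?a" using D by (simp add: medusa_range_def)
  then have par: "medusa_parameters D 0 k 0 ?a" by (simp add: medusa_parameters_iff)
  have M: "metric_graph ?M ?m" using medusa_metric_graph[OF range] D by simp
  have P: "base_points D 0 0 ?a = {0, D}" by (simp add: base_points_def pendants_def)
  have np: "next_point {0, D} 0 = D" using D by (intro next_point_eqI) auto
  define \<phi> where "\<phi> v = (if v = u then Base 0 else Base D)" for v
  define \<psi> where "\<psi> e = (if e = e0 then Base_edge 0 else Parallel (h e))" for e
  have vM: "verts ?M = {Base 0, Base D}" by (simp add: verts_medusa P pendants_def)
  have aM: "arcs ?M = insert (Base_edge 0) (Parallel ` {..<k})"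
    using D by (auto simp: arcs_medusa P pendants_def)
  have \<phi>: "bij_betw \<phi> (verts G) (verts ?M)"
    using V D by (auto simp: bij_betw_def vM \<phi>_def)
  have \<psi>: "bij_betw \<psi> (arcs G) (arcs ?M)"
    unfolding bij_betw_def
  proof
    show "inj_on \<psi> (arcs G)"
      using h by (auto simp: inj_on_def \<psi>_def bij_betw_def)
    have "\<psi> ` arcs G = insert (\<psi> e0) (\<psi> ` ?A)" using e0 by blast
    also have "\<psi> ` ?A = Parallel ` h ` ?A" unfolding image_image by (rule image_cong) (simp_all add: \<psi>_def)
    also have "h ` ?A = {..<k}" using h by (simp add: bij_betw_def atLeast0LessThan)
    finally show "\<psi> ` arcs G = arcs ?M" by (simp add: aM \<psi>_def)
  qed
  have len: "?m (\<psi> e) = w e" if "e \<in> arcs G" for e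
    using arcs that by (auto simp: \<psi>_def P np)
  have ends: "joins ?M (\<psi> e) (\<phi> (tail G e)) (\<phi> (head G e))" if e: "e \<in> arcs G" for e
  proof -
    have "\<psi> e \<in> arcs ?M" using \<psi> e by (auto simp: bij_betw_def)
    moreover have "tail G e = u \<and> head G e = q \<or> tail G e = q \<and> head G e = u"
      using arcs e by (auto simp: joins_def)
    ultimately show ?thesis
      using V(1) by (auto simp: joins_def \<phi>_def \<psi>_def P np)
  qed
  obtain f where "isometry_map G w ?M ?m f"
    using relabel_isometry[OF metric_graph_axioms M \<phi> \<psi> len ends] by blast
  then have "isometric G w ?M ?m" using isometric_iff by blast
  with par show ?thesis unfolding is_medusa_def by blast
qed

text \<open>For \<open>lam = D / 2\<close> the base edge is the single point \<open>Base 0\<close>;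
  all attachment points are \<open>0\<close>, and the arcs that are not pendant become
  loops.\<close>

lemma is_medusa_half:
  fixes G :: "(nat, nat) pre_digraph"
  assumes G: "metric_graph G w"
    and V: "y \<notin> L" "verts G = insert y L" and L: "finite L" "L \<noteq> {}"
    and leaves: "num_leaves G = card L"
    and pend: "\<forall>x\<in>L. pendant G (p x) y x \<and> w (p x) = D / 2"
    and loops: "\<forall>e\<in>arcs G - p ` L. joins G e y y \<and> w e = D" and D: "0 < D"
  shows "\<exists>k. is_medusa G w D (D / 2) k (card L)"
proof -
  interpret metric_graph G w by fact
  let ?B = "arcs G - p ` L" and ?l = "card L"
  define k where "k = card ?B"
  obtain h where h: "bij_betw h ?B {0..<k}"
    using ex_bij_betw_finite_nat[of ?B] finite_arcs by (auto simp: k_def)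
  obtain i where i: "bij_betw i L {0..<?l}"
    using ex_bij_betw_finite_nat[OF L(1)] by blast
  have pA: "p x \<in> arcs G" "joins G (p x) y x" if "x \<in> L" for x
  proof -
    have "pendant G (p x) y x" using pend that by blast
    then show "joins G (p x) y x" by (simp add: pendant_def)
    then show "p x \<in> arcs G" by (rule joins_arc)
  qed
  have injp: "inj_on p L"
  proof (rule inj_onI)
    fix a b assume ab: "a \<in> L" "b \<in> L" "p a = p b"
    then show "a = b" using pA(2)[OF ab(1)] pA(2)[OF ab(2)] V(1) unfolding joins_def by metis
  qed
  let ?a = "\<lambda>_::nat. 0::real"
  let ?M = "medusa D (D / 2) k ?l ?a" and ?m = "medusa_length D (D / 2) ?l ?a"
  have pend_l: "pendants (D / 2) ?l = {..<?l}" using D by (simp add: pendants_def)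
  have P: "base_points D (D / 2) ?l ?a = {0}" by (auto simp: base_points_def)
  have vM: "verts ?M = insert (Base 0) (Leaf ` {..<?l})" by (simp add: verts_medusa P pend_l)
  have aM: "arcs ?M = Parallel ` {..<k} \<union> Pendant ` {..<?l}" by (simp add: arcs_medusa P pend_l)
  have l0: "0 < ?l" using L by (simp add: card_gt_0_iff)
  have range: "medusa_range D (D / 2) ?l ?a" using D by (simp add: medusa_range_def)
  have M: "metric_graph ?M ?m" using medusa_metric_graph[OF range] l0 by simp
  define q where "q e = inv_into L p e" for e
  have q: "q (p x) = x" if "x \<in> L" for x using injp that by (simp add: q_def)
  define \<phi> where "\<phi> v = (if v = y then Base 0 else Leaf (i v))" for v
  define \<psi> where "\<psi> e = (if e \<in> p ` L then Pendant (i (q e)) else Parallel (h e))" for e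
  have \<phi>: "bij_betw \<phi> (verts G) (verts ?M)"
    unfolding bij_betw_def
  proof
    show "inj_on \<phi> (verts G)" using i V by (auto simp: inj_on_def \<phi>_def bij_betw_def)
    have "\<phi> ` L = Leaf ` i ` L" unfolding image_image by (rule image_cong) (use V in \<open>auto simp: \<phi>_def\<close>)
    also have "i ` L = {..<?l}" using i by (simp add: bij_betw_def atLeast0LessThan)
    finally show "\<phi> ` verts G = verts ?M" by (simp add: V vM \<phi>_def)
  qed
  have \<psi>p: "\<psi> (p x) = Pendant (i x)" if "x \<in> L" for x using that q by (simp add: \<psi>_def)
  have \<psi>h: "\<psi> e = Parallel (h e)" if "e \<in> ?B" for e using that by (simp add: \<psi>_def)
  have split: "arcs G = ?B \<union> p ` L" using pA by blast
  have \<psi>: "bij_betw \<psi> (arcs G) (arcs ?M)"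
  proof -
    have "bij_betw \<psi> ?B (Parallel ` {..<k})"
    proof -
      have "bij_betw (Parallel \<circ> h) ?B (Parallel ` {..<k})"
        using bij_betw_trans[OF h, of Parallel "Parallel ` {..<k}"]
        by (simp add: bij_betw_def atLeast0LessThan)
      then show ?thesis by (rule bij_betw_cong[THEN iffD1, rotated]) (simp add: \<psi>h)
    qed
    moreover have "bij_betw \<psi> (p ` L) (Pendant ` {..<?l})"
    proof -
      have "bij_betw (Pendant \<circ> i) L (Pendant ` {..<?l})"
        using bij_betw_trans[OF i, of Pendant "Pendant ` {..<?l}"]
        by (simp add: bij_betw_def atLeast0LessThan)
      then have "bij_betw (\<psi> \<circ> p) L (Pendant ` {..<?l})"
        by (rule bij_betw_cong[THEN iffD1, rotated]) (simp add: \<psi>p)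
      then show ?thesis using bij_betw_comp_iff[of p L "p ` L" \<psi>] injp by (simp add: bij_betw_def)
    qed
    moreover have "Parallel ` {..<k} \<inter> Pendant ` {..<?l} = {}" by blast
    ultimately have "bij_betw \<psi> (?B \<union> p ` L) (Parallel ` {..<k} \<union> Pendant ` {..<?l})"
      by (rule bij_betw_combine)
    then show ?thesis using split aM by simp
  qed
  have cases: "e \<in> ?B \<or> (\<exists>x\<in>L. e = p x)" if "e \<in> arcs G" for e using that by blast
  have len: "?m (\<psi> e) = w e" if "e \<in> arcs G" for e
    using cases[OF that] \<psi>p \<psi>h pend loops by auto
  have ends: "joins ?M (\<psi> e) (\<phi> (tail G e)) (\<phi> (head G e))" if e: "e \<in> arcs G" for e
  proof -
    have \<psi>M: "\<psi> e \<in> arcs ?M" using \<psi> e by (auto simp: bij_betw_def)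
    from cases[OF e] show ?thesis
    proof
      assume eB: "e \<in> ?B"
      then have "tail G e = y" "head G e = y" using loops by (auto simp: joins_def)
      then show ?thesis using \<psi>M \<psi>h[OF eB] by (simp add: joins_def \<phi>_def)
    next
      assume "\<exists>x\<in>L. e = p x"
      then obtain x where x: "x \<in> L" "e = p x" by blast
      have "x \<noteq> y" using x(1) V(1) by blast
      then show ?thesis using \<psi>M \<psi>p[OF x(1)] pA(2)[OF x(1)] x(2) by (auto simp: joins_def \<phi>_def)
    qed
  qed
  obtain f where "isometry_map G w ?M ?m f"
    using relabel_isometry[OF G M \<phi> \<psi> len ends] by blast
  then have iso: "isometric G w ?M ?m" using isometric_iff by blast
  have "num_leaves ?M = ?l"
    using isometric_num_leaves[OF G M iso] infinite_medusa_types leaves by simp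
  then have "medusa_parameters D (D / 2) k ?l ?a" using range by (simp add: medusa_parameters_iff)
  with iso show ?thesis unfolding is_medusa_def by blast
qed

lemma joins_relabel:
  assumes "joins G e a b" "joins H e' (\<phi> a) (\<phi> b)"
  shows "joins H e' (\<phi> (tail G e)) (\<phi> (head G e))"
  using assms joins_commute[of H e' "\<phi> a" "\<phi> b"] by (auto simp: joins_def[of G])

text \<open>The path is laid out on the base edge by placing each vertex at its distance from
  \<open>u\<close>; the pendant arcs are attached at the positions of \<open>y1\<close> and
  \<open>y2\<close>, and \<open>lam\<close> is their common length.\<close>

lemma is_medusa_two_leaves:
  fixes G :: "(nat, nat) pre_digraph"
  assumes G: "metric_graph G w"
    and p1: "pendant G p1 y1 x1" and p2: "pendant G p2 y2 x2" and x: "x1 \<noteq> x2" "vdegree G x1 = 1" "vdegree G x2 = 1"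
    and uv: "u \<in> verts G - {x1, x2}" "v \<in> verts G - {x1, x2}" "2 \<le> vdegree G u" "2 \<le> vdegree G v"
    and deg: "\<forall>z\<in>verts G - {x1, x2}. z \<noteq> u \<longrightarrow> z \<noteq> v \<longrightarrow> 3 \<le> vdegree G z"
    and N: "N \<subseteq> arcs G" "real (card N) = real_of_int (cyc G)" "1 \<le> real_of_int (cyc G)" "\<forall>a\<in>N. joins G a u v \<and> w a = D"
    and D: "diam G w \<le> D" and len: "total_length G w = (real_of_int (cyc G) + 1) * D"
  shows "\<exists>lam k. 0 < lam \<and> lam \<le> D / 2 \<and> is_medusa G w D lam k 2"
proof -
  interpret metric_graph G w by fact
  note st = two_leaf_structure[OF p1 p2 x uv deg N D len]
  note pv1 = pendant_verts[OF p1] and pv2 = pendant_verts[OF p2]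
  define C where "C = verts G - {x1, x2}"
  define f where "f = vd u"
  obtain par p where tree: "\<forall>z\<in>C - {u}. joins G (par z) (p z) z \<and> p z \<in> C \<and> f z = f (p z) + w (par z)
        \<and> (\<forall>a\<in>C. f (p z) < f a \<longrightarrow> f z \<le> f a)"
    and bij: "bij_betw par (C - {u}) (arcs G - N - {p1, p2})" and inj: "inj_on f C" and C: "C = {u, v, y1, y2}"
    and pN: "p1 \<in> arcs G - N" "p2 \<in> arcs G - N" "p1 \<noteq> p2"
    using two_leaf_path[OF p1 p2 x uv deg N D len] unfolding C_def f_def by blast
  define lam where "lam = w p1"
  define d where "d = D - 2 * lam"
  have lam: "0 < lam" "w p2 = lam" using pv1(5) st(3,4) by (simp_all add: lam_def)
  have fv: "f v = d" using st(3) by (simp add: f_def d_def lam_def)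
  have fu: "f u = 0" using uv by (simp add: f_def)
  have f_range: "0 \<le> f z" "f z \<le> d" if "z \<in> C" for z
    using st(5)[of z] that fv vd_nonneg[of u z] vd_nonneg[of v z] uv by (auto simp: f_def C_def)
  have uC: "u \<in> C" "v \<in> C" "y1 \<in> C" "y2 \<in> C" using C by auto
  have lam2: "lam \<le> D / 2" "0 < D" using f_range[OF uC(2)] fv diam_pos D by (simp_all add: d_def)
  have finC: "finite C" by (simp add: C_def)
  have step: "f (p z) < f z" if "z \<in> C - {u}" for z
  proof -
    have "joins G (par z) (p z) z" "f z = f (p z) + w (par z)" using tree that by blast+
    then show ?thesis using length_pos[OF joins_arc] by simp
  qed
  define n where "n = card N"
  obtain h where h: "bij_betw h N {0..<n}"
    using ex_bij_betw_finite_nat[of N] finite_subset[OF N(1) finite_arcs] by (auto simp: n_def)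
  define a where "a i = (if i = 0 then f y1 else f y2)" for i :: nat
  let ?M = "medusa D lam n 2 a" and ?m = "medusa_length D lam 2 a" and ?P = "base_points D lam 2 a"
  have range: "medusa_range D lam 2 a"
    using lam lam2 f_range[OF uC(3)] f_range[OF uC(4)] by (auto simp: medusa_range_def a_def d_def)
  have pend: "pendants lam 2 = {0, 1}" using lam by (auto simp: pendants_def)
  have P: "?P = f ` C" using C fu fv by (auto simp: base_points_def pend a_def d_def)
  have M: "metric_graph ?M ?m" using medusa_metric_graph[OF range] by simp
  have vM: "verts ?M = Base ` f ` C \<union> {Leaf 0, Leaf 1}" by (simp add: verts_medusa P pend)
  have aM: "arcs ?M = Base_edge ` (f ` C - {d}) \<union> Parallel ` {..<n} \<union> {Pendant 0, Pendant 1}"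
    by (simp add: arcs_medusa P pend d_def)
  have np: "next_point (f ` C) (f (p z)) = f z" if z: "z \<in> C - {u}" for z
  proof (rule next_point_eqI)
    show "finite (f ` C)" using finC by simp
    show "f z \<in> f ` C" using z by blast
    show "f (p z) < f z" by (rule step[OF z])
    have t: "\<forall>a\<in>C. f (p z) < f a \<longrightarrow> f z \<le> f a" using bspec[OF tree z] by blast
    show "f z \<le> r" if "r \<in> f ` C" "f (p z) < r" for r using t that by blast
  qed
  define \<phi> where "\<phi> z = (if z = x1 then Leaf 0 else if z = x2 then Leaf 1 else Base (f z))" for z
  define q where "q = inv_into (C - {u}) par"
  have q: "q (par z) = z" if "z \<in> C - {u}" for z
    using bij that by (simp add: q_def bij_betw_def)
  \<comment> \<open>Path arcs are indexed by their upper vertex, base edges of the Medusa graph by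
    their lower end; hence the parent \<open>p\<close> in the name.\<close>
  define \<psi> where "\<psi> e = (if e = p1 then Pendant 0 else if e = p2 then Pendant 1
    else if e \<in> N then Parallel (h e) else Base_edge (f (p (q e))))" for e
  have \<psi>1: "\<psi> p1 = Pendant 0" "\<psi> p2 = Pendant 1" using pN(3) by (simp_all add: \<psi>_def)
  have \<psi>N: "\<psi> e = Parallel (h e)" if "e \<in> N" for e using that pN by (auto simp: \<psi>_def)
  have \<psi>p: "\<psi> (par z) = Base_edge (f (p z))" if z: "z \<in> C - {u}" for z
  proof -
    have "par z \<in> arcs G - N - {p1, p2}" using bij z by (auto simp: bij_betw_def)
    then show ?thesis using q[OF z] by (simp add: \<psi>_def)
  qed
  have \<phi>C: "\<phi> z = Base (f z)" if "z \<in> C" for z using that by (simp add: \<phi>_def C_def)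
  have VG: "verts G = C \<union> {x1, x2}" using pv1(2) pv2(2) by (auto simp: C_def)
  have \<phi>: "bij_betw \<phi> (verts G) (verts ?M)"
  proof -
    have "bij_betw (Base \<circ> f) C (Base ` f ` C)"
      using bij_betw_trans[OF inj_on_imp_bij_betw[OF inj] inj_on_imp_bij_betw[OF inj_medusa(1)]] .
    then have 1: "bij_betw \<phi> C (Base ` f ` C)"
      by (rule bij_betw_cong[THEN iffD1, rotated]) (simp add: \<phi>C)
    have 2: "bij_betw \<phi> {x1, x2} {Leaf 0, Leaf 1}"
      using x(1) by (auto simp: bij_betw_def \<phi>_def)
    show ?thesis unfolding VG vM by (rule bij_betw_combine[OF 1 2]) auto
  qed
  have AG: "arcs G = (arcs G - N - {p1, p2}) \<union> N \<union> {p1, p2}" using pN N(1) by blast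
  have \<psi>: "bij_betw \<psi> (arcs G) (arcs ?M)"
  proof -
    let ?g = "\<lambda>z. Base_edge (f (p z))"
    have inj_g: "inj_on ?g (C - {u})"
    proof (rule inj_onI)
      fix b c assume bc: "b \<in> C - {u}" "c \<in> C - {u}" "?g b = ?g c"
      then have "f (p b) < f c" "f (p c) < f b" using step[of b] step[of c] by auto
      then have "f b = f c" using tree bc by (intro antisym) blast+
      then show "b = c" using inj bc by (auto dest: inj_onD)
    qed
    have sub: "?g ` (C - {u}) \<subseteq> Base_edge ` (f ` C - {d})"
    proof
      fix e assume "e \<in> ?g ` (C - {u})"
      then obtain z where z: "z \<in> C - {u}" "e = ?g z" by blast
      then have "f (p z) < d" using step[OF z(1)] f_range(2)[of z] by auto
      moreover have "p z \<in> C" using tree z(1) by blast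
      ultimately show "e \<in> Base_edge ` (f ` C - {d})" using z(2) by auto
    qed
    \<comment> \<open>Surjectivity by counting: there is one path arc for each vertex except
      \<open>u\<close> and one base edge for each position except \<open>d\<close>.\<close>
    have "card (f ` C - {d}) = card (C - {u})"
      using card_image[OF inj] uC fv finC by (metis card_Diff_singleton imageI)
    then have "card (?g ` (C - {u})) = card (Base_edge ` (f ` C - {d}))"
      using card_image[OF inj_g] by (simp add: card_image)
    then have img: "?g ` (C - {u}) = Base_edge ` (f ` C - {d})"
      using card_subset_eq[OF _ sub] finC by simp
    have "bij_betw (\<psi> \<circ> par) (C - {u}) (Base_edge ` (f ` C - {d}))"
      using inj_g img by (subst bij_betw_cong[of _ _ ?g]) (simp_all add: \<psi>p bij_betw_def)
    then have 1: "bij_betw \<psi> (arcs G - N - {p1, p2}) (Base_edge ` (f ` C - {d}))"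
      using bij_betw_comp_iff[OF bij] by blast
    have "bij_betw (Parallel \<circ> h) N (Parallel ` {..<n})"
      using bij_betw_trans[OF h, of Parallel "Parallel ` {..<n}"] by (simp add: bij_betw_def atLeast0LessThan)
    then have 2: "bij_betw \<psi> N (Parallel ` {..<n})"
      by (rule bij_betw_cong[THEN iffD1, rotated]) (simp add: \<psi>N)
    have 3: "bij_betw \<psi> {p1, p2} {Pendant 0, Pendant 1}"
      using pN(3) \<psi>1 by (auto simp: bij_betw_def)
    have 12: "bij_betw \<psi> ((arcs G - N - {p1, p2}) \<union> N) (Base_edge ` (f ` C - {d}) \<union> Parallel ` {..<n})"
      by (rule bij_betw_combine[OF 1 2]) auto
    have "bij_betw \<psi> ((arcs G - N - {p1, p2}) \<union> N \<union> {p1, p2})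
      (Base_edge ` (f ` C - {d}) \<union> Parallel ` {..<n} \<union> {Pendant 0, Pendant 1})"
      by (rule bij_betw_combine[OF 12 3]) auto
    then show ?thesis unfolding aM using AG by simp
  qed
  have cases: "e = p1 \<or> e = p2 \<or> e \<in> N \<or> (\<exists>z\<in>C - {u}. e = par z)" if "e \<in> arcs G" for e
    using that bij unfolding bij_betw_def by blast
  have len_e: "?m (\<psi> e) = w e" if "e \<in> arcs G" for e
    using cases[OF that]
  proof (elim disjE bexE)
    fix z assume z: "z \<in> C - {u}" "e = par z"
    then show ?thesis using np[OF z(1)] tree by (simp add: \<psi>p P)
  qed (use \<psi>1 \<psi>N N(4) lam in \<open>auto simp: lam_def\<close>)
  have ends: "joins ?M (\<psi> e) (\<phi> (tail G e)) (\<phi> (head G e))" if e: "e \<in> arcs G" for e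
  proof -
    have \<psi>M: "\<psi> e \<in> arcs ?M" using \<psi> e by (auto simp: bij_betw_def)
    have \<phi>x: "\<phi> x1 = Leaf 0" "\<phi> x2 = Leaf 1" using x(1) by (simp_all add: \<phi>_def)
    from cases[OF e] show ?thesis
    proof (elim disjE bexE)
      assume e1: "e = p1"
      have "joins G e y1 x1" using p1 e1 by (simp add: pendant_def)
      then show ?thesis
        by (rule joins_relabel) (use \<psi>M e1 \<psi>1 \<phi>x \<phi>C[OF uC(3)] in \<open>simp add: joins_def a_def\<close>)
    next
      assume e2: "e = p2"
      have "joins G e y2 x2" using p2 e2 by (simp add: pendant_def)
      then show ?thesis
        by (rule joins_relabel) (use \<psi>M e2 \<psi>1 \<phi>x \<phi>C[OF uC(4)] in \<open>simp add: joins_def a_def\<close>)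
    next
      assume eN: "e \<in> N"
      then have "joins G e u v" using N(4) by blast
      then show ?thesis
        by (rule joins_relabel) (use \<psi>M \<psi>N[OF eN] \<phi>C[OF uC(1)] \<phi>C[OF uC(2)] fu fv in \<open>simp add: joins_def d_def\<close>)
    next
      fix z assume z: "z \<in> C - {u}" "e = par z"
      then have "joins G e (p z) z" "p z \<in> C" using tree by blast+
      then show ?thesis
        by (intro joins_relabel[of G e "p z" z])
          (use \<psi>M z \<psi>p[OF z(1)] \<phi>C np[OF z(1)] in \<open>simp_all add: joins_def P\<close>)
    qed
  qed
  obtain g where "isometry_map G w ?M ?m g"
    using relabel_isometry[OF G M \<phi> \<psi> len_e ends] by blast
  then have iso: "isometric G w ?M ?m" using isometric_iff by blast
  have "num_leaves G = 2"
  proof -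
    have "vdegree G z \<noteq> 1" if "z \<in> C" for z
    proof (cases "z = u \<or> z = v")
      case True
      then show ?thesis using uv(3,4) by auto
    next
      case False
      then have "3 \<le> vdegree G z" using deg that by (auto simp: C_def)
      then show ?thesis by simp
    qed
    then have "{z \<in> verts G. vdegree G z = 1} = {x1, x2}" using VG x(2,3) by auto
    then show ?thesis using x(1) by (simp add: num_leaves_eq)
  qed
  then have "num_leaves ?M = 2"
    using isometric_num_leaves[OF G M iso] infinite_medusa_types by simp
  with range have "medusa_parameters D lam n 2 a" by (simp add: medusa_parameters_iff)
  with iso have "is_medusa G w D lam n 2" unfolding is_medusa_def by blast
  then show ?thesis using lam(1) lam2(1) by blast
qed

section \<open>The extremal graphs\<close>

lemma is_medusa_isometric:
  "isometric G w H w' \<Longrightarrow> is_medusa H w' D lam k l \<Longrightarrow> is_medusa G w D lam k l"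
  unfolding is_medusa_def using isometric_trans by blast

text \<open>For \<open>k = 1\<close> the arc found may be longer than the diameter. It is then cut
  at distance \<open>diam G w\<close> from its tail: the first piece becomes the parallel edge and
  the rest belongs to the base edge, with the new vertex as one end.\<close>

lemma extremal_two_leaves:
  fixes G :: "(nat, nat) pre_digraph"
  assumes G: "metric_graph G w" and red: "reduced G" and two: "num_leaves G = 2"
    and more: "\<nexists>p y x. pendant G p y x \<and> arcs G = {p}"
    and len: "total_length G w = (real_of_int (cyc G) + 1) * diam G w"
  shows "\<exists>lam k. 0 < lam \<and> lam \<le> diam G w / 2 \<and> is_medusa G w (diam G w) lam k 2"
proof -
  interpret metric_graph G w by fact
  obtain x1 x2 p1 p2 y1 y2 where x: "x1 \<noteq> x2" "pendant G p1 y1 x1" "pendant G p2 y2 x2"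
    "vdegree G x1 = 1" "vdegree G x2 = 1" "w p2 \<le> w p1"
    "\<forall>v\<in>verts G. vdegree G v = 1 \<longrightarrow> v = x1 \<or> v = x2"
    using leaves_two[OF two] by blast
  have "arcs G \<noteq> {p2}" using more x(3) by blast
  note par = two_leaf_parallel[OF infinite_UNIV_nat infinite_UNIV_nat red this x(2,3,1,4) bspec[OF x(7), THEN mp] x(6) order_refl len]
  have deg: "3 \<le> vdegree G z" if "z \<in> verts G - {x1, x2}" for z
    using that x(7) degree_pos[of z] red by (force simp: reduced_def)
  show ?thesis
  proof (cases "cyc G = 1")
    case False
    have "1 \<le> real_of_int (cyc G)" using par(1) by blast
    then have "2 \<le> cyc G" using False by simp
    then have "2 \<le> k" by simp
    then obtain N u v where N: "N \<subseteq> arcs G" "real (card N) = k" "\<forall>a\<in>N. joins G a u v \<and> w a = diam G w"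
      "u \<notin> {x1, x2}" "v \<notin> {x1, x2}"
      using par(2) by blast
    have "N \<noteq> {}" using N(2) \<open>2 \<le> k\<close> by auto
    then have "u \<in> verts G" "v \<in> verts G" using N(3) joins_verts by blast+
    then have uv: "u \<in> verts G - {x1, x2}" "v \<in> verts G - {x1, x2}" using N(4,5) by blast+
    have uv2: "2 \<le> vdegree G u" "2 \<le> vdegree G v" using deg[OF uv(1)] deg[OF uv(2)] by simp_all
    have deg': "\<forall>z\<in>verts G - {x1, x2}. z \<noteq> u \<longrightarrow> z \<noteq> v \<longrightarrow> 3 \<le> vdegree G z" using deg by blast
    have "1 \<le> k" using \<open>2 \<le> k\<close> by simp
    from is_medusa_two_leaves[OF G x(2,3,1,4,5) uv uv2 deg' N(1,2) this N(3) order_refl len]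
    show ?thesis .
  next
    case True
    then have k1: "k = 1" by simp
    then obtain e where e: "e \<in> arcs G" "diam G w \<le> w e" "tail G e \<notin> {x1, x2}" "head G e \<notin> {x1, x2}"
      using par(3) by blast
    have uG: "tail G e \<in> verts G - {x1, x2}" "head G e \<in> verts G - {x1, x2}" using e by auto
    show ?thesis
    proof (cases "w e = diam G w")
      case True
      have uv2: "2 \<le> vdegree G (tail G e)" "2 \<le> vdegree G (head G e)" using deg[OF uG(1)] deg[OF uG(2)] by simp_all
      have deg': "\<forall>z\<in>verts G - {x1, x2}. z \<noteq> tail G e \<longrightarrow> z \<noteq> head G e \<longrightarrow> 3 \<le> vdegree G z" using deg by blast
      have N: "{e} \<subseteq> arcs G" "real (card {e}) = k" "1 \<le> k"
        "\<forall>a\<in>{e}. joins G a (tail G e) (head G e) \<and> w a = diam G w"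
        using e(1) k1 True joins_ends[OF e(1)] by simp_all
      from is_medusa_two_leaves[OF G x(2,3,1,4,5) uG uv2 deg' N order_refl len]
      show ?thesis .
    next
      case False
      then have s: "0 < diam G w" "diam G w < w e" using e(2) diam_pos by auto
      obtain v' e' where "splits_at e (diam G w) v' e'"
        using ex_splits_at[OF e(1) s infinite_UNIV_nat infinite_UNIV_nat] by blast
      note K = splits_atD[OF this]
      let ?K = "split_arc G e v' e'" and ?k = "split_length w e (diam G w) e'"
      interpret K: metric_graph ?K ?k by fact
      have vK: "verts ?K = insert v' (verts G)" and aK: "e \<in> arcs ?K" "e \<noteq> e'"
        using e(1) K(2) by (auto simp: split_arc_def)
      have xG: "x1 \<in> verts G" "x2 \<in> verts G" using pendant_verts(2) x(2,3) by blast+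
      have xK: "x1 \<in> verts ?K" "x2 \<in> verts ?K" "vdegree ?K x1 = 1" "vdegree ?K x2 = 1"
        using xG vK K(7) x(4,5) by auto
      obtain q1 z1 where q1: "pendant ?K q1 z1 x1" using K.ex_pendant[OF xK(1,3)] by blast
      obtain q2 z2 where q2: "pendant ?K q2 z2 x2" using K.ex_pendant[OF xK(2,4)] by blast
      have dK: "diam ?K ?k = diam G w" using isometric_diam[OF K(4)] .
      have v'x: "v' \<notin> {x1, x2}" using xG K(1) by auto
      have uv: "tail G e \<in> verts ?K - {x1, x2}" "v' \<in> verts ?K - {x1, x2}"
        "2 \<le> vdegree ?K (tail G e)" "2 \<le> vdegree ?K v'"
        using uG vK v'x K(7)[of "tail G e"] K(8) deg[OF uG(1)] by auto
      have deg': "\<forall>z\<in>verts ?K - {x1, x2}. z \<noteq> tail G e \<longrightarrow> z \<noteq> v' \<longrightarrow> 3 \<le> vdegree ?K z"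
        using deg K(7) vK by auto
      have N: "{e} \<subseteq> arcs ?K" "real (card {e}) = K.k" "1 \<le> K.k"
        "\<forall>a\<in>{e}. joins ?K a (tail G e) v' \<and> ?k a = diam G w"
        using aK K(9) k1 by (auto simp: joins_def split_arc_def split_length_def)
      have lenK: "total_length ?K ?k = (K.k + 1) * diam G w" using K(9,10) len by simp
      have "\<exists>lam k. 0 < lam \<and> lam \<le> diam G w / 2 \<and> is_medusa ?K ?k (diam G w) lam k 2"
        by (rule is_medusa_two_leaves[OF K(3) q1 q2 x(1) xK(3,4) uv deg' N _ lenK]) (simp add: dK)
      then show ?thesis using is_medusa_isometric[OF K(4)] by blast
    qed
  qed
qed

text \<open>A circle of length \<open>2 * diam G w\<close>, cut into halves, consists of two
  parallel arcs: one is the base edge, the other the only parallel edge.\<close>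

lemma extremal_loop:
  fixes G :: "(nat, nat) pre_digraph"
  assumes G: "metric_graph G w" and loop: "verts G = {v}" "arcs G = {e}"
    and len: "w e = 2 * diam G w"
  shows "\<exists>k. is_medusa G w (diam G w) 0 k 0"
proof -
  interpret metric_graph G w by fact
  have e: "e \<in> arcs G" "tail G e = v" "head G e = v" using loop tail_in_verts[of e] head_in_verts[of e] by auto
  obtain v' e' where "splits_at e (diam G w) v' e'"
    using ex_splits_at[OF e(1) _ _ infinite_UNIV_nat infinite_UNIV_nat] diam_pos len by fastforce
  note K = splits_atD[OF this]
  let ?K = "split_arc G e v' e'" and ?k = "split_length w e (diam G w) e'"
  interpret K: metric_graph ?K ?k by fact
  have ne: "v \<noteq> v'" "e \<noteq> e'" using K(1,2) loop by auto
  have "\<exists>k. is_medusa ?K ?k (diam G w) 0 k 0"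
  proof (rule K.is_medusa_0[OF ne(1)])
    show "verts ?K = {v, v'}" using loop by (auto simp: split_arc_def)
    show "\<forall>a\<in>arcs ?K. joins ?K a v v' \<and> ?k a = diam G w"
      using loop e len ne by (auto simp: split_arc_def split_length_def joins_def)
  qed (rule diam_pos)
  then show ?thesis using is_medusa_isometric[OF K(4)] by blast
qed

lemma extremal_is_medusa:
  fixes G :: "(nat, nat) pre_digraph"
  assumes "metric_graph G w"
    and "total_length G w = (real_of_int (cyc G) + max 1 (real (num_leaves G) / 2)) * diam G w"
  shows "(\<exists>k. is_medusa G w (diam G w) 0 k 0)
    \<or> (\<exists>lam k. 0 < lam \<and> lam < diam G w / 2 \<and> is_medusa G w (diam G w) lam k 2)
    \<or> (\<exists>k l. 2 \<le> l \<and> is_medusa G w (diam G w) (diam G w / 2) k l)"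
proof -
  obtain H :: "(nat, nat) pre_digraph" and h where H: "metric_graph H h" "isometric G w H h"
    "reduced H \<or> (\<exists>v e. verts H = {v} \<and> arcs H = {e})" "diam H h = diam G w"
    "total_length H h = total_length G w" "cyc H = cyc G" "num_leaves H = num_leaves G"
    using isometric_reduced_model[OF assms(1)] by blast
  interpret H: metric_graph H h by (rule H(1))
  have len: "total_length H h = (H.k + max 1 (real (num_leaves H) / 2)) * diam H h"
    using assms(2) H(4-7) by simp
  have D: "0 < diam H h" by (rule H.diam_pos)
  have degree1: "v \<in> verts H \<Longrightarrow> 1 \<le> vdegree H v" for v by (rule H.degree_pos)
  have "(\<exists>k. is_medusa H h (diam H h) 0 k 0)
    \<or> (\<exists>lam k. 0 < lam \<and> lam < diam H h / 2 \<and> is_medusa H h (diam H h) lam k 2)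
    \<or> (\<exists>k l. 2 \<le> l \<and> is_medusa H h (diam H h) (diam H h / 2) k l)"
  proof (cases "reduced H")
    case False
    then obtain v e where loop: "verts H = {v}" "arcs H = {e}" using H(3) by blast
    have "num_leaves H \<le> card {v}"
      unfolding num_leaves_eq using loop by (intro card_mono) auto
    moreover have "cyc H = 1" "total_length H h = h e" using loop by (simp_all add: cyc_def total_length_def)
    ultimately have "h e = 2 * diam H h" using len by simp
    from extremal_loop[OF H(1) loop this] show ?thesis by blast
  next
    case red: True
    have three: "3 \<le> vdegree H v" if "v \<in> verts H" "vdegree H v \<noteq> 1" for v
      using degree1[OF that(1)] that red by (force simp: reduced_def)
    consider "num_leaves H = 0" | "num_leaves H = 1" | "num_leaves H = 2" | "3 \<le> num_leaves H" by linarith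
    then show ?thesis
    proof cases
      case 1
      then have "{v \<in> verts H. vdegree H v = 1} = {}" unfolding num_leaves_eq by simp
      then have deg: "3 \<le> vdegree H v" if "v \<in> verts H" for v using three[OF that] that by blast
      have len0: "total_length H h = (H.k + 1) * diam H h" using len 1 by simp
      show ?thesis
      proof (rule H.leafless_extremal[OF infinite_UNIV_nat infinite_UNIV_nat _ len0])
        show "3 \<le> vdegree H v" if "v \<in> verts H" for v by (rule deg[OF that])
      next
        fix u q assume uq: "u \<noteq> q" "verts H = {u, q}"
          "\<And>e. e \<in> arcs H \<Longrightarrow> joins H e u q \<and> h e = diam H h"
        have "\<exists>k. is_medusa H h (diam H h) 0 k 0"
          by (rule H.is_medusa_0[OF uq(1,2) _ D]) (use uq(3) in blast)
        then show ?thesis by blast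
      qed
    next
      case 2
      then obtain x where x: "{v \<in> verts H. vdegree H v = 1} = {x}"
        unfolding num_leaves_eq by (rule card_1_singletonE)
      then have xH: "x \<in> verts H" "vdegree H x = 1" by auto
      obtain p y where p: "pendant H p y x" using H.ex_pendant[OF xH] by blast
      have deg: "3 \<le> vdegree H v" if "v \<in> verts H" "v \<noteq> x" for v using three[OF that(1)] that x by blast
      \<comment> \<open>One leaf never gives equality: the bound falls short by the positive length
        of the pendant arc.\<close>
      have "total_length H h \<le> (H.k + 1) * diam H h - h p"
        by (rule H.one_leaf_length[OF infinite_UNIV_nat infinite_UNIV_nat p xH(2) deg order_refl])
      moreover have "total_length H h = (H.k + 1) * diam H h" using len 2 by simp
      ultimately show ?thesis using H.pendant_verts(5)[OF p] by simp
    next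
      case 3
      have len': "total_length H h = (H.k + 1) * diam H h" using len 3 by simp
      show ?thesis
      \<comment> \<open>A single segment has two leaves but belongs to the \<open>0\<close>-Medusa
        graphs, with \<open>k = 0\<close>.\<close>
      proof (cases "\<exists>p y x. pendant H p y x \<and> arcs H = {p}")
        case True
        then obtain p y x where p: "pendant H p y x" "arcs H = {p}" by blast
        note s = H.single_arc[OF p] and pv = H.pendant_verts[OF p(1)]
        have "h p = diam H h" using len' s by simp
        moreover have "joins H p x y" using p(1) joins_commute[of H p x y] by (simp add: pendant_def)
        ultimately have "\<exists>k. is_medusa H h (diam H h) 0 k 0"
          using H.is_medusa_0[OF pv(4)[symmetric] s(1) _ D] p(2) by simp
        then show ?thesis by blast
      next
        case False
        obtain lam k where "0 < lam" "lam \<le> diam H h / 2" "is_medusa H h (diam H h) lam k 2"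
          using extremal_two_leaves[OF H(1) red 3 False len'] by blast
        \<comment> \<open>For \<open>lam = diam H h / 2\<close> the graph falls into the third
          class, with \<open>l = 2\<close>.\<close>
        then show ?thesis by (cases "lam = diam H h / 2") auto
      qed
    next
      case 4
      then have len': "total_length H h = (H.k + real (num_leaves H) / 2) * diam H h"
        using len by (simp add: max_def)
      let ?L = "{v \<in> verts H. vdegree H v = 1}"
      obtain y p where star: "y \<notin> ?L" "verts H = insert y ?L"
        "\<forall>x\<in>?L. pendant H (p x) y x \<and> h (p x) = diam H h / 2"
        "\<forall>e\<in>arcs H - p ` ?L. joins H e y y \<and> h e = diam H h"
        using many_leaf_star[OF H(1) red 4 order_refl len'] by blast
      have L: "finite ?L" "num_leaves H = card ?L" by (simp_all add: num_leaves_eq)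
      have "0 < card ?L" using 4 L(2) by linarith
      then have "?L \<noteq> {}" unfolding card_gt_0_iff by blast
      from is_medusa_half[OF H(1) star(1,2) L(1) this L(2) star(3,4) D]
      have "\<exists>k. is_medusa H h (diam H h) (diam H h / 2) k (card ?L)" .
      moreover have "2 \<le> card ?L" using 4 L(2) by simp
      ultimately show ?thesis by blast
    qed
  qed
  then show ?thesis unfolding H(4) using is_medusa_isometric[OF H(2)] by blast
qed

text \<open>The three invariants are read off from the standard model and carried over by isometry
  invariance, for which the types have to be infinite.\<close>

lemma medusa_length:
  fixes G :: "(nat, nat) pre_digraph"
  assumes G: "metric_graph G w" and med: "is_medusa G w D lam k l" and ne: "lam = D / 2 \<longrightarrow> 0 < k \<or> 0 < l"
  shows "cyc G = int k" "total_length G w = D - 2 * lam + real k * D + real l * lam"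
    "0 < lam \<Longrightarrow> num_leaves G = l" "lam = 0 \<Longrightarrow> l = 0 \<Longrightarrow> num_leaves G \<le> 2"
proof -
  obtain a where par: "medusa_parameters D lam k l a"
    and iso: "isometric G w (medusa D lam k l a) (medusa_length D lam l a)"
    using med by (auto simp: is_medusa_def)
  have range: "medusa_range D lam l a" using par by (simp add: medusa_parameters_iff)
  have M: "metric_graph (medusa D lam k l a) (medusa_length D lam l a)"
    using medusa_metric_graph[OF range ne] .
  have cyc: "cyc (medusa D lam k l a) = cyc G"
    by (rule isometric_cyc[OF G M iso infinite_UNIV_nat infinite_UNIV_nat infinite_medusa_types])
  have leaves: "num_leaves (medusa D lam k l a) = num_leaves G"
    by (rule isometric_num_leaves[OF G M iso infinite_UNIV_nat infinite_UNIV_nat infinite_medusa_types])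
  have len: "total_length (medusa D lam k l a) (medusa_length D lam l a) = total_length G w"
    by (rule isometric_total_length[OF G M iso infinite_medusa_types])
  show "cyc G = int k" using cyc medusa_cyc by simp
  show "total_length G w = D - 2 * lam + real k * D + real l * lam"
    using len medusa_total_length[OF range, of k] by (simp add: pendants_def split: if_splits)
  show "0 < lam \<Longrightarrow> num_leaves G = l" using par leaves by (simp add: medusa_parameters_iff)
  show "lam = 0 \<Longrightarrow> l = 0 \<Longrightarrow> num_leaves G \<le> 2" using leaves num_leaves_medusa_0[of D k a] by simp
qed

theorem theorem8:
  fixes G :: "('v, 'e) pre_digraph" and w :: "'e \<Rightarrow> real"
  assumes "metric_graph G w"
  shows "total_length G w = (real_of_int (cyc G) + max 1 (real (num_leaves G) / 2)) * diam G w
    \<longleftrightarrow>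
      (\<exists>k. is_medusa G w (diam G w) 0 k 0)
    \<or> (\<exists>lam k. 0 < lam \<and> lam < diam G w / 2 \<and> is_medusa G w (diam G w) lam k 2)
    \<or> (\<exists>k l. 2 \<le> l \<and> is_medusa G w (diam G w) (diam G w / 2) k l)"
proof (rule nat_model[OF assms])
  fix H :: "(nat, nat) pre_digraph" and h
  assume H: "metric_graph H h" "isometric G w H h" "total_length H h = total_length G w"
    "cyc H = cyc G" "num_leaves H = num_leaves G"
  interpret H: metric_graph H h by (rule H(1))
  have D: "diam H h = diam G w" using isometric_diam[OF H(2)] .
  have D0: "0 < diam G w" using H.diam_pos D by simp
  \<comment> \<open>Being a Medusa graph is defined up to isometry, so both sides of the equivalence
    can be moved to \<open>H\<close>.\<close>
  have med: "is_medusa G w d lam k l \<longleftrightarrow> is_medusa H h d lam k l" for d lam k l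
    using is_medusa_isometric[OF H(2)] is_medusa_isometric[OF isometric_sym[OF H(2)]] by blast
  have "total_length H h = (real_of_int (cyc H) + max 1 (real (num_leaves H) / 2)) * diam H h
    \<longleftrightarrow>
      (\<exists>k. is_medusa H h (diam H h) 0 k 0)
    \<or> (\<exists>lam k. 0 < lam \<and> lam < diam H h / 2 \<and> is_medusa H h (diam H h) lam k 2)
    \<or> (\<exists>k l. 2 \<le> l \<and> is_medusa H h (diam H h) (diam H h / 2) k l)" (is "?len \<longleftrightarrow> ?medusa")
  proof
    assume ?len
    then show ?medusa by (rule extremal_is_medusa[OF H(1)])
  next
    assume ?medusa
    then show ?len
    proof (elim disjE exE conjE)
      fix k assume m: "is_medusa H h (diam H h) 0 k 0"
      note M = medusa_length[OF H(1) m]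
      have "max 1 (real (num_leaves H) / 2) = 1" using M(4) D0 D by simp
      then show ?len using M(1,2) D0 D by (simp add: algebra_simps)
    next
      fix lam k assume l: "0 < lam" "lam < diam H h / 2" and m: "is_medusa H h (diam H h) lam k 2"
      note M = medusa_length[OF H(1) m]
      \<comment> \<open>The two pendant edges make up for the \<open>2 * lam\<close> missing from
        the base edge.\<close>
      show ?len using M(1-3) l by (simp add: algebra_simps)
    next
      fix k l assume l: "2 \<le> l" and m: "is_medusa H h (diam H h) (diam H h / 2) k l"
      note M = medusa_length[OF H(1) m]
      \<comment> \<open>The base edge has length zero, and each pendant edge contributes half the
        diameter.\<close>
      show ?len using M(1-3) l D0 D by (simp add: algebra_simps max_def)
    qed
  qed
  then show ?thesis unfolding med H(3-5) D .
qed

end
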